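(* Consider the Gaussian one-to-many interference channel, with users ordered so that $\mathtt{INR}_{i+1}>\mathtt{INR}_i$ for $1\le i\le K-1$ and with $\mathtt{INR}_1>1$. Let $\mathcal R$ be the region defined by the individual constraints $r_i\le\log(1+\mathtt{SNR}_i)$, $0\le i\le K$, and, for every nonempty $S\subseteq\{1,\dots,K\}$, relabeled as $S=\{1,\dots,m\}$ so that $\mathtt{INR}$ increases with the index, the sum-rate constraint $$r_0+\sum_{i=1}^m r_i\le\log\Big(1+\frac{\mathtt{SNR}_0}{1+\mathtt{INR}_m}\Big)+\log(1+\mathtt{SNR}_1+\mathtt{INR}_1)+\sum_{i=2}^m\log\Big(1+\mathtt{SNR}_i+\frac{\mathtt{INR}_i}{1+\mathtt{INR}_{i-1}}\Big).$$ Then the capacity region $\mathcal C$ satisfies $\mathcal C\subseteq\mathcal R$, and $\mathcal C$ is within $(2K+1,1,\dots,1)$ bits of $\mathcal R$: for every $(r_0,\dots,r_K)\in\mathcal R$, the point $\big((r_0-(2K+1))^+,(r_1-1)^+,\dots,(r_K-1)^+\big)\in\mathcal C$.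
   Context: Gaussian one-to-many interference channel with users $0,\dots,K$: $y_0=h_{00}x_0+z_0$ and $y_i=h_{ii}x_i+h_{i0}x_0+z_i$ for $1\le i\le K$, with complex inputs subject to average power constraints $\frac1N\mathbb E\|x_i^N\|^2\le P_i$ and independent noises $z_i\sim\mathcal{CN}(0,N_0)$ i.i.d. over time. $\mathtt{SNR}_i=|h_{ii}|^2P_i/N_0$ ($0\le i\le K$), $\mathtt{INR}_i=|h_{i0}|^2P_0/N_0$ ($1\le i\le K$). Each receiver $i$ decodes the independent message of transmitter $i$; capacity region = closure of achievable rate tuples. Logs base 2, $(a)^+=\max(a,0)$. *)

theory Defs
  imports "HOL-Probability.Probability"
begin

text \<open>Gaussian one-to-many interference channel with users 0..K.
  Direct gains: hdir i = h_ii (hdir 0 = h_00); cross gains: hc i = h_i0 (1 \<le> i \<le> K).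
  Powers P i, noise variance n0 (each noise sample is CN(0,n0)).\<close>

definition SNR :: "(nat \<Rightarrow> complex) \<Rightarrow> (nat \<Rightarrow> real) \<Rightarrow> real \<Rightarrow> nat \<Rightarrow> real" where
  "SNR hdir P n0 i = (cmod (hdir i))\<^sup>2 * P i / n0"

definition INR :: "(nat \<Rightarrow> complex) \<Rightarrow> (nat \<Rightarrow> real) \<Rightarrow> real \<Rightarrow> nat \<Rightarrow> real" where
  "INR hc P n0 i = (cmod (hc i))\<^sup>2 * P 0 / n0"

definition cgauss :: "real \<Rightarrow> complex measure" where
  "cgauss n0 = density lborel (\<lambda>z. ennreal (exp (- (cmod z)\<^sup>2 / n0) / (pi * n0)))"

definition noise_space :: "nat \<Rightarrow> nat \<Rightarrow> real \<Rightarrow> (nat \<times> nat \<Rightarrow> complex) measure" where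
  "noise_space K N n0 = PiM ({..K} \<times> {..<N}) (\<lambda>_. cgauss n0)"

definition out_space :: "nat \<Rightarrow> (nat \<Rightarrow> complex) measure" where
  "out_space N = PiM {..<N} (\<lambda>_. borel)"

text \<open>Received block at receiver i for messages w, encoders enc (enc i m t = symbol of
  transmitter i for message m at time t), noise realisation z.\<close>
definition rx :: "nat \<Rightarrow> (nat \<Rightarrow> complex) \<Rightarrow> (nat \<Rightarrow> complex) \<Rightarrow>
    (nat \<Rightarrow> nat \<Rightarrow> nat \<Rightarrow> complex) \<Rightarrow> (nat \<Rightarrow> nat) \<Rightarrow> (nat \<times> nat \<Rightarrow> complex) \<Rightarrow> nat \<Rightarrow> (nat \<Rightarrow> complex)" where
  "rx N hdir hc enc w z i = restrict (\<lambda>t.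
      if i = 0 then hdir 0 * enc 0 (w 0) t + z (0, t)
      else hdir i * enc i (w i) t + hc i * enc 0 (w 0) t + z (i, t)) {..<N}"

definition err_prob :: "nat \<Rightarrow> nat \<Rightarrow> (nat \<Rightarrow> complex) \<Rightarrow> (nat \<Rightarrow> complex) \<Rightarrow> real \<Rightarrow>
    (nat \<Rightarrow> nat) \<Rightarrow> (nat \<Rightarrow> nat \<Rightarrow> nat \<Rightarrow> complex) \<Rightarrow> (nat \<Rightarrow> (nat \<Rightarrow> complex) \<Rightarrow> nat) \<Rightarrow> real" where
  "err_prob K N hdir hc n0 M enc dec =
     (\<Sum>w\<in>PiE {..K} (\<lambda>i. {..<M i}).
        measure (noise_space K N n0)
          {z \<in> space (noise_space K N n0). \<exists>i\<le>K. dec i (rx N hdir hc enc w z i) \<noteq> w i})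
     / (\<Prod>i\<le>K. real (M i))"

definition good_code :: "nat \<Rightarrow> (nat \<Rightarrow> complex) \<Rightarrow> (nat \<Rightarrow> complex) \<Rightarrow> (nat \<Rightarrow> real) \<Rightarrow> real \<Rightarrow>
    nat \<Rightarrow> (nat \<Rightarrow> nat) \<Rightarrow> (nat \<Rightarrow> nat \<Rightarrow> nat \<Rightarrow> complex) \<Rightarrow> (nat \<Rightarrow> (nat \<Rightarrow> complex) \<Rightarrow> nat) \<Rightarrow> real \<Rightarrow> bool" where
  "good_code K hdir hc P n0 N M enc dec eps \<longleftrightarrow>
     (\<forall>i\<le>K. M i \<ge> 1) \<and>
     (\<forall>i\<le>K. (\<Sum>m<M i. \<Sum>t<N. (cmod (enc i m t))\<^sup>2) / real (M i) \<le> real N * P i) \<and>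
     (\<forall>i\<le>K. dec i \<in> measurable (out_space N) (count_space UNIV)) \<and>
     err_prob K N hdir hc n0 M enc dec \<le> eps"

definition achievable :: "nat \<Rightarrow> (nat \<Rightarrow> complex) \<Rightarrow> (nat \<Rightarrow> complex) \<Rightarrow> (nat \<Rightarrow> real) \<Rightarrow> real \<Rightarrow>
    (nat \<Rightarrow> real) set" where
  "achievable K hdir hc P n0 = {r. (\<forall>i>K. r i = 0) \<and> (\<forall>i\<le>K. r i \<ge> 0) \<and>
     (\<forall>eps>0. \<exists>N0. \<forall>N\<ge>N0. \<exists>M enc dec.
        (\<forall>i\<le>K. real (M i) \<ge> 2 powr (real N * r i)) \<and> good_code K hdir hc P n0 N M enc dec eps)}"

text \<open>Capacity region: closure of the achievable set (product topology; coordinates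
  beyond K are identically 0).\<close>
definition capacity_region :: "nat \<Rightarrow> (nat \<Rightarrow> complex) \<Rightarrow> (nat \<Rightarrow> complex) \<Rightarrow> (nat \<Rightarrow> real) \<Rightarrow> real \<Rightarrow>
    (nat \<Rightarrow> real) set" where
  "capacity_region K hdir hc P n0 = closure (achievable K hdir hc P n0)"

text \<open>Right-hand side of the sum-rate constraint for S, with S listed in increasing
  index (= increasing INR) order as s_1 < ... < s_m.\<close>
definition sum_bound :: "(nat \<Rightarrow> complex) \<Rightarrow> (nat \<Rightarrow> complex) \<Rightarrow> (nat \<Rightarrow> real) \<Rightarrow> real \<Rightarrow> nat set \<Rightarrow> real" where
  "sum_bound hdir hc P n0 S =
     (let ss = sorted_list_of_set S; m = length ss;
          snr = SNR hdir P n0; inr = INR hc P n0 in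
      log 2 (1 + snr 0 / (1 + inr (ss ! (m - 1))))
      + log 2 (1 + snr (ss ! 0) + inr (ss ! 0))
      + (\<Sum>j\<in>{1..<m}. log 2 (1 + snr (ss ! j) + inr (ss ! j) / (1 + inr (ss ! (j - 1))))))"

definition outer_region :: "nat \<Rightarrow> (nat \<Rightarrow> complex) \<Rightarrow> (nat \<Rightarrow> complex) \<Rightarrow> (nat \<Rightarrow> real) \<Rightarrow> real \<Rightarrow>
    (nat \<Rightarrow> real) set" where
  "outer_region K hdir hc P n0 = {r. (\<forall>i>K. r i = 0) \<and>
     (\<forall>i\<le>K. r i \<le> log 2 (1 + SNR hdir P n0 i)) \<and>
     (\<forall>S. S \<subseteq> {1..K} \<and> S \<noteq> {} \<longrightarrow> r 0 + (\<Sum>i\<in>S. r i) \<le> sum_bound hdir hc P n0 S)}"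

end

theory Submission
  imports Defs
begin

text \<open>
  Converse: no entropies are needed. For each decoded message one writes down a positive function of messages and noise
  with mean at most 2: the factor \<open>M\<^sub>i\<close> when decoding succeeds (1 otherwise), times a Gaussian test density of the output
  given suitable side information, divided by its true density. In the outer bound for
  \<open>s\<^sub>1 < \<dots> < s\<^sub>m\<close>, receiver \<open>s\<^sub>k\<close> gets the interference plus noise of the
  receivers \<open>s\<^sub>1, \<dots>, s\<^sub>k\<^sub>-\<^sub>1\<close>, receiver 0 that of all of them. Then all mixture
  densities cancel in the product of these functions, whose logarithm is an explicit quadratic; Jensen's
  inequality gives the bound.

  Achievability: user 0 superposes \<open>K + 1\<close> Gaussian layers with powers such that the layers
  \<open>i + 1, \<dots>, K + 1\<close> together reach receiver \<open>i\<close> at the noise level, costing one bit. Receiver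
  \<open>i\<close> decodes the layers \<open>1, \<dots>, i\<close> and its own message by minimum distance. The layer rates exist because a
  system of difference constraints is solvable up to the cheapest chain, and the chains are exactly the sets in the outer bound.
\<close>

section \<open>Complex Gaussian measures\<close>

text \<open>The codebooks are arbitrary and the decoders arbitrary measurable maps, so the outputs
  are Gaussian mixtures about which nothing explicit is known. Mixtures therefore enter the converse
  only as ratios of densities against the noise, arranged so that every test function has a bounded
  mean for any code. Of the codewords only second moments remain, and those the power constraint
  controls. In the coding part the candidates are exponentially many, while the law of large numbers
  used is a mere second-moment bound. The atypical event is hence made to depend only on which
  components a candidate gets wrong, and there are boundedly many such patterns; only the
  exponentially small pairwise errors are summed over candidates. The slack in power, typicality and
  rate is paid from one small \<delta>, which the closure in the capacity region absorbs. What is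
  left is one bit for each receiver in a chain, so user 0 loses at most K bits, within the 2K + 1 of
  the claim.\<close>

lemma Basis_prod_normal_density:
  fixes z :: complex
  assumes "v > 0"
  shows "exp (- (cmod z)\<^sup>2 / v) / (pi * v) = (\<Prod>b\<in>Basis. normal_density 0 (sqrt (v/2)) (z \<bullet> b))"
proof -
  have "(\<Prod>b\<in>Basis. normal_density 0 (sqrt (v/2)) (z \<bullet> b)) =
      normal_density 0 (sqrt (v/2)) (Re z) * normal_density 0 (sqrt (v/2)) (Im z)"
    by (simp add: Basis_complex_def inner_complex_def)
  also have "\<dots> = (1 / sqrt (pi * v)) * (1 / sqrt (pi * v)) * (exp (- (Re z)\<^sup>2 / v) * exp (- (Im z)\<^sup>2 / v))"
    using assms by (simp add: normal_density_def)
  also have "\<dots> = exp (- (cmod z)\<^sup>2 / v) / (pi * v)"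
    using assms by (simp add: mult_exp_exp cmod_power2 add_divide_distrib diff_divide_distrib)
  finally show ?thesis by simp
qed

lemma sets_cgauss [measurable_cong, simp]: "sets (cgauss v) = sets borel"
  by (simp add: cgauss_def)

lemma space_cgauss [simp]: "space (cgauss v) = UNIV"
  by (simp add: cgauss_def)

lemma nn_integral_normal_density:
  assumes "s > 0" shows "(\<integral>\<^sup>+x. ennreal (normal_density m s x) \<partial>lborel) = 1"
  using assms by (subst nn_integral_eq_integral) auto

lemma nn_integral_complex_gauss:
  assumes v: "v > 0"
  shows "(\<integral>\<^sup>+z. ennreal (exp (- (cmod (z - c))\<^sup>2 / v) / (pi * v)) \<partial>lborel) = 1"
proof -
  have "(\<integral>\<^sup>+z. ennreal (exp (- (cmod (z - c))\<^sup>2 / v) / (pi * v)) \<partial>lborel) =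
      (\<integral>\<^sup>+z. ennreal (exp (- (cmod (z - c))\<^sup>2 / v) / (pi * v)) \<partial>distr lborel borel ((+) c))"
    by (simp add: lborel_distr_plus)
  also have "\<dots> = (\<integral>\<^sup>+z. ennreal (exp (- (cmod z)\<^sup>2 / v) / (pi * v)) \<partial>lborel)"
    by (subst nn_integral_distr) auto
  also have "\<dots> = (\<integral>\<^sup>+z. (\<Prod>b\<in>Basis. ennreal (normal_density 0 (sqrt (v/2)) (z \<bullet> b))) \<partial>(lborel :: complex measure))"
    by (simp only: Basis_prod_normal_density[OF v]) (simp add: prod_ennreal)
  also have "\<dots> = (\<Prod>b\<in>(Basis::complex set). (\<integral>\<^sup>+x. ennreal (normal_density 0 (sqrt (v/2)) x) \<partial>lborel))"
    by (rule nn_integral_lborel_prod) auto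
  also have "\<dots> = 1"
    using v by (simp add: nn_integral_normal_density)
  finally show ?thesis .
qed

lemma nn_integral_cgauss:
  assumes [measurable]: "f \<in> borel_measurable borel"
  shows "(\<integral>\<^sup>+z. f z \<partial>cgauss v) = (\<integral>\<^sup>+z. ennreal (exp (- (cmod z)\<^sup>2 / v) / (pi * v)) * f z \<partial>lborel)"
  unfolding cgauss_def by (subst nn_integral_density) auto

lemma prob_space_cgauss:
  assumes "v > 0" shows "prob_space (cgauss v)"
proof
  show "emeasure (cgauss v) (space (cgauss v)) = 1"
    using nn_integral_complex_gauss[OF assms, of 0]
    by (simp add: cgauss_def emeasure_density)
qed

lemma nn_integral_cgauss_sq:
  assumes v: "v > 0"
  shows "(\<integral>\<^sup>+z. ennreal ((cmod z)\<^sup>2) \<partial>cgauss v) = ennreal v"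
proof -
  let ?n = "normal_density 0 (sqrt (v/2))"
  have one: "(\<integral>\<^sup>+z. ennreal ((z \<bullet> b)\<^sup>2) \<partial>cgauss v) = ennreal (v/2)" if b: "b \<in> Basis" for b :: complex
  proof -
    \<comment> \<open>The square sits on the single coordinate \<open>b\<close>, so that the
      integrand stays a product over the basis: one factor contributes \<open>v / 2\<close>, the
      other one total mass 1.\<close>
    define f where "f b' x = (if b' = b then x\<^sup>2 * ?n x else ?n x)" for b' :: complex and x :: real
    have f[measurable]: "f b' \<in> borel_measurable borel" for b'
      unfolding f_def by measurable
    have pr: "(\<Prod>b'\<in>Basis. f b' (z \<bullet> b')) = (z \<bullet> b)\<^sup>2 * (\<Prod>b'\<in>Basis. ?n (z \<bullet> b'))" for z
    proof -
      have "(\<Prod>b'\<in>Basis. f b' (z \<bullet> b')) = (\<Prod>b'\<in>Basis. (if b' = b then (z \<bullet> b)\<^sup>2 else 1) * ?n (z \<bullet> b'))"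
        by (rule prod.cong) (auto simp: f_def)
      then show ?thesis using b by (simp add: prod.distrib)
    qed
    have "(\<integral>\<^sup>+z. ennreal ((z \<bullet> b)\<^sup>2) \<partial>cgauss v) = (\<integral>\<^sup>+z. (\<Prod>b'\<in>Basis. ennreal (f b' (z \<bullet> b'))) \<partial>lborel)"
    proof (subst nn_integral_cgauss, simp, rule nn_integral_cong)
      fix z :: complex
      have "(\<Prod>b'\<in>Basis. ennreal (f b' (z \<bullet> b'))) = ennreal (\<Prod>b'\<in>Basis. f b' (z \<bullet> b'))"
        by (rule prod_ennreal) (simp add: f_def)
      then show "ennreal (exp (- (cmod z)\<^sup>2 / v) / (pi * v)) * ennreal ((z \<bullet> b)\<^sup>2) = (\<Prod>b'\<in>Basis. ennreal (f b' (z \<bullet> b')))"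
        unfolding Basis_prod_normal_density[OF v] pr by (simp add: ennreal_mult' mult.commute)
    qed
    also have "\<dots> = (\<Prod>b'\<in>Basis. (\<integral>\<^sup>+x. ennreal (f b' x) \<partial>lborel))"
      by (rule nn_integral_lborel_prod) auto
    also have "\<dots> = (\<Prod>b'\<in>Basis. if b' = b then ennreal (v/2) else 1)"
    proof (rule prod.cong, goal_cases)
      case (2 b')
      have "has_bochner_integral lborel (\<lambda>x. ?n x * x\<^sup>2) (v/2)"
        using normal_moment_even[of "sqrt (v/2)" 0 1] v by simp
      then have "integrable lborel (\<lambda>x. ?n x * x\<^sup>2)" "integral\<^sup>L lborel (\<lambda>x. ?n x * x\<^sup>2) = v/2"
        by (auto simp only: has_bochner_integral_iff)
      then have "(\<integral>\<^sup>+x. ennreal (?n x * x\<^sup>2) \<partial>lborel) = ennreal (v/2)"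
        by (subst nn_integral_eq_integral) (assumption, simp, simp only:)
      then show ?case using v by (simp add: f_def mult.commute nn_integral_normal_density)
    qed simp
    also have "\<dots> = ennreal (v/2)" using b by simp
    finally show ?thesis .
  qed
  have "(cmod z)\<^sup>2 = (z \<bullet> 1)\<^sup>2 + (z \<bullet> \<i>)\<^sup>2" for z
    by (simp add: cmod_power2 inner_complex_def)
  then have "(\<integral>\<^sup>+z. ennreal ((cmod z)\<^sup>2) \<partial>cgauss v) = (\<integral>\<^sup>+z. ennreal ((z \<bullet> 1)\<^sup>2) + ennreal ((z \<bullet> \<i>)\<^sup>2) \<partial>cgauss v)"
    by (simp add: ennreal_plus)
  also have "\<dots> = ennreal (v/2) + ennreal (v/2)"
    using one[of 1] one[of \<i>] by (subst nn_integral_add) (auto simp: Basis_complex_def)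
  also have "\<dots> = ennreal v" using v by (simp flip: ennreal_plus)
  finally show ?thesis .
qed

text \<open>Completing the square in \<open>x\<close>. Averaging over a fresh Gaussian symbol
  preserves the form of the integrand and only weakens its rate from \<open>l\<close> to
  \<open>l / (1 + l * (cmod a)\<^sup>2 * v)\<close>; because of this closure, codeword components
  can later be integrated out one after another.\<close>

lemma cgauss_exp_quad:
  assumes v: "v > 0" and l: "l \<ge> 0"
  shows "(\<integral>\<^sup>+x. ennreal (exp (- l * (cmod (y - a * x))\<^sup>2)) \<partial>cgauss v) =
    ennreal (1 / (1 + l * (cmod a)\<^sup>2 * v) * exp (- (l / (1 + l * (cmod a)\<^sup>2 * v)) * (cmod y)\<^sup>2))"
proof -
  define D where "D = 1 + l * (cmod a)\<^sup>2 * v"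
  have D: "D > 0" using v l by (simp add: D_def add_pos_nonneg)
  \<comment> \<open>For positive \<open>l\<close>, \<open>v'\<close> and \<open>c\<close> are the
    posterior variance and mean of \<open>x\<close>, given the observation \<open>y\<close> of
    \<open>a * x\<close> in Gaussian noise of variance \<open>1 / l\<close>.\<close>
  define v' where "v' = v / D"
  have v': "v' > 0" using v D by (simp add: v'_def)
  define c where "c = of_real (v' * l) * cnj a * y"
  have quad: "(cmod x)\<^sup>2 / v + l * (cmod (y - a * x))\<^sup>2 = (cmod (x - c))\<^sup>2 / v' + (l / D) * (cmod y)\<^sup>2" for x
  proof -
    have 1: "(cmod (y - a * x))\<^sup>2 = (cmod y)\<^sup>2 - 2 * Re (cnj a * y * cnj x) + (cmod a)\<^sup>2 * (cmod x)\<^sup>2"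
      unfolding cmod_power2 by (simp add: power2_eq_square algebra_simps)
    have 2: "(cmod (x - c))\<^sup>2 = (cmod x)\<^sup>2 - 2 * (v' * l) * Re (cnj a * y * cnj x) + (v' * l)\<^sup>2 * ((cmod a)\<^sup>2 * (cmod y)\<^sup>2)"
      unfolding cmod_power2 c_def by (simp add: power2_eq_square algebra_simps)
    have 3: "1 / v' = 1 / v + l * (cmod a)\<^sup>2"
      using v D by (simp add: v'_def D_def field_simps)
    have 4: "l - l / D = v' * l\<^sup>2 * (cmod a)\<^sup>2"
      using D by (simp add: v'_def field_simps) (simp add: D_def algebra_simps power2_eq_square)
    have "(cmod (x - c))\<^sup>2 / v' = (cmod x)\<^sup>2 * (1 / v') - 2 * l * Re (cnj a * y * cnj x) + v' * l\<^sup>2 * (cmod a)\<^sup>2 * (cmod y)\<^sup>2"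
      using v' unfolding 2 by (simp add: field_simps power2_eq_square)
    also have "\<dots> = (cmod x)\<^sup>2 * (1 / v + l * (cmod a)\<^sup>2) - 2 * l * Re (cnj a * y * cnj x) + (l - l / D) * (cmod y)\<^sup>2"
      by (simp only: 3 4)
    finally show ?thesis unfolding 1 by (simp add: algebra_simps)
  qed
  have "(\<integral>\<^sup>+x. ennreal (exp (- l * (cmod (y - a * x))\<^sup>2)) \<partial>cgauss v) =
      (\<integral>\<^sup>+x. ennreal (1 / D * exp (- (l / D) * (cmod y)\<^sup>2)) * ennreal (exp (- (cmod (x - c))\<^sup>2 / v') / (pi * v')) \<partial>lborel)"
  proof (subst nn_integral_cgauss, simp, rule nn_integral_cong)
    fix x
    have "exp (- (cmod x)\<^sup>2 / v) / (pi * v) * exp (- l * (cmod (y - a * x))\<^sup>2) =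
        exp (- ((cmod x)\<^sup>2 / v + l * (cmod (y - a * x))\<^sup>2)) / (pi * v)"
      by (simp add: exp_diff exp_minus exp_add field_simps)
    also have "\<dots> = 1 / D * exp (- (l / D) * (cmod y)\<^sup>2) * (exp (- (cmod (x - c))\<^sup>2 / v') / (pi * v'))"
      unfolding quad minus_add_distrib exp_add using v D by (simp add: v'_def)
    finally show "ennreal (exp (- (cmod x)\<^sup>2 / v) / (pi * v)) * ennreal (exp (- l * (cmod (y - a * x))\<^sup>2)) =
        ennreal (1 / D * exp (- (l / D) * (cmod y)\<^sup>2)) * ennreal (exp (- (cmod (x - c))\<^sup>2 / v') / (pi * v'))"
      using v D v' by (simp flip: ennreal_mult)
  qed
  also have "\<dots> = ennreal (1 / D * exp (- (l / D) * (cmod y)\<^sup>2))"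
    by (subst nn_integral_cmult) (use nn_integral_complex_gauss[OF v', of c] in auto)
  finally show ?thesis by (simp add: D_def)
qed

definition ell :: "real \<Rightarrow> complex \<Rightarrow> complex \<Rightarrow> real" where
  "ell v c z = exp (((cmod z)\<^sup>2 - (cmod (z - c))\<^sup>2) / v)"

lemma ell_pos [simp]: "ell v c z > 0" "ell v c z \<ge> 0" "ell v c z \<noteq> 0"
  by (simp_all add: ell_def)

lemma measurable_ell [measurable]: "ell v c \<in> borel_measurable borel"
  unfolding ell_def by measurable

text \<open>Cameron-Martin formula for one coordinate: translating the argument is traded for the
  density of the translated Gaussian, so a received signal becomes pure noise under a
  weight.\<close>

lemma cgauss_shift:
  assumes v: "v > 0" and [measurable]: "F \<in> borel_measurable borel"
  shows "(\<integral>\<^sup>+z. F (z + c) \<partial>cgauss v) = (\<integral>\<^sup>+z. F z * ennreal (ell v c z) \<partial>cgauss v)"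
proof -
  have "(\<integral>\<^sup>+z. F z * ennreal (ell v c z) \<partial>cgauss v) =
      (\<integral>\<^sup>+z. ennreal (exp (- (cmod (z - c))\<^sup>2 / v) / (pi * v)) * F z \<partial>lborel)"
  proof (subst nn_integral_cgauss, simp, rule nn_integral_cong)
    fix z
    have "exp (- (cmod z)\<^sup>2 / v) / (pi * v) * ell v c z = exp (- (cmod (z - c))\<^sup>2 / v) / (pi * v)"
      using v by (simp add: ell_def mult_exp_exp diff_divide_distrib)
    then show "ennreal (exp (- (cmod z)\<^sup>2 / v) / (pi * v)) * (F z * ennreal (ell v c z)) =
        ennreal (exp (- (cmod (z - c))\<^sup>2 / v) / (pi * v)) * F z"
      using v by (simp add: mult.left_commute[of _ "F z"] mult.commute[of _ "F z"] flip: ennreal_mult)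
  qed
  also have "\<dots> = (\<integral>\<^sup>+z. ennreal (exp (- (cmod (z - c))\<^sup>2 / v) / (pi * v)) * F z \<partial>distr lborel borel ((+) c))"
    by (simp add: lborel_distr_plus)
  also have "\<dots> = (\<integral>\<^sup>+z. ennreal (exp (- (cmod z)\<^sup>2 / v) / (pi * v)) * F (c + z) \<partial>lborel)"
    by (subst nn_integral_distr) auto
  also have "\<dots> = (\<integral>\<^sup>+z. F (z + c) \<partial>cgauss v)"
    by (subst nn_integral_cgauss) (auto simp: add.commute)
  finally show ?thesis by simp
qed

lemma integrable_cgauss_sq:
  assumes v: "v > 0"
  shows "integrable (cgauss v) (\<lambda>z. (cmod z)\<^sup>2)" and "integral\<^sup>L (cgauss v) (\<lambda>z. (cmod z)\<^sup>2) = v"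
proof -
  have "has_bochner_integral (cgauss v) (\<lambda>z. (cmod z)\<^sup>2) v"
    using v by (intro has_bochner_integral_nn_integral) (auto simp: nn_integral_cgauss_sq)
  then show "integrable (cgauss v) (\<lambda>z. (cmod z)\<^sup>2)" "integral\<^sup>L (cgauss v) (\<lambda>z. (cmod z)\<^sup>2) = v"
    by (auto simp: has_bochner_integral_iff)
qed

lemma integrable_cgauss_id:
  assumes v: "v > 0"
  shows "integrable (cgauss v) (\<lambda>z. z)"
proof -
  interpret prob_space "cgauss v" by (rule prob_space_cgauss[OF v])
  have le: "norm z \<le> norm (1 + (cmod z)\<^sup>2)" for z :: complex
    proof -
    have "2 * cmod z \<le> 1 + (cmod z)\<^sup>2" using sum_squares_bound[of 1 "cmod z"] by simp
    then have "cmod z \<le> 1 + (cmod z)\<^sup>2" using norm_ge_zero[of z] by linarith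
    then show ?thesis by simp
  qed
  show ?thesis
  proof (rule Bochner_Integration.integrable_bound)
    show "integrable (cgauss v) (\<lambda>z. 1 + (cmod z)\<^sup>2)"
      by (rule Bochner_Integration.integrable_add[OF integrable_const integrable_cgauss_sq(1)[OF v]])
    show "AE z in cgauss v. norm z \<le> norm (1 + (cmod z)\<^sup>2)"
      by (rule AE_I2) (rule le)
  qed simp
qed

text \<open>The density is even and Lebesgue measure is invariant under negation, so the law equals
  its own reflection.\<close>

lemma integral_cgauss_id:
  assumes v: "v > 0"
  shows "integral\<^sup>L (cgauss v) (\<lambda>z. z) = 0"
proof -
  have unm: "distr lborel borel (uminus :: complex \<Rightarrow> complex) = lborel"
    using lborel_affine[of "-1" "0 :: complex"] by (simp add: density_1)
  have d: "distr (cgauss v) borel uminus = cgauss v"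
  proof (rule measure_eqI)
    fix A assume A: "A \<in> sets (distr (cgauss v) borel uminus)"
    then have [measurable]: "A \<in> sets borel" by simp
    have "emeasure (distr (cgauss v) borel uminus) A = (\<integral>\<^sup>+z. indicator A (- z) \<partial>cgauss v)"
      by (subst nn_integral_indicator[symmetric], simp, subst nn_integral_distr) auto
    also have "\<dots> = (\<integral>\<^sup>+z. ennreal (exp (- (cmod z)\<^sup>2 / v) / (pi * v)) * indicator A (- z) \<partial>lborel)"
      by (subst nn_integral_cgauss) auto
    also have "\<dots> = (\<integral>\<^sup>+z. ennreal (exp (- (cmod z)\<^sup>2 / v) / (pi * v)) * indicator A z \<partial>distr lborel borel uminus)"
      by (subst nn_integral_distr) auto
    also have "\<dots> = (\<integral>\<^sup>+z. ennreal (exp (- (cmod z)\<^sup>2 / v) / (pi * v)) * indicator A z \<partial>lborel)"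
      by (simp only: unm)
    also have "\<dots> = (\<integral>\<^sup>+z. indicator A z \<partial>cgauss v)"
      by (subst nn_integral_cgauss) auto
    finally show "emeasure (distr (cgauss v) borel uminus) A = emeasure (cgauss v) A" by simp
  qed simp
  have "integral\<^sup>L (cgauss v) (\<lambda>z. z) = integral\<^sup>L (distr (cgauss v) borel uminus) (\<lambda>z. z)"
    by (simp only: d)
  also have "\<dots> = - integral\<^sup>L (cgauss v) (\<lambda>z. z)"
    by (subst integral_distr) auto
  finally show ?thesis by simp
qed

text \<open>Only the order \<open>v\<^sup>2\<close> matters, for a variance estimate. Half of the
  exponential decay absorbs the fourth power by \<open>x\<^sup>2 / 2 \<le> exp x\<close>, the other
  half is an unnormalized Gaussian of variance \<open>2 * v\<close>; this yields 16 in place of the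
  exact 2.\<close>

lemma nn_integral_cgauss_fourth:
  assumes v: "v > 0"
  shows "(\<integral>\<^sup>+z. ennreal ((cmod z)^4) \<partial>cgauss v) \<le> ennreal (16 * v\<^sup>2)"
proof -
  have dens: "exp (- (cmod z)\<^sup>2 / v) / (pi * v) * (cmod z)^4 \<le> 16 * v\<^sup>2 * (exp (- (cmod z)\<^sup>2 / (2 * v)) / (pi * (2 * v)))" for z
  proof -
    define x where "x = (cmod z)\<^sup>2 / (2 * v)"
    have x: "x \<ge> 0" using v by (simp add: x_def)
    have "x\<^sup>2 / 2 \<le> exp x" using exp_lower_Taylor_quadratic[OF x] x by simp
    then have "x\<^sup>2 * exp (-x) / 2 \<le> 1" by (simp add: exp_minus field_simps)
    moreover have c4: "(cmod z)^4 = 4 * v\<^sup>2 * x\<^sup>2" using v by (simp add: x_def power_divide power_mult_distrib flip: power_mult)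
    moreover have "exp (- (cmod z)\<^sup>2 / v) = exp (-x) * exp (-x)" using v by (simp add: x_def mult_exp_exp)
    moreover have "exp (- (cmod z)\<^sup>2 / (2 * v)) = exp (-x)" by (simp add: x_def)
    ultimately have "exp (- (cmod z)\<^sup>2 / v) * (cmod z)^4 \<le> 8 * v\<^sup>2 * exp (- (cmod z)\<^sup>2 / (2 * v))"
      using mult_left_mono[of "x\<^sup>2 * exp (-x) / 2" 1 "8 * v\<^sup>2 * exp (-x)"] by (simp add: field_simps)
    then show ?thesis using v by (simp add: field_simps)
  qed
  have "(\<integral>\<^sup>+z. ennreal ((cmod z)^4) \<partial>cgauss v) = (\<integral>\<^sup>+z. ennreal (exp (- (cmod z)\<^sup>2 / v) / (pi * v) * (cmod z)^4) \<partial>lborel)"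
    using v by (subst nn_integral_cgauss, simp, intro nn_integral_cong) (simp flip: ennreal_mult)
  also have "\<dots> \<le> (\<integral>\<^sup>+z. ennreal (16 * v\<^sup>2) * ennreal (exp (- (cmod z)\<^sup>2 / (2 * v)) / (pi * (2 * v))) \<partial>lborel)"
    using v dens by (intro nn_integral_mono) (simp flip: ennreal_mult)
  also have "\<dots> = ennreal (16 * v\<^sup>2)"
    using nn_integral_complex_gauss[of "2 * v" 0] v by (subst nn_integral_cmult) auto
  finally show ?thesis .
qed

section \<open>Products of complex Gaussians\<close>

lemma product_prob_space_cgauss:
  assumes "\<And>i. v i > 0" shows "product_prob_space (\<lambda>i. cgauss (v i))"
  using assms by (intro product_prob_spaceI prob_space_cgauss)

lemma gauss_PiM_shift:
  fixes v :: "'i \<Rightarrow> real" and c :: "'i \<Rightarrow> complex"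
  assumes v: "\<And>i. v i > 0" and "finite I"
    and "F \<in> borel_measurable (PiM I (\<lambda>i. cgauss (v i)))"
  shows "(\<integral>\<^sup>+w. F (\<lambda>i\<in>I. w i + c i) \<partial>PiM I (\<lambda>i. cgauss (v i))) =
    (\<integral>\<^sup>+w. F w * (\<Prod>i\<in>I. ennreal (ell (v i) (c i) (w i))) \<partial>PiM I (\<lambda>i. cgauss (v i)))"
  using assms(2,3)
proof (induction I arbitrary: F rule: finite_induct)
  case empty
  then show ?case by (simp add: PiM_empty nn_integral_count_space_finite)
next
  case (insert i I)
  interpret product_prob_space "\<lambda>i. cgauss (v i)" by (rule product_prob_space_cgauss[where v=v, OF v])
  note [measurable] = insert.prems
  let ?M = "\<lambda>i. cgauss (v i)"
  have upd[measurable]: "(\<lambda>(x, y). x(i := y)) \<in> measurable (PiM I ?M \<Otimes>\<^sub>M cgauss (v i)) (PiM (insert i I) ?M)"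
    using measurable_add_dim[of i I ?M] by simp
  have sh[measurable]: "(\<lambda>x. \<lambda>k\<in>I. x k + c k) \<in> measurable (PiM I ?M) (PiM I ?M)"
    by (rule measurable_restrict) measurable
  have upd_at: "(\<lambda>x. x(i := y)) \<in> measurable (PiM I ?M) (PiM (insert i I) ?M)" for y
    using measurable_compose[OF _ upd, of "\<lambda>x. (x, y)" "PiM I ?M"] by simp
  have upd_f: "(\<lambda>y. x(i := y)) \<in> measurable borel (PiM (insert i I) ?M)" if "x \<in> space (PiM I ?M)" for x
    using measurable_compose[OF _ upd, of "\<lambda>y. (x, y)" "borel"] that by simp
  have ext: "(\<lambda>k\<in>insert i I. (x(i := y)) k + c k) = (\<lambda>k\<in>I. x k + c k)(i := y + c i)" for x y
    using insert.hyps by (auto simp: fun_eq_iff restrict_def)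
  have shm: "(\<lambda>x. \<lambda>k\<in>insert i I. x k + c k) \<in> measurable (PiM (insert i I) ?M) (PiM (insert i I) ?M)"
    by (rule measurable_restrict) measurable
  have "(\<integral>\<^sup>+w. F (\<lambda>k\<in>insert i I. w k + c k) \<partial>PiM (insert i I) ?M) =
      (\<integral>\<^sup>+x. (\<integral>\<^sup>+y. F ((\<lambda>k\<in>I. x k + c k)(i := y + c i)) \<partial>?M i) \<partial>PiM I ?M)"
    using insert.hyps measurable_compose[OF shm insert.prems]
    by (subst product_nn_integral_insert) (simp_all only: ext not_False_eq_True)
  also have "\<dots> = (\<integral>\<^sup>+x. (\<integral>\<^sup>+y. F ((\<lambda>k\<in>I. x k + c k)(i := y)) * ennreal (ell (v i) (c i) y) \<partial>?M i) \<partial>PiM I ?M)"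
  proof (rule nn_integral_cong)
    fix x assume "x \<in> space (PiM I ?M)"
    have "(\<lambda>k\<in>I. x k + c k) \<in> space (PiM I ?M)" by (simp add: space_PiM)
    from measurable_compose[OF upd_f[OF this] insert.prems]
    show "(\<integral>\<^sup>+y. F ((\<lambda>k\<in>I. x k + c k)(i := y + c i)) \<partial>?M i) =
       (\<integral>\<^sup>+y. F ((\<lambda>k\<in>I. x k + c k)(i := y)) * ennreal (ell (v i) (c i) y) \<partial>?M i)"
      by (rule cgauss_shift[OF v])
  qed
  \<comment> \<open>The order of integration is exchanged so that the induction hypothesis applies
    to the coordinates in \<open>I\<close> while the new one is frozen.\<close>
  also have "\<dots> = (\<integral>\<^sup>+y. (\<integral>\<^sup>+x. F ((\<lambda>k\<in>I. x k + c k)(i := y)) * ennreal (ell (v i) (c i) y) \<partial>PiM I ?M) \<partial>?M i)"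
  proof (rule pair_sigma_finite.Fubini'[symmetric])
    show "pair_sigma_finite (PiM I ?M) (?M i)"
      by (auto intro!: pair_sigma_finite.intro prob_space_imp_sigma_finite prob_space_PiM prob_space_cgauss v)
    have "(\<lambda>p. (\<lambda>k\<in>I. fst p k + c k, snd p)) \<in> measurable (PiM I ?M \<Otimes>\<^sub>M ?M i) (PiM I ?M \<Otimes>\<^sub>M ?M i)"
      by measurable
    from measurable_compose[OF measurable_compose[OF this upd] insert.prems]
    have [measurable]: "(\<lambda>p. F ((\<lambda>k\<in>I. fst p k + c k)(i := snd p))) \<in> borel_measurable (PiM I ?M \<Otimes>\<^sub>M ?M i)"
      by simp
    show "(\<lambda>(x, y). F ((\<lambda>k\<in>I. x k + c k)(i := y)) * ennreal (ell (v i) (c i) y)) \<in> borel_measurable (PiM I ?M \<Otimes>\<^sub>M ?M i)"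
      unfolding case_prod_beta by measurable
  qed
  also have "\<dots> = (\<integral>\<^sup>+y. (\<integral>\<^sup>+x. F (x(i := y)) * (\<Prod>k\<in>I. ennreal (ell (v k) (c k) (x k))) * ennreal (ell (v i) (c i) y) \<partial>PiM I ?M) \<partial>?M i)"
  proof (rule nn_integral_cong)
    fix y
    have Fm[measurable]: "(\<lambda>x. F (x(i := y))) \<in> borel_measurable (PiM I ?M)"
      by (rule measurable_compose[OF upd_at insert.prems])
    show "(\<integral>\<^sup>+x. F ((\<lambda>k\<in>I. x k + c k)(i := y)) * ennreal (ell (v i) (c i) y) \<partial>PiM I ?M) =
      (\<integral>\<^sup>+x. F (x(i := y)) * (\<Prod>k\<in>I. ennreal (ell (v k) (c k) (x k))) * ennreal (ell (v i) (c i) y) \<partial>PiM I ?M)"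
      by (simp add: nn_integral_multc insert.IH[OF Fm] measurable_compose[OF sh Fm] del: fun_upd_apply)
  qed
  also have "\<dots> = (\<integral>\<^sup>+w. F w * (\<Prod>k\<in>insert i I. ennreal (ell (v k) (c k) (w k))) \<partial>PiM (insert i I) ?M)"
    using insert.hyps
    apply (subst product_nn_integral_insert_rev)
       apply (auto intro!: nn_integral_cong simp: mult_ac)
    apply (rule arg_cong2[where f="(*)", OF refl])
    apply (rule arg_cong2[where f="(*)", OF refl])
    apply (rule prod.cong)
     apply auto
    done
  finally show ?case .
qed

text \<open>Once the coordinates outside \<open>F\<close> are frozen, each factor reads one
  coordinate of its own, and independence turns the integral of the product into a product of
  integrals. The converse integrates out the output of one receiver this way, the coding part a
  wrong codeword.\<close>

lemma gauss_PiM_eliminate: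
  fixes v :: "'i \<Rightarrow> real" and h :: "'i \<Rightarrow> ('i \<Rightarrow> complex) \<Rightarrow> complex \<Rightarrow> ennreal"
  assumes v: "\<And>i. v i > 0" and I: "finite I" and F: "F \<subseteq> I"
    and G[measurable]: "G \<in> borel_measurable (PiM I (\<lambda>i. cgauss (v i)))"
    and h: "\<And>f. f \<in> F \<Longrightarrow> (\<lambda>(w, x). h f w x) \<in> borel_measurable (PiM I (\<lambda>i. cgauss (v i)) \<Otimes>\<^sub>M borel)"
    and Ginv: "\<And>w w'. (\<And>i. i \<in> I - F \<Longrightarrow> w i = w' i) \<Longrightarrow> G w = G w'"
    and hinv: "\<And>f w w'. f \<in> F \<Longrightarrow> (\<And>i. i \<in> I - F \<Longrightarrow> w i = w' i) \<Longrightarrow> h f w = h f w'"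
  shows "(\<integral>\<^sup>+w. G w * (\<Prod>f\<in>F. h f w (w f)) \<partial>PiM I (\<lambda>i. cgauss (v i))) =
    (\<integral>\<^sup>+w. G w * (\<Prod>f\<in>F. \<integral>\<^sup>+x. h f w x \<partial>cgauss (v f)) \<partial>PiM I (\<lambda>i. cgauss (v i)))"
proof -
  let ?M = "\<lambda>i. cgauss (v i)"
  interpret product_prob_space ?M by (rule product_prob_space_cgauss[where v=v, OF v])
  interpret PF: prob_space "PiM F ?M" by (rule prob_space_PiM) (rule prob_space_cgauss[OF v])
  have IF: "I = (I - F) \<union> F" "(I - F) \<inter> F = {}" "finite (I - F)" "finite F"
    using F I by (auto intro: finite_subset)
  note fold = product_nn_integral_fold[OF IF(2,3,4), unfolded IF(1)[symmetric]]
  have hw[measurable]: "h f w \<in> borel_measurable borel" if "f \<in> F" for f w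
  proof -
    \<comment> \<open>\<open>w\<close> may lie outside the product space; restricting it to
      \<open>I\<close> changes nothing that \<open>h f\<close> reads.\<close>
    define w' where "w' = (\<lambda>i\<in>I. w i)"
    have "w' \<in> space (PiM I ?M)" by (simp add: w'_def space_PiM)
    then have "h f w' \<in> borel_measurable borel"
      using measurable_Pair2[OF h[OF that]] by simp
    moreover have "h f w' = h f w" by (rule hinv[OF that]) (auto simp: w'_def)
    ultimately show ?thesis by simp
  qed
  have m1: "(\<lambda>w. h f w (w f)) \<in> borel_measurable (PiM I ?M)" if "f \<in> F" for f
  proof -
    have "(\<lambda>w. (w, w f)) \<in> measurable (PiM I ?M) (PiM I ?M \<Otimes>\<^sub>M borel)"
      using that F by (intro measurable_Pair) auto
    from measurable_compose[OF this h[OF that]] show ?thesis by simp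
  qed
  have m2: "(\<lambda>w. \<integral>\<^sup>+x. h f w x \<partial>cgauss (v f)) \<in> borel_measurable (PiM I ?M)" if "f \<in> F" for f
  proof -
    interpret cg: prob_space "cgauss (v f)" by (rule prob_space_cgauss[OF v])
    have "(\<lambda>(w, x). h f w x) \<in> borel_measurable (PiM I ?M \<Otimes>\<^sub>M cgauss (v f))"
      using h[OF that] by (simp cong: measurable_cong_sets)
    then show ?thesis by measurable
  qed
  have mg: "(\<And>i. i \<in> I - F \<Longrightarrow> merge (I - F) F (x, y) i = x i)" for x y :: "'i \<Rightarrow> complex"
    by (simp add: merge_def)
  have Gm: "G (merge (I - F) F (x, y)) = G x" for x y by (rule Ginv) (simp add: mg)
  have hm: "f \<in> F \<Longrightarrow> h f (merge (I - F) F (x, y)) = h f x" for x y f by (rule hinv) (auto simp: mg)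
  have "(\<integral>\<^sup>+w. G w * (\<Prod>f\<in>F. h f w (w f)) \<partial>PiM I ?M) =
     (\<integral>\<^sup>+x. (\<integral>\<^sup>+y. G (merge (I - F) F (x, y)) * (\<Prod>f\<in>F. h f (merge (I - F) F (x, y)) (merge (I - F) F (x, y) f)) \<partial>PiM F ?M) \<partial>PiM (I - F) ?M)"
    by (intro fold borel_measurable_times_ennreal G borel_measurable_prod_ennreal m1)
  also have "\<dots> = (\<integral>\<^sup>+x. (\<integral>\<^sup>+y. G x * (\<Prod>f\<in>F. h f x (y f)) \<partial>PiM F ?M) \<partial>PiM (I - F) ?M)"
    by (intro nn_integral_cong arg_cong2[where f="(*)"] prod.cong) (auto simp: Gm hm)
  also have "\<dots> = (\<integral>\<^sup>+x. G x * (\<Prod>f\<in>F. \<integral>\<^sup>+y. h f x y \<partial>cgauss (v f)) \<partial>PiM (I - F) ?M)"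
  proof (rule nn_integral_cong)
    fix x
    have "(\<lambda>y. \<Prod>f\<in>F. h f x (y f)) \<in> borel_measurable (PiM F ?M)"
      by measurable
    then have "(\<integral>\<^sup>+y. G x * (\<Prod>f\<in>F. h f x (y f)) \<partial>PiM F ?M) = G x * (\<integral>\<^sup>+y. (\<Prod>f\<in>F. h f x (y f)) \<partial>PiM F ?M)"
      by (rule nn_integral_cmult)
    then show "(\<integral>\<^sup>+y. G x * (\<Prod>f\<in>F. h f x (y f)) \<partial>PiM F ?M) = G x * (\<Prod>f\<in>F. \<integral>\<^sup>+y. h f x y \<partial>cgauss (v f))"
      using product_nn_integral_prod[OF IF(4), of "\<lambda>f. h f x"] hw by (simp cong: measurable_cong_sets)
  qed
  also have "\<dots> = (\<integral>\<^sup>+x. (\<integral>\<^sup>+y. G (merge (I - F) F (x, y)) * (\<Prod>f\<in>F. \<integral>\<^sup>+u. h f (merge (I - F) F (x, y)) u \<partial>cgauss (v f)) \<partial>PiM F ?M) \<partial>PiM (I - F) ?M)"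
    by (simp add: Gm hm PF.emeasure_space_1 cong: prod.cong)
  also have "\<dots> = (\<integral>\<^sup>+w. G w * (\<Prod>f\<in>F. \<integral>\<^sup>+x. h f w x \<partial>cgauss (v f)) \<partial>PiM I ?M)"
    by (intro fold[symmetric] borel_measurable_times_ennreal G borel_measurable_prod_ennreal m2)
  finally show ?thesis .
qed

lemma nn_integral_gauss_PiM_component:
  assumes v: "\<And>i. v i > 0" and i: "i \<in> I" and f[measurable]: "f \<in> borel_measurable borel"
  shows "(\<integral>\<^sup>+w. f (w i) \<partial>PiM I (\<lambda>i. cgauss (v i))) = (\<integral>\<^sup>+z. f z \<partial>cgauss (v i))"
proof -
  interpret product_prob_space "\<lambda>i. cgauss (v i)" I by (rule product_prob_space_cgauss[where v=v, OF v])
  have "(\<integral>\<^sup>+z. f z \<partial>cgauss (v i)) = (\<integral>\<^sup>+z. f z \<partial>distr (PiM I (\<lambda>i. cgauss (v i))) (cgauss (v i)) (\<lambda>w. w i))"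
    by (simp only: PiM_component[OF i])
  also have "\<dots> = (\<integral>\<^sup>+w. f (w i) \<partial>PiM I (\<lambda>i. cgauss (v i)))"
    using i by (subst nn_integral_distr) auto
  finally show ?thesis by simp
qed

lemma gauss_PiM_component:
  fixes f :: "complex \<Rightarrow> 'b::{banach, second_countable_topology}"
  assumes v: "\<And>i. v i > 0" and i: "i \<in> I" and f[measurable]: "f \<in> borel_measurable borel"
  shows "integrable (PiM I (\<lambda>i. cgauss (v i))) (\<lambda>w. f (w i)) \<longleftrightarrow> integrable (cgauss (v i)) f"
    and "integral\<^sup>L (PiM I (\<lambda>i. cgauss (v i))) (\<lambda>w. f (w i)) = integral\<^sup>L (cgauss (v i)) f"
proof -
  interpret product_prob_space "\<lambda>i. cgauss (v i)" I by (rule product_prob_space_cgauss[where v=v, OF v])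
  have d: "distr (PiM I (\<lambda>i. cgauss (v i))) (cgauss (v i)) (\<lambda>w. w i) = cgauss (v i)"
    by (rule PiM_component[OF i])
  show "integrable (PiM I (\<lambda>i. cgauss (v i))) (\<lambda>w. f (w i)) \<longleftrightarrow> integrable (cgauss (v i)) f"
    using i by (subst d[symmetric], subst integrable_distr_eq) auto
  show "integral\<^sup>L (PiM I (\<lambda>i. cgauss (v i))) (\<lambda>w. f (w i)) = integral\<^sup>L (cgauss (v i)) f"
    using i by (subst d[symmetric], subst integral_distr) auto
qed

lemma gauss_PiM_indep:
  assumes v: "\<And>i. v i > 0"
  shows "prob_space.indep_vars (PiM I (\<lambda>i. cgauss (v i))) (\<lambda>_. borel) (\<lambda>i w. w i) I"
proof (cases "I = {}")
  case True
  interpret prob_space "PiM I (\<lambda>i. cgauss (v i))" by (rule prob_space_PiM) (rule prob_space_cgauss[OF v])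
  show ?thesis unfolding indep_vars_def indep_sets_def using True by auto
next
  case False
  let ?P = "PiM I (\<lambda>i. cgauss (v i))"
  interpret product_prob_space "\<lambda>i. cgauss (v i)" I by (rule product_prob_space_cgauss[where v=v, OF v])
  interpret prob_space ?P by (rule prob_space_PiM) (rule prob_space_cgauss[OF v])
  have c: "distr ?P borel (\<lambda>w. w i) = cgauss (v i)" if "i \<in> I" for i
    using PiM_component[OF that] by (simp cong: distr_cong)
  have "distr ?P (\<Pi>\<^sub>M i\<in>I. borel) (\<lambda>x. \<lambda>i\<in>I. x i) = distr ?P ?P (\<lambda>x. x)"
    by (rule distr_cong) (auto simp: space_PiM intro!: sets_PiM_cong)
  also have "\<dots> = ?P" by (rule distr_id)
  also have "\<dots> = (\<Pi>\<^sub>M i\<in>I. distr ?P borel (\<lambda>w. w i))"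
    by (rule PiM_cong) (auto simp: c)
  finally show ?thesis
    using False by (subst indep_vars_iff_distr_eq_PiM') auto
qed

lemma gauss_PiM_cross:
  assumes v: "\<And>i. v i > 0" and ij: "i \<in> I" "j \<in> I" "i \<noteq> j"
  shows "integrable (PiM I (\<lambda>i. cgauss (v i))) (\<lambda>w. w i * cnj (w j))"
    and "integral\<^sup>L (PiM I (\<lambda>i. cgauss (v i))) (\<lambda>w. w i * cnj (w j)) = 0"
proof -
  let ?P = "PiM I (\<lambda>i. cgauss (v i))"
  interpret prob_space ?P by (rule prob_space_PiM) (rule prob_space_cgauss[OF v])
  \<comment> \<open>The conjugate is put on the second variable only, so that the product over
    \<open>{i, j}\<close> is exactly the mixed moment.\<close>
  define X where "X k w = (if k = i then w k else cnj (w k))" for k and w :: "'a \<Rightarrow> complex"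
  have X: "X = (\<lambda>k w. (if k = i then (\<lambda>z. z) else cnj) (w k))" by (auto simp: X_def fun_eq_iff)
  have ind: "indep_vars (\<lambda>_. borel) X {i, j}"
    unfolding X
    by (rule indep_vars_compose2[OF indep_vars_subset[OF gauss_PiM_indep[where v=v, OF v]]])
       (use ij in \<open>auto intro: borel_measurable_continuous_onI continuous_intros\<close>)
  have cm[measurable]: "cnj \<in> borel_measurable borel" by (intro borel_measurable_continuous_onI continuous_intros)
  have int: "integrable ?P (X k)" if "k \<in> {i, j}" for k
  proof -
    have k: "k \<in> I" using that ij by auto
    have 1: "integrable (cgauss (v k)) (\<lambda>z. z)" by (rule integrable_cgauss_id[OF v])
    have "integrable ?P (\<lambda>w. w k)"
      by (rule gauss_PiM_component(1)[where v=v, OF v k, where f="\<lambda>z. z", THEN iffD2, OF _ 1]) measurable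
    moreover have "integrable ?P (\<lambda>w. cnj (w k))"
      by (rule gauss_PiM_component(1)[where v=v, OF v k cm, THEN iffD2, OF integrable_cnj[OF 1]])
    moreover have "X k = (if k = i then (\<lambda>w. w k) else (\<lambda>w. cnj (w k)))" by (auto simp: X_def)
    ultimately show ?thesis by (cases "k = i") simp_all
  qed
  have e: "(\<lambda>w. w i * cnj (w j)) = (\<lambda>w. \<Prod>k\<in>{i, j}. X k w)" using ij by (auto simp: X_def fun_eq_iff)
  show "integrable ?P (\<lambda>w. w i * cnj (w j))"
    unfolding e by (rule indep_vars_integrable[OF _ ind int]) auto
  have "integral\<^sup>L ?P (\<lambda>w. w i * cnj (w j)) = (\<Prod>k\<in>{i, j}. integral\<^sup>L ?P (X k))"
    unfolding e by (rule indep_vars_lebesgue_integral[OF _ ind int]) auto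
  also have "\<dots> = 0"
    using ij gauss_PiM_component(2)[where v=v, OF v ij(1), where f="\<lambda>z. z"] integral_cgauss_id[OF v, of i]
    by (simp add: X_def[abs_def])
  finally show "integral\<^sup>L ?P (\<lambda>w. w i * cnj (w j)) = 0" .
qed

lemma cmod_add_power2: "(cmod (x + y))\<^sup>2 = (cmod x)\<^sup>2 + (cmod y)\<^sup>2 + 2 * Re (x * cnj y)"
  unfolding cmod_power2 by (simp add: power2_eq_square algebra_simps)

text \<open>Distinct coordinates are uncorrelated and have mean zero, so the variances add up.
  Orthogonality is enough here; the law of the sum is never identified.\<close>

lemma gauss_PiM_lincomb_sq:
  assumes v: "\<And>i. v i > 0" and "finite A" and "A \<subseteq> I"
  shows "integrable (PiM I (\<lambda>i. cgauss (v i))) (\<lambda>w. (cmod (k + (\<Sum>i\<in>A. a i * w i)))\<^sup>2)"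
    and "integral\<^sup>L (PiM I (\<lambda>i. cgauss (v i))) (\<lambda>w. (cmod (k + (\<Sum>i\<in>A. a i * w i)))\<^sup>2) =
      (cmod k)\<^sup>2 + (\<Sum>i\<in>A. (cmod (a i))\<^sup>2 * v i)"
proof -
  let ?P = "PiM I (\<lambda>i. cgauss (v i))"
  interpret prob_space ?P by (rule prob_space_PiM) (rule prob_space_cgauss[OF v])
  have "has_bochner_integral ?P (\<lambda>w. (cmod (k + (\<Sum>i\<in>A. a i * w i)))\<^sup>2) ((cmod k)\<^sup>2 + (\<Sum>i\<in>A. (cmod (a i))\<^sup>2 * v i))"
    using assms(2,3)
  proof (induction A rule: finite_induct)
    case empty
    show ?case by (simp add: has_bochner_integral_iff prob_space)
  next
    case (insert j A)
    have eq: "(cmod (k + (\<Sum>i\<in>insert j A. a i * w i)))\<^sup>2 =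
       (cmod (k + (\<Sum>i\<in>A. a i * w i)))\<^sup>2 + (cmod (a j))\<^sup>2 * (cmod (w j))\<^sup>2
         + 2 * Re (k * cnj (a j) * cnj (w j) + (\<Sum>i\<in>A. a i * cnj (a j) * (w i * cnj (w j))))" for w
    proof -
      have "k + (\<Sum>i\<in>insert j A. a i * w i) = (k + (\<Sum>i\<in>A. a i * w i)) + a j * w j"
        using insert.hyps by simp
      then show ?thesis
        by (simp only: cmod_add_power2) (simp add: norm_mult power_mult_distrib algebra_simps sum_distrib_left sum_distrib_right)
    qed
    have jI: "j \<in> I" using insert.prems by simp
    have sqj: "has_bochner_integral ?P (\<lambda>w. (cmod (w j))\<^sup>2) (v j)"
      using integrable_cgauss_sq[OF v, of j] gauss_PiM_component[where v=v, OF v jI, where f="\<lambda>z. (cmod z)\<^sup>2"]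
      by (auto simp: has_bochner_integral_iff)
    have cm: "cnj \<in> borel_measurable borel" by (intro borel_measurable_continuous_onI continuous_intros)
    have idj: "has_bochner_integral ?P (\<lambda>w. cnj (w j)) 0"
      unfolding has_bochner_integral_iff
      using gauss_PiM_component(1)[where v=v, OF v jI cm, THEN iffD2, OF integrable_cnj[OF integrable_cgauss_id[OF v]]]
        integral_cgauss_id[OF v, of j] gauss_PiM_component(2)[where v=v, OF v jI cm] Bochner_Integration.integral_cnj[of "cgauss (v j)" "\<lambda>z. z"] by (simp only: complex_cnj_zero simp_thms)
    have cr: "has_bochner_integral ?P (\<lambda>w. w i * cnj (w j)) 0" if "i \<in> A" for i
      using gauss_PiM_cross[where v=v and i=i and j=j, OF v] that insert by (auto simp: has_bochner_integral_iff)
    have "has_bochner_integral ?P (\<lambda>w. k * cnj (a j) * cnj (w j) + (\<Sum>i\<in>A. a i * cnj (a j) * (w i * cnj (w j))))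
        (k * cnj (a j) * 0 + (\<Sum>i\<in>A. a i * cnj (a j) * 0))"
      by (intro has_bochner_integral_add has_bochner_integral_sum has_bochner_integral_mult_right idj cr)
    then have cross: "has_bochner_integral ?P (\<lambda>w. 2 * Re (k * cnj (a j) * cnj (w j) + (\<Sum>i\<in>A. a i * cnj (a j) * (w i * cnj (w j)))))
        (2 * Re (k * cnj (a j) * 0 + (\<Sum>i\<in>A. a i * cnj (a j) * 0)))"
      by (intro has_bochner_integral_mult_right has_bochner_integral_Re)
    have "has_bochner_integral ?P (\<lambda>w. (cmod (k + (\<Sum>i\<in>insert j A. a i * w i)))\<^sup>2)
       (((cmod k)\<^sup>2 + (\<Sum>i\<in>A. (cmod (a i))\<^sup>2 * v i)) + (cmod (a j))\<^sup>2 * v j + (2 * Re (k * cnj (a j) * 0 + (\<Sum>i\<in>A. a i * cnj (a j) * 0))))"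
      unfolding eq using insert.prems
      by (intro has_bochner_integral_add[OF has_bochner_integral_add[OF insert.IH has_bochner_integral_mult_right[OF sqj]] cross]) auto
    then show ?case using insert.hyps by (simp add: algebra_simps)
  qed
  then show "integrable ?P (\<lambda>w. (cmod (k + (\<Sum>i\<in>A. a i * w i)))\<^sup>2)"
    "integral\<^sup>L ?P (\<lambda>w. (cmod (k + (\<Sum>i\<in>A. a i * w i)))\<^sup>2) = (cmod k)\<^sup>2 + (\<Sum>i\<in>A. (cmod (a i))\<^sup>2 * v i)"
    by (auto simp: has_bochner_integral_iff)
qed

section \<open>Converse\<close>

text \<open>Exchanging the message \<open>w j\<close> with an independent uniform copy
  \<open>a\<close> is an involution of the pairs \<open>(w, a)\<close>, so resampling one message
  leaves the total unchanged up to the number of copies.\<close>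

lemma sum_PiE_resample:
  fixes F :: "('i \<Rightarrow> nat) \<Rightarrow> 'b::semiring_1"
  assumes j: "j \<in> A" and A: "finite A"
  shows "(\<Sum>w\<in>PiE A (\<lambda>i. {..<M i}). \<Sum>a<M j. F (w(j := a))) = of_nat (M j) * (\<Sum>w\<in>PiE A (\<lambda>i. {..<M i}). F w)"
proof -
  let ?W = "PiE A (\<lambda>i. {..<M i::nat})"
  have fin: "finite ?W" using A by (intro finite_PiE) auto
  have "(\<Sum>w\<in>?W. \<Sum>a<M j. F (w(j := a))) = (\<Sum>p\<in>?W \<times> {..<M j}. F ((fst p)(j := snd p)))"
    using fin by (simp add: sum.cartesian_product case_prod_beta)
  also have "\<dots> = (\<Sum>p\<in>?W \<times> {..<M j}. F (fst p))"
    by (rule sum.reindex_bij_witness[of _ "\<lambda>p. ((fst p)(j := snd p), fst p j)" "\<lambda>p. ((fst p)(j := snd p), fst p j)"])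
       (use j in \<open>auto simp: PiE_iff extensional_def\<close>)
  also have "\<dots> = (\<Sum>w\<in>?W. \<Sum>a<M j. F w)"
    by (subst sum.cartesian_product) (simp add: case_prod_beta)
  finally show ?thesis by (simp add: sum_distrib_left)
qed

text \<open>The passage to marginals is stated without division, so that it is available in
  \<open>ennreal\<close> too.\<close>

lemma sum_PiE_one:
  fixes F :: "nat \<Rightarrow> 'b::semiring_1"
  assumes j: "j \<in> A" and A: "finite A"
  shows "of_nat (M j) * (\<Sum>w\<in>PiE A (\<lambda>i. {..<M i}). F (w j)) = of_nat (\<Prod>i\<in>A. M i) * (\<Sum>a<M j. F a)"
  using sum_PiE_resample[OF assms, where F="\<lambda>w. F (w j)" and M=M] A by (simp add: card_PiE)

lemma sum_PiE_two:
  fixes F :: "nat \<Rightarrow> nat \<Rightarrow> 'b::comm_semiring_1"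
  assumes j: "i \<in> A" "j \<in> A" "i \<noteq> j" and A: "finite A"
  shows "of_nat (M i * M j) * (\<Sum>w\<in>PiE A (\<lambda>i. {..<M i}). F (w i) (w j)) =
    of_nat (\<Prod>i\<in>A. M i) * (\<Sum>a<M i. \<Sum>b<M j. F a b)"
proof -
  let ?W = "PiE A (\<lambda>i. {..<M i::nat})"
  have "of_nat (M j) * (\<Sum>w\<in>?W. F (w i) (w j)) = (\<Sum>w\<in>?W. \<Sum>b<M j. F (w i) b)"
    using sum_PiE_resample[OF j(2) A, where F="\<lambda>w. F (w i) (w j)" and M=M] j(3) by simp
  then have "of_nat (M i * M j) * (\<Sum>w\<in>?W. F (w i) (w j)) = of_nat (M i) * (\<Sum>w\<in>?W. \<Sum>b<M j. F (w i) b)"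
    by (simp add: mult.assoc)
  also have "\<dots> = of_nat (\<Prod>i\<in>A. M i) * (\<Sum>a<M i. \<Sum>b<M j. F a b)"
    by (rule sum_PiE_one[OF j(1) A])
  finally show ?thesis .
qed

section \<open>Gaussian test densities relative to the noise\<close>

definition gkern :: "real \<Rightarrow> real \<Rightarrow> complex \<Rightarrow> complex \<Rightarrow> real" where
  "gkern v s m y = (v / s) * exp ((cmod y)\<^sup>2 / v - (cmod (y - m))\<^sup>2 / s)"

lemma gkern_pos: "v > 0 \<Longrightarrow> s > 0 \<Longrightarrow> gkern v s m y > 0"
  by (simp add: gkern_def)

lemma measurable_gkern [measurable]:
  assumes [measurable]: "f \<in> borel_measurable M" "g \<in> borel_measurable M"
  shows "(\<lambda>x. gkern v s (f x) (g x)) \<in> borel_measurable M"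
  unfolding gkern_def by measurable

lemma nn_integral_gkern:
  assumes v: "v > 0" and s: "s > 0"
  shows "(\<integral>\<^sup>+y. ennreal (gkern v s m y) \<partial>cgauss v) = 1"
proof -
  have "(\<integral>\<^sup>+y. ennreal (gkern v s m y) \<partial>cgauss v) =
      (\<integral>\<^sup>+y. ennreal (exp (- (cmod (y - m))\<^sup>2 / s) / (pi * s)) \<partial>lborel)"
  proof (subst nn_integral_cgauss, simp, rule nn_integral_cong)
    fix y
    have "exp (- (cmod y)\<^sup>2 / v) / (pi * v) * gkern v s m y = exp (- (cmod (y - m))\<^sup>2 / s) / (pi * s)"
      using v s by (simp add: gkern_def mult_exp_exp)
    then show "ennreal (exp (- (cmod y)\<^sup>2 / v) / (pi * v)) * ennreal (gkern v s m y) =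
        ennreal (exp (- (cmod (y - m))\<^sup>2 / s) / (pi * s))"
      using v by (simp flip: ennreal_mult')
  qed
  also have "\<dots> = 1" by (rule nn_integral_complex_gauss[OF s])
  finally show ?thesis .
qed

text \<open>All densities below are relative to the noise: \<open>ell v c\<close> is the density of \<open>CN(c, v)\<close> relative to \<open>CN(0, v)\<close>,
  \<open>gkern v s m\<close> that of \<open>CN(m, s)\<close>. In the locale, \<open>cs a\<close> and \<open>own b\<close> are the contributions of
  message \<open>a\<close> of user 0 and of a receiver's own message \<open>b\<close> to the outputs (user 0 counts only in \<open>cs\<close>),
  \<open>LL A a\<close> is the likelihood of the interference at the receivers in \<open>A\<close> given \<open>a\<close>, and \<open>mix A\<close> its average over \<open>a\<close>.\<close>
locale channel_code =
  fixes K N :: nat and n0 :: real and hdir hc :: "nat \<Rightarrow> complex"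
    and M :: "nat \<Rightarrow> nat" and enc :: "nat \<Rightarrow> nat \<Rightarrow> nat \<Rightarrow> complex"
    and dec :: "nat \<Rightarrow> (nat \<Rightarrow> complex) \<Rightarrow> nat"
  assumes n0: "n0 > 0" and M_pos: "\<And>i. i \<le> K \<Longrightarrow> M i \<ge> 1"
    and dec_meas: "\<And>i. i \<le> K \<Longrightarrow> dec i \<in> measurable (out_space N) (count_space UNIV)"
begin

abbreviation "I \<equiv> {..K} \<times> {..<N}"
abbreviation "\<mu> \<equiv> PiM I (\<lambda>_. cgauss n0)"
abbreviation "W \<equiv> PiE {..K} (\<lambda>i. {..<M i})"
abbreviation "gain i \<equiv> (if i = 0 then hdir 0 else hc i)"

definition cs :: "nat \<Rightarrow> nat \<times> nat \<Rightarrow> complex" where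
  "cs a p = gain (fst p) * enc 0 a (snd p)"

definition own :: "nat \<Rightarrow> nat \<times> nat \<Rightarrow> complex" where
  "own b p = (if fst p = 0 then 0 else hdir (fst p) * enc (fst p) b (snd p))"

text \<open>A substitute for Fano's inequality: the logarithm is \<open>ln (M i)\<close> upon
  correct decoding and 0 otherwise, so its mean is the success probability times the logarithm of
  the number of messages.\<close>

definition okf :: "nat \<Rightarrow> nat \<Rightarrow> (nat \<times> nat \<Rightarrow> complex) \<Rightarrow> real" where
  "okf i b y = (if dec i (restrict (\<lambda>t. y (i, t)) {..<N}) = b then real (M i) else 1)"

definition LL :: "nat set \<Rightarrow> nat \<Rightarrow> (nat \<times> nat \<Rightarrow> complex) \<Rightarrow> real" where
  "LL A a z = (\<Prod>p\<in>A \<times> {..<N}. ell n0 (cs a p) (z p))"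

definition mix :: "nat set \<Rightarrow> (nat \<times> nat \<Rightarrow> complex) \<Rightarrow> real" where
  "mix A z = (\<Sum>a<M 0. LL A a z) / real (M 0)"

lemma prob_mu: "prob_space \<mu>"
  by (rule prob_space_PiM) (rule prob_space_cgauss[OF n0])

lemma M_real_pos: "i \<le> K \<Longrightarrow> real (M i) > 0"
  using M_pos[of i] by simp

lemma finite_W: "finite W" by (intro finite_PiE) auto

lemma LL_pos: "LL A a z > 0"
  unfolding LL_def by (rule prod_pos) simp

lemma mix_pos: "mix A z > 0"
  unfolding mix_def using M_pos[of 0]
  by (intro divide_pos_pos sum_pos) (auto simp: LL_pos lessThan_empty_iff)

lemma mix_empty: "mix {} z = 1"
  using M_pos[of 0] by (simp add: mix_def LL_def)

lemma okf_pos: "i \<le> K \<Longrightarrow> okf i b y > 0"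
  using M_pos[of i] by (simp add: okf_def)

lemma measurable_comp_mu:
  "p \<in> I \<Longrightarrow> (\<lambda>z. z p) \<in> borel_measurable \<mu>"
  by measurable

lemma measurable_LL: "A \<subseteq> {..K} \<Longrightarrow> LL A a \<in> borel_measurable \<mu>"
  unfolding LL_def by (intro borel_measurable_prod measurable_compose[OF _ measurable_ell] measurable_comp_mu) auto

lemma measurable_mix: "A \<subseteq> {..K} \<Longrightarrow> mix A \<in> borel_measurable \<mu>"
  unfolding mix_def by (intro borel_measurable_divide borel_measurable_sum measurable_LL borel_measurable_const)

lemma measurable_okf:
  assumes i: "i \<le> K" and f: "\<And>t. t < N \<Longrightarrow> (\<lambda>z. f z (i, t)) \<in> borel_measurable \<mu>"
  shows "(\<lambda>z. okf i b (f z)) \<in> borel_measurable \<mu>"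
proof -
  have r: "(\<lambda>z. restrict (\<lambda>t. f z (i, t)) {..<N}) \<in> measurable \<mu> (out_space N)"
    unfolding out_space_def by (rule measurable_restrict) (use f in auto)
  have "Measurable.pred \<mu> (\<lambda>z. dec i (restrict (\<lambda>t. f z (i, t)) {..<N}) = b)"
    using measurable_compose[OF r dec_meas[OF i]] by measurable
  then show ?thesis unfolding okf_def by measurable
qed

lemma LL_cong: "(\<And>p. p \<in> A \<times> {..<N} \<Longrightarrow> z p = z' p) \<Longrightarrow> LL A a z = LL A a z'"
  unfolding LL_def by (rule prod.cong) auto

lemma mix_cong: "(\<And>p. p \<in> A \<times> {..<N} \<Longrightarrow> z p = z' p) \<Longrightarrow> mix A z = mix A z'"
  unfolding mix_def by (intro arg_cong2[where f="(/)"] sum.cong refl LL_cong)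

lemma okf_cong: "(\<And>t. t < N \<Longrightarrow> z (i, t) = z' (i, t)) \<Longrightarrow> okf i b z = okf i b z'"
proof -
  assume "\<And>t. t < N \<Longrightarrow> z (i, t) = z' (i, t)"
  then have "restrict (\<lambda>t. z (i, t)) {..<N} = restrict (\<lambda>t. z' (i, t)) {..<N}" by auto
  then show ?thesis by (simp add: okf_def)
qed

text \<open>The decoder names one message, whatever \<open>b\<close> was sent: at most one
  \<open>b\<close> has weight \<open>M i\<close>, all others have weight 1. This is the origin of
  the constant 2 in the bounds on the test functions.\<close>

lemma sum_okf_le: "i \<le> K \<Longrightarrow> (\<Sum>b<M i. okf i b y) \<le> 2 * real (M i)"
proof -
  define d where "d = dec i (restrict (\<lambda>t. y (i, t)) {..<N})"
  have "(\<Sum>b<M i. okf i b y) \<le> (\<Sum>b<M i. 1 + (if d = b then real (M i) else 0))"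
    by (rule sum_mono) (simp add: okf_def d_def)
  also have "\<dots> \<le> 2 * real (M i)"
    by (simp add: sum.distrib sum.delta)
  finally show ?thesis .
qed

section \<open>Changes of measure for the noise vector\<close>

lemma noise_shift:
  fixes \<Phi> :: "(nat \<times> nat \<Rightarrow> complex) \<Rightarrow> ennreal"
  assumes meas: "\<Phi> \<in> borel_measurable \<mu>" and A: "A \<subseteq> {..K}"
    and loc: "\<And>z z'. (\<And>p. p \<in> A \<times> {..<N} \<Longrightarrow> z p = z' p) \<Longrightarrow> \<Phi> z = \<Phi> z'"
  shows "(\<integral>\<^sup>+z. \<Phi> (\<lambda>p. z p + c p) \<partial>\<mu>) = (\<integral>\<^sup>+z. \<Phi> z * ennreal (\<Prod>p\<in>A \<times> {..<N}. ell n0 (c p) (z p)) \<partial>\<mu>)"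
proof -
  define c' where "c' p = (if p \<in> A \<times> {..<N} then c p else 0)" for p
  have "(\<integral>\<^sup>+z. \<Phi> (\<lambda>p. z p + c p) \<partial>\<mu>) = (\<integral>\<^sup>+z. \<Phi> (\<lambda>p\<in>I. z p + c' p) \<partial>\<mu>)"
    by (intro nn_integral_cong loc) (use A in \<open>auto simp: c'_def\<close>)
  also have "\<dots> = (\<integral>\<^sup>+z. \<Phi> z * (\<Prod>p\<in>I. ennreal (ell n0 (c' p) (z p))) \<partial>\<mu>)"
    by (rule gauss_PiM_shift[where v="\<lambda>_. n0"]) (use n0 meas in auto)
  also have "\<dots> = (\<integral>\<^sup>+z. \<Phi> z * ennreal (\<Prod>p\<in>A \<times> {..<N}. ell n0 (c p) (z p)) \<partial>\<mu>)"
  proof (intro nn_integral_cong arg_cong2[where f="(*)", OF refl])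
    fix z :: "nat \<times> nat \<Rightarrow> complex"
    have "(\<Prod>p\<in>A \<times> {..<N}. ell n0 (c p) (z p)) = (\<Prod>p\<in>I. ell n0 (c' p) (z p))"
      by (rule prod.mono_neutral_cong_left) (use A in \<open>auto simp: c'_def ell_def\<close>)
    then show "(\<Prod>p\<in>I. ennreal (ell n0 (c' p) (z p))) = ennreal (\<Prod>p\<in>A \<times> {..<N}. ell n0 (c p) (z p))"
      by (simp add: prod_ennreal)
  qed
  finally show ?thesis .
qed

lemma noise_shift_cs:
  fixes \<Phi> :: "(nat \<times> nat \<Rightarrow> complex) \<Rightarrow> ennreal"
  assumes "\<Phi> \<in> borel_measurable \<mu>" and "A \<subseteq> {..K}"
    and "\<And>z z'. (\<And>p. p \<in> A \<times> {..<N} \<Longrightarrow> z p = z' p) \<Longrightarrow> \<Phi> z = \<Phi> z'"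
  shows "(\<integral>\<^sup>+z. \<Phi> (\<lambda>p. z p + cs a p) \<partial>\<mu>) = (\<integral>\<^sup>+z. \<Phi> z * ennreal (LL A a z) \<partial>\<mu>)"
  unfolding LL_def by (rule noise_shift[OF assms])

lemma mix_integral: "A \<subseteq> {..K} \<Longrightarrow> (\<integral>\<^sup>+z. ennreal (mix A z) \<partial>\<mu>) = 1"
proof -
  assume A: "A \<subseteq> {..K}"
  interpret prob_space \<mu> by (rule prob_mu)
  note [measurable] = measurable_LL[OF A]
  have LL: "(\<integral>\<^sup>+z. ennreal (LL A a z) \<partial>\<mu>) = 1" for a
    using noise_shift_cs[of "\<lambda>_. 1" A a] A by (simp add: emeasure_space_1)
  have "(\<integral>\<^sup>+z. ennreal (mix A z) \<partial>\<mu>) = (\<integral>\<^sup>+z. (\<Sum>a<M 0. ennreal (LL A a z)) * ennreal (1 / real (M 0)) \<partial>\<mu>)"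
    by (intro nn_integral_cong)
       (simp add: mix_def less_imp_le[OF LL_pos] sum_nonneg flip: ennreal_mult)
  also have "\<dots> = (\<Sum>a<M 0. (\<integral>\<^sup>+z. ennreal (LL A a z) \<partial>\<mu>)) * ennreal (1 / real (M 0))"
    by (simp add: nn_integral_multc nn_integral_sum)
  also have "\<dots> = 1"
    using M_pos[of 0] by (simp add: LL ennreal_of_nat_eq_real_of_nat flip: ennreal_mult)
  finally show ?thesis .
qed

text \<open>A conditional test density of output \<open>i\<close> has total mass 1 for every value
  of its mean, so it drops out whenever neither the mean nor the rest of the integrand reads
  receiver \<open>i\<close>.\<close>

lemma gkern_eliminate:
  assumes i: "i \<le> K" and s: "s > 0"
    and G: "G \<in> borel_measurable \<mu>" and m: "\<And>t. t < N \<Longrightarrow> m t \<in> borel_measurable \<mu>"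
    and Ginv: "\<And>z z'. (\<And>p. p \<in> I \<Longrightarrow> fst p \<noteq> i \<Longrightarrow> z p = z' p) \<Longrightarrow> G z = G z'"
    and minv: "\<And>t z z'. t < N \<Longrightarrow> (\<And>p. p \<in> I \<Longrightarrow> fst p \<noteq> i \<Longrightarrow> z p = z' p) \<Longrightarrow> m t z = m t z'"
  shows "(\<integral>\<^sup>+z. G z * ennreal (\<Prod>t<N. gkern n0 s (m t z) (z (i, t))) \<partial>\<mu>) = (\<integral>\<^sup>+z. G z \<partial>\<mu>)"
proof -
  let ?F = "{i} \<times> {..<N}"
  have "(\<integral>\<^sup>+z. G z * ennreal (\<Prod>t<N. gkern n0 s (m t z) (z (i, t))) \<partial>\<mu>) =
      (\<integral>\<^sup>+z. G z * (\<Prod>f\<in>?F. ennreal (gkern n0 s (m (snd f) z) (z f))) \<partial>\<mu>)"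
  proof (intro nn_integral_cong arg_cong2[where f="(*)", OF refl])
    fix z
    have "(\<Prod>f\<in>?F. ennreal (gkern n0 s (m (snd f) z) (z f))) = (\<Prod>t<N. ennreal (gkern n0 s (m t z) (z (i, t))))"
      by (rule prod.reindex_bij_witness[of _ "\<lambda>t. (i, t)" snd]) auto
    then show "ennreal (\<Prod>t<N. gkern n0 s (m t z) (z (i, t))) = (\<Prod>f\<in>?F. ennreal (gkern n0 s (m (snd f) z) (z f)))"
      using gkern_pos[OF n0 s] by (simp add: prod_ennreal less_imp_le)
  qed
  also have "\<dots> = (\<integral>\<^sup>+z. G z * (\<Prod>f\<in>?F. \<integral>\<^sup>+x. ennreal (gkern n0 s (m (snd f) z) x) \<partial>cgauss n0) \<partial>\<mu>)"
  proof (rule gauss_PiM_eliminate[where v="\<lambda>_. n0" and h="\<lambda>f z x. ennreal (gkern n0 s (m (snd f) z) x)"])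
    fix f assume f: "f \<in> ?F"
    have [measurable]: "m (snd f) \<in> borel_measurable \<mu>" using f m by auto
    show "(\<lambda>(z, x). ennreal (gkern n0 s (m (snd f) z) x)) \<in> borel_measurable (\<mu> \<Otimes>\<^sub>M borel)"
      by measurable
  next
    fix f and z z' :: "nat \<times> nat \<Rightarrow> complex" assume "f \<in> ?F" and e: "\<And>p. p \<in> I - ?F \<Longrightarrow> z p = z' p"
    then have "m (snd f) z = m (snd f) z'" by (intro minv) auto
    then show "(\<lambda>x. ennreal (gkern n0 s (m (snd f) z) x)) = (\<lambda>x. ennreal (gkern n0 s (m (snd f) z') x))" by simp
  next
    fix z z' :: "nat \<times> nat \<Rightarrow> complex" assume e: "\<And>p. p \<in> I - ?F \<Longrightarrow> z p = z' p"
    show "G z = G z'" by (rule Ginv) (use e in auto)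
  qed (use n0 i G in auto)
  also have "\<dots> = (\<integral>\<^sup>+z. G z \<partial>\<mu>)"
    by (simp add: nn_integral_gkern[OF n0 s])
  finally show ?thesis .
qed

section \<open>From bounded test functions to a rate inequality\<close>

abbreviation "PM \<equiv> (\<Prod>i\<le>K. real (M i))"

lemma PM_pos: "PM > 0"
  by (rule prod_pos) (use M_real_pos in simp)

definition yy :: "(nat \<Rightarrow> nat) \<Rightarrow> (nat \<times> nat \<Rightarrow> complex) \<Rightarrow> nat \<times> nat \<Rightarrow> complex" where
  "yy w z p = z p + cs (w 0) p + own (w (fst p)) p"

lemma rx_eq: "i \<le> K \<Longrightarrow> rx N hdir hc enc w z i = restrict (\<lambda>t. yy w z (i, t)) {..<N}"
  by (auto simp: rx_def yy_def cs_def own_def fun_eq_iff)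

lemma card_W: "real (card W) = PM"
  by (simp add: card_PiE)

lemma sum_W_one:
  fixes F :: "nat \<Rightarrow> ennreal"
  assumes i: "i \<le> K" and b: "(\<Sum>a<M i. F a) \<le> ennreal (2 * real (M i))"
  shows "(\<Sum>w\<in>W. F (w i)) \<le> ennreal (2 * PM)"
proof -
  have "ennreal (real (M i)) * (\<Sum>w\<in>W. F (w i)) = of_nat (\<Prod>i\<le>K. M i) * (\<Sum>a<M i. F a)"
    using sum_PiE_one[of i "{..K}" M F] i by (simp add: ennreal_of_nat_eq_real_of_nat)
  also have "\<dots> \<le> of_nat (\<Prod>i\<le>K. M i) * ennreal (2 * real (M i))"
    by (rule mult_left_mono[OF b]) simp
  also have "\<dots> = ennreal (real (M i)) * ennreal (2 * PM)"
    by (simp add: ennreal_of_nat_eq_real_of_nat prod_nonneg mult_ac flip: ennreal_mult)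
  finally show ?thesis
    using M_real_pos[OF i] by (simp add: ennreal_mult_le_mult_iff)
qed

lemma sum_W_two:
  fixes F :: "nat \<Rightarrow> nat \<Rightarrow> ennreal"
  assumes i: "i \<le> K" "j \<le> K" "i \<noteq> j" and b: "(\<Sum>a<M i. \<Sum>b<M j. F a b) \<le> ennreal (2 * real (M i) * real (M j))"
  shows "(\<Sum>w\<in>W. F (w i) (w j)) \<le> ennreal (2 * PM)"
proof -
  have "ennreal (real (M i) * real (M j)) * (\<Sum>w\<in>W. F (w i) (w j)) = of_nat (\<Prod>i\<le>K. M i) * (\<Sum>a<M i. \<Sum>b<M j. F a b)"
    using sum_PiE_two[of i "{..K}" j M F] i by (simp add: ennreal_of_nat_eq_real_of_nat ennreal_mult)
  also have "\<dots> \<le> of_nat (\<Prod>i\<le>K. M i) * ennreal (2 * real (M i) * real (M j))"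
    by (rule mult_left_mono[OF b]) simp
  also have "\<dots> = ennreal (real (M i) * real (M j)) * ennreal (2 * PM)"
    by (simp add: ennreal_of_nat_eq_real_of_nat prod_nonneg mult_ac flip: ennreal_mult)
  finally show ?thesis
    using M_real_pos[OF i(1)] M_real_pos[OF i(2)] by (simp add: ennreal_mult_le_mult_iff)
qed

text \<open>The density \<open>G\<close> does not depend on the message \<open>b\<close>, so under
  it the output tells nothing about \<open>b\<close>; the weights may be summed over
  \<open>b\<close> pointwise, before integrating.\<close>

lemma sum_okf_integral_le:
  assumes i: "i \<le> K" and G: "G \<in> borel_measurable \<mu>" and G1: "(\<integral>\<^sup>+z. ennreal (G z) \<partial>\<mu>) \<le> 1"
    and Gnn: "\<And>z. G z \<ge> 0"
  shows "(\<Sum>b<M i. \<integral>\<^sup>+z. ennreal (okf i b z * G z) \<partial>\<mu>) \<le> ennreal (2 * real (M i))"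
proof -
  have ok[measurable]: "(\<lambda>z. okf i b z) \<in> borel_measurable \<mu>" for b
    by (rule measurable_okf[OF i]) (use i in \<open>auto intro: measurable_comp_mu\<close>)
  note [measurable] = G
  have "(\<Sum>b<M i. \<integral>\<^sup>+z. ennreal (okf i b z * G z) \<partial>\<mu>) = (\<integral>\<^sup>+z. (\<Sum>b<M i. ennreal (okf i b z * G z)) \<partial>\<mu>)"
    by (rule nn_integral_sum[symmetric]) measurable
  also have "\<dots> \<le> (\<integral>\<^sup>+z. ennreal (2 * real (M i)) * ennreal (G z) \<partial>\<mu>)"
  proof (rule nn_integral_mono)
    fix z
    have "(\<Sum>b<M i. ennreal (okf i b z * G z)) = ennreal ((\<Sum>b<M i. okf i b z) * G z)"
      using okf_pos[OF i] Gnn by (simp add: sum_distrib_right less_imp_le)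
    also have "\<dots> \<le> ennreal (2 * real (M i) * G z)"
      by (intro ennreal_leI mult_right_mono sum_okf_le i Gnn)
    finally show "(\<Sum>b<M i. ennreal (okf i b z * G z)) \<le> ennreal (2 * real (M i)) * ennreal (G z)"
      by (simp add: ennreal_mult Gnn)
  qed
  also have "\<dots> = ennreal (2 * real (M i)) * (\<integral>\<^sup>+z. ennreal (G z) \<partial>\<mu>)"
    by (rule nn_integral_cmult) measurable
  also have "\<dots> \<le> ennreal (2 * real (M i)) * 1"
    by (rule mult_left_mono[OF G1]) simp
  finally show ?thesis by simp
qed

text \<open>The averages of the \<open>U j\<close> are at most 2, so \<open>ln u \<le> u/2 - 1 + ln 2\<close> replaces
  Fano's inequality and all entropy estimates at once, provided the logarithm of the product of the
  \<open>U j\<close> is an explicit quadratic form.\<close>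
lemma converse_core:
  fixes U :: "'j \<Rightarrow> (nat \<Rightarrow> nat) \<Rightarrow> (nat \<times> nat \<Rightarrow> complex) \<Rightarrow> real"
    and e :: "'j \<Rightarrow> (nat \<Rightarrow> nat) \<Rightarrow> (nat \<times> nat \<Rightarrow> complex) \<Rightarrow> nat \<Rightarrow> complex"
  assumes J: "finite J" and usr: "\<And>j. j \<in> J \<Longrightarrow> usr j \<le> K"
    and Upos: "\<And>j w z. j \<in> J \<Longrightarrow> w \<in> W \<Longrightarrow> U j w z > 0"
    and Um: "\<And>j w. j \<in> J \<Longrightarrow> w \<in> W \<Longrightarrow> U j w \<in> borel_measurable \<mu>"
    and U2: "\<And>j. j \<in> J \<Longrightarrow> (\<Sum>w\<in>W. \<integral>\<^sup>+z. ennreal (U j w z) \<partial>\<mu>) \<le> ennreal (2 * PM)"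
    and s: "\<And>j. j \<in> J \<Longrightarrow> s j > 0"
    and lnU: "\<And>w z. w \<in> W \<Longrightarrow> (\<Sum>j\<in>J. ln (U j w z)) =
        (\<Sum>j\<in>J. ln (okf (usr j) (w (usr j)) (yy w z)) +
          (\<Sum>t<N. ln (n0 / s j) + (cmod (z (usr j, t)))\<^sup>2 / n0 - (cmod (e j w z t))\<^sup>2 / s j))"
    and eint: "\<And>j w t. j \<in> J \<Longrightarrow> w \<in> W \<Longrightarrow> t < N \<Longrightarrow> integrable \<mu> (\<lambda>z. (cmod (e j w z t))\<^sup>2)"
    and e2: "\<And>j. j \<in> J \<Longrightarrow> (\<Sum>w\<in>W. \<Sum>t<N. integral\<^sup>L \<mu> (\<lambda>z. (cmod (e j w z t))\<^sup>2)) \<le> PM * (real N * s j)"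
    and err: "err_prob K N hdir hc n0 M enc dec \<le> eps"
  shows "(\<Sum>j\<in>J. (1 - eps) * ln (real (M (usr j)))) \<le> real N * (\<Sum>j\<in>J. ln (s j / n0)) + real (card J) * ln 2"
proof -
  interpret prob_space \<mu> by (rule prob_mu)
  define ok where "ok i w z = (dec i (rx N hdir hc enc w z i) = w i)" for i w z
  have yym: "(\<lambda>z. yy w z p) \<in> borel_measurable \<mu>" if "p \<in> I" for w p
    unfolding yy_def using measurable_comp_mu[OF that] by measurable
  have okm: "Measurable.pred \<mu> (ok i w)" if "i \<le> K" for i w
  proof -
    have "(\<lambda>z. restrict (\<lambda>t. yy w z (i, t)) {..<N}) \<in> measurable \<mu> (out_space N)"
      unfolding out_space_def by (rule measurable_restrict) (use yym that in auto)
    from measurable_compose[OF this dec_meas[OF that]] show ?thesis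
      unfolding ok_def rx_eq[OF that] by measurable
  qed
  have lnok: "ln (okf i (w i) (yy w z)) = ln (real (M i)) * indicator {z. ok i w z} z" if "i \<le> K" for i w z
    by (simp add: okf_def ok_def rx_eq[OF that])
  have okS: "{z \<in> space \<mu>. ok i w z} \<in> sets \<mu>" if "i \<le> K" for i w
    using okm[OF that] by simp
  have okint: "integrable \<mu> (\<lambda>z. ln (okf i (w i) (yy w z)))"
    "integral\<^sup>L \<mu> (\<lambda>z. ln (okf i (w i) (yy w z))) = ln (real (M i)) * prob {z \<in> space \<mu>. ok i w z}" if "i \<le> K" for i w
  proof -
    have eq: "ln (okf i (w i) (yy w z)) = ln (real (M i)) * indicator {z \<in> space \<mu>. ok i w z} z" if "z \<in> space \<mu>" for z
      using that by (simp add: lnok[OF \<open>i \<le> K\<close>] indicator_def)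
    have "has_bochner_integral \<mu> (\<lambda>z. ln (real (M i)) * indicator {z \<in> space \<mu>. ok i w z} z) (ln (real (M i)) * prob {z \<in> space \<mu>. ok i w z})"
      by (intro has_bochner_integral_mult_right has_bochner_integral_real_indicator okS that) (simp add: emeasure_eq_measure)
    then have "has_bochner_integral \<mu> (\<lambda>z. ln (okf i (w i) (yy w z))) (ln (real (M i)) * prob {z \<in> space \<mu>. ok i w z})"
      by (subst has_bochner_integral_cong[OF refl _ refl]) (auto simp: eq)
    then show "integrable \<mu> (\<lambda>z. ln (okf i (w i) (yy w z)))"
      "integral\<^sup>L \<mu> (\<lambda>z. ln (okf i (w i) (yy w z))) = ln (real (M i)) * prob {z \<in> space \<mu>. ok i w z}"
      by (simp_all only: has_bochner_integral_iff)
  qed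
  have zsq: "integrable \<mu> (\<lambda>z. (cmod (z p))\<^sup>2)" "integral\<^sup>L \<mu> (\<lambda>z. (cmod (z p))\<^sup>2) = n0" if "p \<in> I" for p
    using gauss_PiM_component[where v="\<lambda>_. n0" and I=I and i=p and f="\<lambda>z. (cmod z)\<^sup>2", OF n0 that] integrable_cgauss_sq[OF n0] by auto
  define G where "G w z = (\<Sum>j\<in>J. ln (okf (usr j) (w (usr j)) (yy w z)) +
          (\<Sum>t<N. ln (n0 / s j) + (cmod (z (usr j, t)))\<^sup>2 / n0 - (cmod (e j w z t))\<^sup>2 / s j))" for w z
  have Gb: "has_bochner_integral \<mu> (G w) (\<Sum>j\<in>J. ln (real (M (usr j))) * prob {z \<in> space \<mu>. ok (usr j) w z} +
     (\<Sum>t<N. ln (n0 / s j) + n0 / n0 - integral\<^sup>L \<mu> (\<lambda>z. (cmod (e j w z t))\<^sup>2) / s j))" if w: "w \<in> W" for w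
  proof -
    have 1: "has_bochner_integral \<mu> (\<lambda>z. ln (okf (usr j) (w (usr j)) (yy w z))) (ln (real (M (usr j))) * prob {z \<in> space \<mu>. ok (usr j) w z})"
      if "j \<in> J" for j using okint[OF usr[OF that]] by (simp only: has_bochner_integral_iff)
    have 2: "has_bochner_integral \<mu> (\<lambda>z. (cmod (z (usr j, t)))\<^sup>2) n0" if "j \<in> J" "t < N" for j t
      using zsq[of "(usr j, t)"] usr[OF that(1)] that by (simp add: has_bochner_integral_iff)
    have 3: "has_bochner_integral \<mu> (\<lambda>z. (cmod (e j w z t))\<^sup>2) (integral\<^sup>L \<mu> (\<lambda>z. (cmod (e j w z t))\<^sup>2))" if "j \<in> J" "t < N" for j t
      using eint[OF that(1) w that(2)] by (simp add: has_bochner_integral_iff)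
    have 4: "has_bochner_integral \<mu> (\<lambda>z. c) c" for c :: real
      by (simp add: has_bochner_integral_iff prob_space)
    show ?thesis unfolding G_def
      by (intro has_bochner_integral_sum has_bochner_integral_add has_bochner_integral_diff has_bochner_integral_divide_zero 1 2 3 4) auto
  qed
  have Uint: "integrable \<mu> (U j w)" if "j \<in> J" "w \<in> W" for j w
  proof (rule integrableI_nonneg)
    show "U j w \<in> borel_measurable \<mu>" by (rule Um[OF that])
    show "AE z in \<mu>. 0 \<le> U j w z" using Upos[OF that] by (auto simp: less_imp_le)
    have "(\<integral>\<^sup>+z. ennreal (U j w z) \<partial>\<mu>) \<le> (\<Sum>w\<in>W. \<integral>\<^sup>+z. ennreal (U j w z) \<partial>\<mu>)"
      using that finite_W by (intro member_le_sum) auto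
    also have "\<dots> < \<infinity>" using U2[OF that(1)] by (simp add: le_less_trans)
    finally show "(\<integral>\<^sup>+z. ennreal (U j w z) \<partial>\<mu>) < \<infinity>" .
  qed
  have U2': "(\<Sum>w\<in>W. integral\<^sup>L \<mu> (U j w)) \<le> 2 * PM" if j: "j \<in> J" for j
  proof -
    have nn: "integral\<^sup>L \<mu> (U j w) \<ge> 0" if "w \<in> W" for w
      using Upos[OF j that] by (intro integral_nonneg_AE) (auto simp: less_imp_le)
    have "(\<Sum>w\<in>W. \<integral>\<^sup>+z. ennreal (U j w z) \<partial>\<mu>) = (\<Sum>w\<in>W. ennreal (integral\<^sup>L \<mu> (U j w)))"
      using Uint[OF j] Upos[OF j] by (intro sum.cong refl nn_integral_eq_integral) (auto simp: less_imp_le)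
    then have "ennreal (\<Sum>w\<in>W. integral\<^sup>L \<mu> (U j w)) \<le> ennreal (2 * PM)"
      using U2[OF j] nn by simp
    then show ?thesis using PM_pos by (subst (asm) ennreal_le_iff) auto
  qed
  have Gle: "integral\<^sup>L \<mu> (G w) \<le> (\<Sum>j\<in>J. integral\<^sup>L \<mu> (U j w) / 2 - 1 + ln 2)" if w: "w \<in> W" for w
  proof -
    \<comment> \<open>The tangent to the logarithm at 2, the bound on the mean of each test
      function.\<close>
    have lnle: "ln u \<le> u / 2 - 1 + ln 2" if "u > 0" for u :: real
      using ln_le_minus_one[of "u / 2"] that by (simp add: ln_div)
    have "integral\<^sup>L \<mu> (G w) \<le> integral\<^sup>L \<mu> (\<lambda>z. \<Sum>j\<in>J. U j w z / 2 - 1 + ln 2)"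
    proof (rule integral_mono)
      show "integrable \<mu> (G w)" using Gb[OF w] by (simp only: has_bochner_integral_iff)
      show "integrable \<mu> (\<lambda>z. \<Sum>j\<in>J. U j w z / 2 - 1 + ln 2)"
        using Uint w by auto
      fix z
      show "G w z \<le> (\<Sum>j\<in>J. U j w z / 2 - 1 + ln 2)"
        unfolding G_def lnU[OF w, symmetric] by (intro sum_mono lnle Upos w)
    qed
    also have "\<dots> = (\<Sum>j\<in>J. integral\<^sup>L \<mu> (U j w) / 2 - 1 + ln 2)"
      using Uint w by (simp add: Bochner_Integration.integral_sum prob_space)
    finally show ?thesis .
  qed
  have GU: "(\<Sum>w\<in>W. integral\<^sup>L \<mu> (G w)) \<le> real (card J) * (ln 2 * PM)"
  proof -
    have "(\<Sum>w\<in>W. integral\<^sup>L \<mu> (G w)) \<le> (\<Sum>w\<in>W. \<Sum>j\<in>J. integral\<^sup>L \<mu> (U j w) / 2 - 1 + ln 2)"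
      by (rule sum_mono[OF Gle])
    also have "\<dots> = (\<Sum>j\<in>J. \<Sum>w\<in>W. integral\<^sup>L \<mu> (U j w) / 2 - 1 + ln 2)"
      by (rule sum.swap)
    also have "\<dots> = (\<Sum>j\<in>J. (\<Sum>w\<in>W. integral\<^sup>L \<mu> (U j w)) / 2 - PM + ln 2 * PM)"
      by (simp add: sum.distrib sum_subtractf sum_divide_distrib card_W[symmetric] del: of_nat_prod card_PiE)
    also have "\<dots> \<le> (\<Sum>j\<in>J. ln 2 * PM)"
      by (rule sum_mono) (use U2' in fastforce)
    finally show ?thesis by simp
  qed
  \<comment> \<open>The error event of one user is contained in the joint error event that
    \<open>err_prob\<close> measures.\<close>
  have okp: "(\<Sum>w\<in>W. prob {z \<in> space \<mu>. ok i w z}) \<ge> (1 - eps) * PM" if i: "i \<le> K" for i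
  proof -
    have "PM - (\<Sum>w\<in>W. prob {z \<in> space \<mu>. ok i w z}) = (\<Sum>w\<in>W. 1 - prob {z \<in> space \<mu>. ok i w z})"
      by (simp add: sum_subtractf card_W[symmetric] del: of_nat_prod card_PiE)
    also have "\<dots> = (\<Sum>w\<in>W. prob {z \<in> space \<mu>. \<not> ok i w z})"
      using prob_neg[OF okS[OF i]] by (intro sum.cong refl) (simp add: okS[OF i])
    also have "\<dots> \<le> (\<Sum>w\<in>W. prob {z \<in> space \<mu>. \<exists>i\<le>K. dec i (rx N hdir hc enc w z i) \<noteq> w i})"
    proof (intro sum_mono finite_measure_mono)
      fix w
      have "{z \<in> space \<mu>. \<exists>i\<le>K. dec i (rx N hdir hc enc w z i) \<noteq> w i} = (\<Union>i\<in>{..K}. space \<mu> - {z \<in> space \<mu>. ok i w z})"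
        by (auto simp: ok_def)
      also have "\<dots> \<in> sets \<mu>" using okS by auto
      finally show "{z \<in> space \<mu>. \<exists>i\<le>K. dec i (rx N hdir hc enc w z i) \<noteq> w i} \<in> sets \<mu>" .
    qed (use i in \<open>auto simp: ok_def\<close>)
    also have "\<dots> \<le> eps * PM"
      using err PM_pos by (simp add: err_prob_def noise_space_def pos_divide_le_eq)
    finally show ?thesis by (simp add: algebra_simps)
  qed
  have "(\<Sum>j\<in>J. (1 - eps) * ln (real (M (usr j)))) * PM - real N * (\<Sum>j\<in>J. ln (s j / n0)) * PM
      = (\<Sum>j\<in>J. ln (real (M (usr j))) * ((1 - eps) * PM) + real N * ln (n0 / s j) * PM)"
  proof -
    have "(\<Sum>j\<in>J. ln (s j / n0)) = (\<Sum>j\<in>J. - ln (n0 / s j))"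
    proof (rule sum.cong[OF refl])
      fix j assume "j \<in> J"
      from s[OF this] show "ln (s j / n0) = - ln (n0 / s j)" using n0 by (simp add: ln_div)
    qed
    then show ?thesis
      by (simp add: sum_distrib_left sum_distrib_right sum.distrib sum_subtractf sum_negf algebra_simps)
  qed
  also have "\<dots> \<le> (\<Sum>j\<in>J. ln (real (M (usr j))) * (\<Sum>w\<in>W. prob {z \<in> space \<mu>. ok (usr j) w z}) +
     (\<Sum>w\<in>W. \<Sum>t<N. ln (n0 / s j) + 1 - integral\<^sup>L \<mu> (\<lambda>z. (cmod (e j w z t))\<^sup>2) / s j))"
  proof (intro sum_mono add_mono mult_left_mono)
    fix j assume j: "j \<in> J"
    show "(1 - eps) * PM \<le> (\<Sum>w\<in>W. prob {z \<in> space \<mu>. ok (usr j) w z})" by (rule okp[OF usr[OF j]])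
    show "0 \<le> ln (real (M (usr j)))" using M_pos[OF usr[OF j]] by simp
    \<comment> \<open>On average the two quadratic terms cancel in the right direction: the noise
      energy over \<open>n0\<close> has mean 1 per symbol, and the residual energy over
      \<open>s j\<close> has mean at most 1 by \<open>e2\<close>.\<close>
    have "(\<Sum>w\<in>W. \<Sum>t<N. integral\<^sup>L \<mu> (\<lambda>z. (cmod (e j w z t))\<^sup>2)) / s j \<le> PM * real N"
      using e2[OF j] s[OF j] by (simp add: divide_le_eq mult_ac)
    then show "real N * ln (n0 / s j) * PM \<le> (\<Sum>w\<in>W. \<Sum>t<N. ln (n0 / s j) + 1 - integral\<^sup>L \<mu> (\<lambda>z. (cmod (e j w z t))\<^sup>2) / s j)"
      by (simp add: sum.distrib sum_subtractf sum_divide_distrib card_W[symmetric] algebra_simps del: of_nat_prod card_PiE)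
  qed
  also have "\<dots> = (\<Sum>w\<in>W. integral\<^sup>L \<mu> (G w))"
  proof -
    have "(\<Sum>w\<in>W. integral\<^sup>L \<mu> (G w)) = (\<Sum>w\<in>W. \<Sum>j\<in>J. ln (real (M (usr j))) * prob {z \<in> space \<mu>. ok (usr j) w z} +
     (\<Sum>t<N. ln (n0 / s j) + n0 / n0 - integral\<^sup>L \<mu> (\<lambda>z. (cmod (e j w z t))\<^sup>2) / s j))"
      using Gb by (intro sum.cong refl) (auto simp only: has_bochner_integral_iff)
    also have "\<dots> = (\<Sum>j\<in>J. \<Sum>w\<in>W. ln (real (M (usr j))) * prob {z \<in> space \<mu>. ok (usr j) w z} +
     (\<Sum>t<N. ln (n0 / s j) + n0 / n0 - integral\<^sup>L \<mu> (\<lambda>z. (cmod (e j w z t))\<^sup>2) / s j))"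
      by (rule sum.swap)
    finally show ?thesis using n0 by (simp add: sum.distrib sum_distrib_left)
  qed
  also note GU
  finally have "((\<Sum>j\<in>J. (1 - eps) * ln (real (M (usr j)))) - real N * (\<Sum>j\<in>J. ln (s j / n0))) * PM \<le> (real (card J) * ln 2) * PM"
    by (simp add: left_diff_distrib)
  then have "(\<Sum>j\<in>J. (1 - eps) * ln (real (M (usr j)))) - real N * (\<Sum>j\<in>J. ln (s j / n0)) \<le> real (card J) * ln 2"
    using PM_pos by (simp add: mult_le_cancel_right)
  then show ?thesis by simp
qed

section \<open>Energy of the prediction residuals\<close>

text \<open>The residual consists of a centered own signal, the part \<open>B\<close> of the signal
  of user 0 that is left after prediction, and two noises. Messages and noises are independent and
  \<open>A\<close> sums to zero over its messages, so the energies add up although the codebook of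
  user 0 need not be centered. For receiver 0 the own signal is the \<open>B\<close> term itself,
  hence \<open>A\<close> vanishes; the alternative \<open>\<alpha> = 0\<close> covers receivers
  without side information.\<close>

lemma residual_sq:
  fixes A :: "nat \<Rightarrow> nat \<Rightarrow> complex" and B \<alpha> :: complex
  assumes i: "i \<le> K" "i' \<le> K" "i' \<noteq> i \<or> \<alpha> = 0"
    and A0: "i = 0 \<Longrightarrow> \<forall>b t. A b t = 0" and Ac: "\<And>t. i \<noteq> 0 \<Longrightarrow> t < N \<Longrightarrow> (\<Sum>b<M i. A b t) = 0"
    and A2: "(\<Sum>b<M i. \<Sum>t<N. (cmod (A b t))\<^sup>2) \<le> real (M i) * (real N * pA)"
    and P0: "(\<Sum>a<M 0. \<Sum>t<N. (cmod (enc 0 a t))\<^sup>2) \<le> real (M 0) * (real N * p0)"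
    and pA: "pA \<ge> 0"
  defines "e \<equiv> \<lambda>w z t. A (w i) t + B * enc 0 (w 0) t + z (i, t) - \<alpha> * z (i', t)"
  shows "t < N \<Longrightarrow> integrable \<mu> (\<lambda>z. (cmod (e w z t))\<^sup>2)"
    and "(\<Sum>w\<in>W. \<Sum>t<N. integral\<^sup>L \<mu> (\<lambda>z. (cmod (e w z t))\<^sup>2)) \<le>
      PM * (real N * (pA + (cmod B)\<^sup>2 * p0 + n0 + (cmod \<alpha>)\<^sup>2 * n0))"
proof -
  have main: "integrable \<mu> (\<lambda>z. (cmod (e w z t))\<^sup>2) \<and>
     integral\<^sup>L \<mu> (\<lambda>z. (cmod (e w z t))\<^sup>2) = (cmod (A (w i) t + B * enc 0 (w 0) t))\<^sup>2 + (n0 + (cmod \<alpha>)\<^sup>2 * n0)" if t: "t < N" for w t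
  proof -
    \<comment> \<open>If \<open>i' = i\<close>, then \<open>\<alpha> = 0\<close> and the set
      collapses to one point, on which the coefficient is 1; both cases are thus covered by one
      linear combination.\<close>
    define C where "C = {(i, t), (i', t)}"
    define a where "a p = (if p = (i, t) then 1 else - \<alpha>)" for p :: "nat \<times> nat"
    have C: "finite C" "C \<subseteq> I" using i t by (auto simp: C_def)
    have Ceq: "(\<Sum>p\<in>C. a p * z p) = z (i, t) - \<alpha> * z (i', t)" for z
      using i(3) by (cases "i' = i") (auto simp: C_def a_def)
    have Cv: "(\<Sum>p\<in>C. (cmod (a p))\<^sup>2 * n0) = n0 + (cmod \<alpha>)\<^sup>2 * n0"
      using i(3) by (cases "i' = i") (auto simp: C_def a_def)
    show ?thesis
      using gauss_PiM_lincomb_sq[where v="\<lambda>_. n0" and A=C and I=I and a=a and k="A (w i) t + B * enc 0 (w 0) t", OF n0 C]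
      unfolding Ceq Cv e_def by (simp add: add_diff_eq)
  qed
  then show "t < N \<Longrightarrow> integrable \<mu> (\<lambda>z. (cmod (e w z t))\<^sup>2)" by blast
  have X: "(\<Sum>w\<in>W. \<Sum>t<N. (cmod (A (w i) t + B * enc 0 (w 0) t))\<^sup>2) \<le> PM * (real N * (pA + (cmod B)\<^sup>2 * p0))"
  proof (cases "i = 0")
    case True
    have "real (M 0) * (\<Sum>w\<in>W. \<Sum>t<N. (cmod (A (w i) t + B * enc 0 (w 0) t))\<^sup>2) =
        PM * ((cmod B)\<^sup>2 * (\<Sum>a<M 0. \<Sum>t<N. (cmod (enc 0 a t))\<^sup>2))"
      using sum_PiE_one[of 0 "{..K}" M "\<lambda>a. \<Sum>t<N. (cmod (B * enc 0 a t))\<^sup>2"] A0[OF True]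
      by (simp add: norm_mult power_mult_distrib sum_distrib_left)
    also have "\<dots> \<le> PM * ((cmod B)\<^sup>2 * (real (M 0) * (real N * p0)))"
      using PM_pos by (intro mult_left_mono P0) auto
    also have "\<dots> \<le> real (M 0) * (PM * (real N * (pA + (cmod B)\<^sup>2 * p0)))"
      using pA PM_pos M_real_pos[of 0] by (simp add: algebra_simps)
    finally show ?thesis using M_real_pos[of 0] by simp
  next
    case False
    let ?c = "\<lambda>a t. B * enc 0 a t"
    have cross: "(\<Sum>b<M i. \<Sum>a<M 0. \<Sum>t<N. 2 * Re (A b t * cnj (?c a t))) = 0"
    proof -
      have "(\<Sum>b<M i. \<Sum>a<M 0. \<Sum>t<N. 2 * Re (A b t * cnj (?c a t))) =
          (\<Sum>a<M 0. \<Sum>b<M i. \<Sum>t<N. 2 * Re (A b t * cnj (?c a t)))" by (rule sum.swap)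
      also have "\<dots> = (\<Sum>a<M 0. \<Sum>t<N. \<Sum>b<M i. 2 * Re (A b t * cnj (?c a t)))"
        by (intro sum.cong refl sum.swap)
      also have "\<dots> = (\<Sum>a<M 0. \<Sum>t<N. 2 * Re ((\<Sum>b<M i. A b t) * cnj (?c a t)))"
        by (simp only: sum_distrib_right Re_sum sum_distrib_left)
      also have "\<dots> = 0" using Ac[OF False] by simp
      finally show ?thesis .
    qed
    have "real (M i * M 0) * (\<Sum>w\<in>W. \<Sum>t<N. (cmod (A (w i) t + ?c (w 0) t))\<^sup>2) =
        PM * (\<Sum>b<M i. \<Sum>a<M 0. \<Sum>t<N. (cmod (A b t + ?c a t))\<^sup>2)"
      using sum_PiE_two[of i "{..K}" 0 M "\<lambda>b a. \<Sum>t<N. (cmod (A b t + ?c a t))\<^sup>2"] False i by simp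
    also have "(\<Sum>b<M i. \<Sum>a<M 0. \<Sum>t<N. (cmod (A b t + ?c a t))\<^sup>2) =
        real (M 0) * (\<Sum>b<M i. \<Sum>t<N. (cmod (A b t))\<^sup>2) + real (M i) * ((cmod B)\<^sup>2 * (\<Sum>a<M 0. \<Sum>t<N. (cmod (enc 0 a t))\<^sup>2))"
      using cross by (simp add: cmod_add_power2 sum.distrib norm_mult power_mult_distrib sum_distrib_left)
    also have "PM * \<dots> \<le> PM * (real (M 0) * (real (M i) * (real N * pA)) + real (M i) * ((cmod B)\<^sup>2 * (real (M 0) * (real N * p0))))"
      using PM_pos by (intro mult_left_mono add_mono A2 P0) auto
    also have "\<dots> = real (M i * M 0) * (PM * (real N * (pA + (cmod B)\<^sup>2 * p0)))"
      by (simp add: algebra_simps)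
    finally show ?thesis using M_real_pos[of 0] M_real_pos[OF i(1)] by simp
  qed
  have "(\<Sum>w\<in>W. \<Sum>t<N. integral\<^sup>L \<mu> (\<lambda>z. (cmod (e w z t))\<^sup>2)) =
      (\<Sum>w\<in>W. \<Sum>t<N. (cmod (A (w i) t + B * enc 0 (w 0) t))\<^sup>2 + (n0 + (cmod \<alpha>)\<^sup>2 * n0))"
    using main by (intro sum.cong refl) auto
  also have "\<dots> = (\<Sum>w\<in>W. \<Sum>t<N. (cmod (A (w i) t + B * enc 0 (w 0) t))\<^sup>2) + PM * (real N * (n0 + (cmod \<alpha>)\<^sup>2 * n0))"
    by (simp add: sum.distrib card_W[symmetric] algebra_simps del: of_nat_prod card_PiE)
  also have "\<dots> \<le> PM * (real N * (pA + (cmod B)\<^sup>2 * p0)) + PM * (real N * (n0 + (cmod \<alpha>)\<^sup>2 * n0))"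
    using X by simp
  finally show "(\<Sum>w\<in>W. \<Sum>t<N. integral\<^sup>L \<mu> (\<lambda>z. (cmod (e w z t))\<^sup>2)) \<le>
      PM * (real N * (pA + (cmod B)\<^sup>2 * p0 + n0 + (cmod \<alpha>)\<^sup>2 * n0))"
    by (simp add: algebra_simps)
qed

definition encm :: "nat \<Rightarrow> nat \<Rightarrow> complex" where
  "encm i t = (\<Sum>b<M i. enc i b t) / of_nat (M i)"

text \<open>A variance is at most the second moment, so subtracting the mean codeword keeps the
  power budget.\<close>

lemma centered:
  assumes i: "i \<le> K" and P: "(\<Sum>b<M i. \<Sum>t<N. (cmod (enc i b t))\<^sup>2) \<le> real (M i) * (real N * p)"
  shows "(\<Sum>b<M i. h * (enc i b t - encm i t)) = 0"
    and "(\<Sum>b<M i. \<Sum>t<N. (cmod (h * (enc i b t - encm i t)))\<^sup>2) \<le> real (M i) * (real N * ((cmod h)\<^sup>2 * p))"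
proof -
  have s0: "(\<Sum>b<M i. enc i b t - encm i t) = 0" for t
    using M_real_pos[OF i] by (simp add: sum_subtractf encm_def)
  then show "(\<Sum>b<M i. h * (enc i b t - encm i t)) = 0"
    by (simp flip: sum_distrib_left)
  have var: "(\<Sum>b<M i. (cmod (enc i b t - encm i t))\<^sup>2) \<le> (\<Sum>b<M i. (cmod (enc i b t))\<^sup>2)" for t
  proof -
    have "(\<Sum>b<M i. (cmod (enc i b t))\<^sup>2) = (\<Sum>b<M i. (cmod ((enc i b t - encm i t) + encm i t))\<^sup>2)" by simp
    also have "\<dots> = (\<Sum>b<M i. (cmod (enc i b t - encm i t))\<^sup>2) + real (M i) * (cmod (encm i t))\<^sup>2
        + 2 * Re ((\<Sum>b<M i. enc i b t - encm i t) * cnj (encm i t))"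
      unfolding cmod_add_power2 by (simp add: sum.distrib sum_distrib_right sum_distrib_left)
    finally show ?thesis unfolding s0 by simp
  qed
  have "(\<Sum>b<M i. \<Sum>t<N. (cmod (h * (enc i b t - encm i t)))\<^sup>2) = (cmod h)\<^sup>2 * (\<Sum>t<N. \<Sum>b<M i. (cmod (enc i b t - encm i t))\<^sup>2)"
    by (subst sum.swap) (simp add: norm_mult power_mult_distrib sum_distrib_left)
  also have "\<dots> \<le> (cmod h)\<^sup>2 * (\<Sum>t<N. \<Sum>b<M i. (cmod (enc i b t))\<^sup>2)"
    by (intro mult_left_mono sum_mono var) auto
  also have "\<dots> = (cmod h)\<^sup>2 * (\<Sum>b<M i. \<Sum>t<N. (cmod (enc i b t))\<^sup>2)"
    by (subst sum.swap) simp
  also have "\<dots> \<le> (cmod h)\<^sup>2 * (real (M i) * (real N * p))"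
    by (intro mult_left_mono P) auto
  finally show "(\<Sum>b<M i. \<Sum>t<N. (cmod (h * (enc i b t - encm i t)))\<^sup>2) \<le> real (M i) * (real N * ((cmod h)\<^sup>2 * p))"
    by (simp add: mult_ac)
qed

section \<open>The individual bound and the sum-rate bound for a fixed code\<close>

lemma gkern_nz: "v > 0 \<Longrightarrow> s > 0 \<Longrightarrow> gkern v s m y \<noteq> 0"
  using gkern_pos[of v s m y] by simp

lemma ln_gkern: "s > 0 \<Longrightarrow> ln (gkern n0 s m y) = ln (n0 / s) + (cmod y)\<^sup>2 / n0 - (cmod (y - m))\<^sup>2 / s"
proof -
  have "ln (a * exp x) = ln a + x" if "a > 0" for a x :: real
    using that by (simp add: ln_mult)
  from this[of "n0 / s"] show "s > 0 \<Longrightarrow> ?thesis" using n0 unfolding gkern_def by (simp only: divide_pos_pos add_diff_eq)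
qed

lemma ln_ell: "ln (ell n0 c y) = ((cmod y)\<^sup>2 - (cmod (y - c))\<^sup>2) / n0"
  by (simp add: ell_def)

text \<open>Receiver \<open>i \<ge> 1\<close> may be handed the message of user 0: the test density
  \<open>Q\<close> is centered at \<open>cs a\<close> plus the mean own signal, so the interference
  is removed and no mixture appears. The individual bound for user 0 comes instead from a chain
  without receivers.\<close>

lemma single_user_bound:
  assumes i: "1 \<le> i" "i \<le> K"
    and P: "(\<Sum>b<M i. \<Sum>t<N. (cmod (enc i b t))\<^sup>2) \<le> real (M i) * (real N * p)" and p: "p \<ge> 0"
    and P0: "(\<Sum>a<M 0. \<Sum>t<N. (cmod (enc 0 a t))\<^sup>2) \<le> real (M 0) * (real N * p0)"
    and err: "err_prob K N hdir hc n0 M enc dec \<le> eps"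
  shows "(1 - eps) * ln (real (M i)) \<le> real N * ln (((cmod (hdir i))\<^sup>2 * p + n0) / n0) + ln 2"
proof -
  define s where "s = (cmod (hdir i))\<^sup>2 * p + n0"
  have s: "s > 0" using n0 p by (simp add: s_def add_nonneg_pos)
  define \<kappa> where "\<kappa> t = hdir i * encm i t" for t
  define c where "c a b p = cs a p + own b p" for a b p
  define Q where "Q a z = (\<Prod>t<N. gkern n0 s (cs a (i, t) + \<kappa> t) (z (i, t)))" for a z
  define \<Phi> where "\<Phi> a b y = okf i b y * Q a y / (\<Prod>p\<in>{i}\<times>{..<N}. ell n0 (c a b p) (y p))" for a b y
  have iK: "{i} \<subseteq> {..K}" using i by simp
  have zm: "t < N \<Longrightarrow> (\<lambda>z. z (i, t)) \<in> borel_measurable \<mu>" for t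
    using i by (intro measurable_comp_mu) auto
  have zm': "p \<in> {i} \<times> {..<N} \<Longrightarrow> (\<lambda>z. z p) \<in> borel_measurable \<mu>" for p
    using i by (intro measurable_comp_mu) auto
  have okm: "okf i b \<in> borel_measurable \<mu>" for b
    by (rule measurable_okf[OF i(2)]) (rule zm)
  have Qm: "Q a \<in> borel_measurable \<mu>" for a
    unfolding Q_def by (intro borel_measurable_prod measurable_gkern borel_measurable_const zm) auto
  have Qpos: "Q a y > 0" for a y unfolding Q_def by (intro prod_pos ballI gkern_pos n0 s)
  have Em: "(\<lambda>y. \<Prod>p\<in>{i}\<times>{..<N}. ell n0 (c a b p) (y p)) \<in> borel_measurable \<mu>" for a b
    by (intro borel_measurable_prod measurable_compose[OF zm' measurable_ell])
  have Epos: "(\<Prod>p\<in>{i}\<times>{..<N}. ell n0 (c a b p) (y p)) > 0" for a b y by (rule prod_pos) simp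
  have \<Phi>m: "\<Phi> a b \<in> borel_measurable \<mu>" for a b
    unfolding \<Phi>_def by (intro borel_measurable_divide borel_measurable_times okm Qm Em)
  have \<Phi>pos: "\<Phi> a b y > 0" for a b y
    unfolding \<Phi>_def using okf_pos[OF i(2)] Qpos Epos by simp
  have \<Phi>sh: "(\<integral>\<^sup>+z. ennreal (\<Phi> a b (\<lambda>p. z p + c a b p)) \<partial>\<mu>) = (\<integral>\<^sup>+z. ennreal (okf i b z * Q a z) \<partial>\<mu>)" for a b
  proof -
    have "(\<integral>\<^sup>+z. ennreal (\<Phi> a b (\<lambda>p. z p + c a b p)) \<partial>\<mu>) =
       (\<integral>\<^sup>+z. ennreal (\<Phi> a b z) * ennreal (\<Prod>p\<in>{i}\<times>{..<N}. ell n0 (c a b p) (z p)) \<partial>\<mu>)"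
    proof (rule noise_shift[where A="{i}"])
      fix z z' :: "nat \<times> nat \<Rightarrow> complex" assume e: "\<And>p. p \<in> {i} \<times> {..<N} \<Longrightarrow> z p = z' p"
      have "okf i b z = okf i b z'" by (rule okf_cong) (use e in auto)
      moreover have "Q a z = Q a z'" unfolding Q_def by (rule prod.cong) (use e in auto)
      moreover have "(\<Prod>p\<in>{i}\<times>{..<N}. ell n0 (c a b p) (z p)) = (\<Prod>p\<in>{i}\<times>{..<N}. ell n0 (c a b p) (z' p))"
        by (rule prod.cong) (use e in auto)
      ultimately show "ennreal (\<Phi> a b z) = ennreal (\<Phi> a b z')" unfolding \<Phi>_def by simp
    qed (use \<Phi>m iK in auto)
    also have "\<dots> = (\<integral>\<^sup>+z. ennreal (okf i b z * Q a z) \<partial>\<mu>)"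
    proof (rule nn_integral_cong)
      fix z
      have "\<Phi> a b z * (\<Prod>p\<in>{i}\<times>{..<N}. ell n0 (c a b p) (z p)) = okf i b z * Q a z"
        unfolding \<Phi>_def using Epos[of a b z] by simp
      then show "ennreal (\<Phi> a b z) * ennreal (\<Prod>p\<in>{i}\<times>{..<N}. ell n0 (c a b p) (z p)) = ennreal (okf i b z * Q a z)"
        using \<Phi>pos[of a b z] Epos[of a b z] by (simp flip: ennreal_mult)
    qed
    finally show ?thesis .
  qed
  have Q1: "(\<integral>\<^sup>+z. ennreal (Q a z) \<partial>\<mu>) = 1" for a
    using gkern_eliminate[OF i(2) s, of "\<lambda>_. 1" "\<lambda>t z. cs a (i, t) + \<kappa> t"] prob_space.emeasure_space_1[OF prob_mu]
    by (simp add: Q_def)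
  have yyc: "yy w z (i, t) = z (i, t) + c (w 0) (w i) (i, t)" for w z t
    by (simp add: yy_def c_def)
  have okyy: "okf i b (\<lambda>p. z p + c (w 0) (w i) p) = okf i b (yy w z)" for b w z
    by (rule okf_cong) (simp add: yyc)
  let ?U = "\<lambda>(j::nat) w z. \<Phi> (w 0) (w i) (\<lambda>p. z p + c (w 0) (w i) p)"
  \<comment> \<open>The zero multiples are written out so that the residual has the shape of
    \<open>residual_sq\<close> with \<open>B = 0\<close> and \<open>\<alpha> = 0\<close>.\<close>
  let ?e = "\<lambda>(j::nat) w z t. hdir i * (enc i (w i) t - encm i t) + 0 * enc 0 (w 0) t + z (i, t) - 0 * z (0, t)"
  have "(\<Sum>j\<in>{0::nat}. (1 - eps) * ln (real (M i))) \<le> real N * (\<Sum>j\<in>{0::nat}. ln (s / n0)) + real (card {0::nat}) * ln 2"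
  proof (rule converse_core[where U="?U" and e="?e" and usr="\<lambda>_. i" and s="\<lambda>_. s" and eps=eps])
    fix w :: "nat \<Rightarrow> nat"
    have sh: "(\<lambda>z. \<lambda>p\<in>I. z p + c (w 0) (w i) p) \<in> measurable \<mu> \<mu>"
      by (rule measurable_restrict) measurable
    have loc: "\<Phi> a b (\<lambda>p. z p + c (w 0) (w i) p) = \<Phi> a b (\<lambda>p\<in>I. z p + c (w 0) (w i) p)" for a b z
    proof -
      let ?x = "\<lambda>p. z p + c (w 0) (w i) p" and ?y = "\<lambda>p\<in>I. z p + c (w 0) (w i) p"
      have "okf i b ?x = okf i b ?y" by (rule okf_cong) (use i in auto)
      moreover have "Q a ?x = Q a ?y" unfolding Q_def by (rule prod.cong) (use i in auto)
      moreover have "(\<Prod>p\<in>{i}\<times>{..<N}. ell n0 (c a b p) (?x p)) = (\<Prod>p\<in>{i}\<times>{..<N}. ell n0 (c a b p) (?y p))"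
        by (rule prod.cong) (use i in auto)
      ultimately show ?thesis unfolding \<Phi>_def by (simp only:)
    qed
    show "?U j w \<in> borel_measurable \<mu>" for j
      unfolding loc by (rule measurable_compose[OF sh \<Phi>m])
  next
    have "(\<Sum>w\<in>W. \<integral>\<^sup>+z. ennreal (okf i (w i) z * Q (w 0) z) \<partial>\<mu>) \<le> ennreal (2 * PM)"
    proof (rule sum_W_two[of 0 i "\<lambda>a b. \<integral>\<^sup>+z. ennreal (okf i b z * Q a z) \<partial>\<mu>"])
      have "(\<Sum>a<M 0. \<Sum>b<M i. \<integral>\<^sup>+z. ennreal (okf i b z * Q a z) \<partial>\<mu>) \<le> (\<Sum>a<M 0. ennreal (2 * real (M i)))"
        by (intro sum_mono sum_okf_integral_le i Qm) (auto simp: Q1 less_imp_le[OF Qpos])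
      also have "\<dots> = ennreal (2 * real (M 0) * real (M i))"
        by (simp add: ennreal_of_nat_eq_real_of_nat mult_ac flip: ennreal_mult)
      finally show "(\<Sum>a<M 0. \<Sum>b<M i. \<integral>\<^sup>+z. ennreal (okf i b z * Q a z) \<partial>\<mu>) \<le> ennreal (2 * real (M 0) * real (M i))" .
    qed (use i in auto)
    then show "(\<Sum>w\<in>W. \<integral>\<^sup>+z. ennreal (?U j w z) \<partial>\<mu>) \<le> ennreal (2 * PM)" for j
      unfolding \<Phi>sh .
  next
    fix w z
    have "ln (?U 0 w z) = ln (okf i (w i) (yy w z)) + ln (Q (w 0) (\<lambda>p. z p + c (w 0) (w i) p)) -
        ln (\<Prod>p\<in>{i}\<times>{..<N}. ell n0 (c (w 0) (w i) p) (z p + c (w 0) (w i) p))"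
      unfolding \<Phi>_def okyy using okf_pos[OF i(2), of "w i" "yy w z"] Qpos[of "w 0" "\<lambda>p. z p + c (w 0) (w i) p"] Epos[of "w 0" "w i" "\<lambda>p. z p + c (w 0) (w i) p"]
      by (simp add: ln_div ln_mult)
    also have "ln (Q (w 0) (\<lambda>p. z p + c (w 0) (w i) p)) = (\<Sum>t<N. ln (gkern n0 s (cs (w 0) (i, t) + \<kappa> t) (z (i, t) + c (w 0) (w i) (i, t))))"
      unfolding Q_def by (intro ln_prod) (auto simp: gkern_nz n0 s)
    also have "ln (\<Prod>p\<in>{i}\<times>{..<N}. ell n0 (c (w 0) (w i) p) (z p + c (w 0) (w i) p)) =
        (\<Sum>p\<in>{i}\<times>{..<N}. ln (ell n0 (c (w 0) (w i) p) (z p + c (w 0) (w i) p)))"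
      by (intro ln_prod) auto
    also have "\<dots> = (\<Sum>t<N. ln (ell n0 (c (w 0) (w i) (i, t)) (z (i, t) + c (w 0) (w i) (i, t))))"
      by (rule sum.reindex_bij_witness[of _ "\<lambda>t. (i, t)" snd]) auto
    finally have "ln (?U 0 w z) = ln (okf i (w i) (yy w z)) + (\<Sum>t<N. ln (gkern n0 s (cs (w 0) (i, t) + \<kappa> t) (z (i, t) + c (w 0) (w i) (i, t)))
        - ln (ell n0 (c (w 0) (w i) (i, t)) (z (i, t) + c (w 0) (w i) (i, t))))"
      by (simp add: sum_subtractf)
    also have "\<dots> = ln (okf i (w i) (yy w z)) + (\<Sum>t<N. ln (n0 / s) + (cmod (z (i, t)))\<^sup>2 / n0 - (cmod (?e 0 w z t))\<^sup>2 / s)"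
    proof (intro arg_cong2[where f="(+)"] refl sum.cong)
      fix t
      have h: "z (i, t) + c (w 0) (w i) (i, t) - (cs (w 0) (i, t) + \<kappa> t) = ?e 0 w z t"
        using i by (simp add: c_def own_def \<kappa>_def algebra_simps)
      show "ln (gkern n0 s (cs (w 0) (i, t) + \<kappa> t) (z (i, t) + c (w 0) (w i) (i, t)))
        - ln (ell n0 (c (w 0) (w i) (i, t)) (z (i, t) + c (w 0) (w i) (i, t))) = ln (n0 / s) + (cmod (z (i, t)))\<^sup>2 / n0 - (cmod (?e 0 w z t))\<^sup>2 / s"
        unfolding ln_gkern[OF s] ln_ell h by (simp add: diff_divide_distrib)
    qed
    finally show "(\<Sum>j\<in>{0::nat}. ln (?U j w z)) = (\<Sum>j\<in>{0::nat}. ln (okf i (w i) (yy w z)) +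
          (\<Sum>t<N. ln (n0 / s) + (cmod (z (i, t)))\<^sup>2 / n0 - (cmod (?e j w z t))\<^sup>2 / s))" by simp
  next
    note R = residual_sq[where i=i and i'=0 and \<alpha>=0 and A="\<lambda>b t. hdir i * (enc i b t - encm i t)" and pA="(cmod (hdir i))\<^sup>2 * p" and ?p0.0=p0 and B=0,
        OF i(2) _ _ _ centered(1)[OF i(2) P] centered(2)[OF i(2) P] P0]
    show "integrable \<mu> (\<lambda>z. (cmod (?e j w z t))\<^sup>2)" if "t < N" for j w t
      by (rule R(1)) (use i p that in auto)
    have "(\<Sum>w\<in>W. \<Sum>t<N. integral\<^sup>L \<mu> (\<lambda>z. (cmod (?e 0 w z t))\<^sup>2)) \<le>
      PM * (real N * ((cmod (hdir i))\<^sup>2 * p + (cmod 0)\<^sup>2 * p0 + n0 + (cmod 0)\<^sup>2 * n0))"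
      by (rule R(2)) (use i p in auto)
    then show "(\<Sum>w\<in>W. \<Sum>t<N. integral\<^sup>L \<mu> (\<lambda>z. (cmod (?e j w z t))\<^sup>2)) \<le> PM * (real N * s)" for j
      by (simp add: s_def)
  qed (use i err s \<Phi>pos in auto)
  then show ?thesis by (simp add: s_def)
qed

text \<open>With \<open>s\<close> the interference plus noise at each receiver, the test functions are, for the users
  \<open>u 0, u 1, \<dots>, u (m - 1)\<close> of the chain, the Fano weight \<open>okf\<close> times \<open>Q k\<close>, a Gaussian
  conditional density of the output \<open>y\<^sub>k\<close> given \<open>s\<^sub>k\<^sub>-\<^sub>1\<close> with linear estimator
  \<open>\<alpha> k\<close>, times \<open>mix (u ` {..<k}) / mix (u ` {..<Suc k})\<close>; the last one, for user 0, has
  \<open>mix (u ` {..<m})\<close> over the likelihood given the message of user 0. The factors \<open>mix\<close>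
  telescope, which is the chain rule for \<open>h(s\<^sub>1, \<dots>, s\<^sub>m)\<close>. Subtracting the means \<open>encm\<close> makes
  the cross terms between users vanish.\<close>
lemma chain_bound:
  fixes u :: "nat \<Rightarrow> nat" and m :: nat and \<alpha> :: "nat \<Rightarrow> complex"
  assumes inj: "inj_on u {..<m}" and u: "\<And>k. k < m \<Longrightarrow> 1 \<le> u k \<and> u k \<le> K"
    and \<alpha>0: "\<alpha> 0 = 0"
    and P: "\<And>i. i \<le> K \<Longrightarrow> (\<Sum>b<M i. \<Sum>t<N. (cmod (enc i b t))\<^sup>2) \<le> real (M i) * (real N * P i)"
    and Pnn: "\<And>i. i \<le> K \<Longrightarrow> P i \<ge> 0"
    and err: "err_prob K N hdir hc n0 M enc dec \<le> eps"
  defines "v \<equiv> \<lambda>k. if k < m then u k else 0"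
    and "pr \<equiv> \<lambda>k. if k = 0 then 0 else u (k - 1)"
  defines "s \<equiv> \<lambda>k. (if k < m then (cmod (hdir (u k)))\<^sup>2 * P (u k) else 0) +
      (cmod (gain (v k) - \<alpha> k * gain (pr k)))\<^sup>2 * P 0 + n0 + (cmod (\<alpha> k))\<^sup>2 * n0"
  shows "(\<Sum>k\<le>m. (1 - eps) * ln (real (M (v k)))) \<le> real N * (\<Sum>k\<le>m. ln (s k / n0)) + real (m + 1) * ln 2"
proof -
  have s: "s k > 0" if "k \<le> m" for k
  proof -
    have "0 \<le> (if k < m then (cmod (hdir (u k)))\<^sup>2 * P (u k) else 0)" using u Pnn by auto
    moreover have "0 \<le> (cmod (gain (v k) - \<alpha> k * gain (pr k)))\<^sup>2 * P 0" using Pnn[of 0] by simp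
    ultimately show ?thesis unfolding s_def using n0 by (simp add: add_nonneg_pos add_pos_nonneg)
  qed
  have vK: "v k \<le> K" if "k \<le> m" for k using u that by (auto simp: v_def)
  have prK: "pr k \<le> K" if "k \<le> m" for k using u[of "k - 1"] that by (auto simp: pr_def)
  have prv: "pr k \<noteq> v k" if "k \<le> m" "k \<noteq> 0" for k
  proof (cases "k < m")
    case True
    then have "k - 1 < m" by simp
    then have "u (k - 1) \<noteq> u k" using True that inj_onD[OF inj, of "k - 1" k] by auto
    then show ?thesis using True that by (simp add: v_def pr_def)
  next
    case False
    then show ?thesis using u[of "k - 1"] that by (auto simp: v_def pr_def)
  qed
  have SK: "u ` {..<k} \<subseteq> {..K}" if "k \<le> m" for k using u that by fastforce
  have v_notin: "v k \<notin> u ` {..<k}" if "k \<le> m" for k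
  proof
    assume "v k \<in> u ` {..<k}"
    then obtain j where j: "j < k" "v k = u j" by auto
    show False
    proof (cases "k < m")
      case True then show False using j inj_onD[OF inj, of k j] by (simp add: v_def)
    next
      case False then show False using j that u[of j] by (simp add: v_def)
    qed
  qed
  have pr_in: "pr k \<in> u ` {..<k}" if "k \<noteq> 0" for k using that by (auto simp: pr_def)

  define \<kappa> where "\<kappa> k t = (if k < m then hdir (u k) * encm (u k) t else 0)" for k t
  define pm where "pm k z t = \<alpha> k * z (pr k, t) + \<kappa> k t" for k and z :: "nat \<times> nat \<Rightarrow> complex" and t
  define Q where "Q k z = (\<Prod>t<N. gkern n0 (s k) (pm k z t) (z (v k, t)))" for k z
  \<comment> \<open>Here \<open>z\<close> stands for interference plus noise. The own signal is
    added at receiver \<open>u k\<close> alone, which turns \<open>z\<close> into the output there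
    and leaves the side information from earlier receivers free of their own signals.\<close>
  define sh where "sh k b z p = z p + (if fst p = u k then own b p else 0)" for k b and z :: "nat \<times> nat \<Rightarrow> complex" and p
  \<comment> \<open>\<open>E\<close> compensates the shift by the own signal: it is the reciprocal
    of the likelihood ratio of that shift, taken at the shifted point. Integrating the shifted
    function against \<open>E\<close> is therefore integrating the unshifted one against the
    noise.\<close>
  define E where "E k b z = (\<Prod>t<N. ell n0 (- own b (u k, t)) (z (u k, t)))" for k b z
  define \<Phi> where "\<Phi> k b z = okf (u k) b (sh k b z) * Q k (sh k b z) * E k b z * mix (u ` {..<k}) z / mix (u ` {..<Suc k}) z" for k b z
  define \<Phi>0 where "\<Phi>0 a z = okf 0 a z * Q m z * mix (u ` {..<m}) z / LL (insert 0 (u ` {..<m})) a z" for a z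
  define U where "U k w z = (if k < m then \<Phi> k (w (u k)) (\<lambda>p. z p + cs (w 0) p) else \<Phi>0 (w 0) (\<lambda>p. z p + cs (w 0) p))" for k w z

  have Qpos: "Q k z > 0" if "k \<le> m" for k z
    unfolding Q_def by (intro prod_pos ballI gkern_pos n0 s that)
  have Epos: "E k b z > 0" for k b z unfolding E_def by (rule prod_pos) simp
  have pmm: "(\<lambda>z. pm k z t) \<in> borel_measurable \<mu>" if "k \<le> m" "t < N" for k t
    unfolding pm_def
    by (intro borel_measurable_add borel_measurable_times borel_measurable_const measurable_comp_mu) (use prK that in auto)
  have Qm: "Q k \<in> borel_measurable \<mu>" if "k \<le> m" for k
    unfolding Q_def
    by (intro borel_measurable_prod measurable_gkern pmm that measurable_comp_mu) (use vK[OF that] in auto)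
  \<comment> \<open>The predecessor \<open>pr 0 = 0\<close> of the first receiver is a dummy value,
    neutralized by \<open>\<alpha> 0 = 0\<close>.\<close>
  have pm_cong: "pm k z t = pm k z' t" if "k \<noteq> 0 \<Longrightarrow> z (pr k, t) = z' (pr k, t)" for k z z' t
    using that \<alpha>0 by (cases "k = 0") (auto simp: pm_def)
  have Q_cong: "Q k z = Q k z'" if "\<And>p. p \<in> insert (v k) (u ` {..<k}) \<times> {..<N} \<Longrightarrow> z p = z' p" for k z z'
    unfolding Q_def using that pr_in
    by (intro prod.cong refl arg_cong2[where f="gkern n0 (s k)"] pm_cong) auto
  \<comment> \<open>A mixture density of the earlier interference times a conditional density of the
    new output is a joint probability density. The new output is integrated out first; neither the
    mixture nor the estimator reads it.\<close>
  have Qmix: "(\<integral>\<^sup>+z. ennreal (Q k z * mix (u ` {..<k}) z) \<partial>\<mu>) = 1" if k: "k \<le> m" for k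
  proof -
    have "(\<integral>\<^sup>+z. ennreal (Q k z * mix (u ` {..<k}) z) \<partial>\<mu>) =
        (\<integral>\<^sup>+z. ennreal (mix (u ` {..<k}) z) * ennreal (\<Prod>t<N. gkern n0 (s k) (pm k z t) (z (v k, t))) \<partial>\<mu>)"
      using Qpos[OF k] mix_pos by (intro nn_integral_cong) (simp add: Q_def less_imp_le mult.commute flip: ennreal_mult)
    also have "\<dots> = (\<integral>\<^sup>+z. ennreal (mix (u ` {..<k}) z) \<partial>\<mu>)"
    proof (rule gkern_eliminate[where m="\<lambda>t z. pm k z t"])
      fix z z' :: "nat \<times> nat \<Rightarrow> complex" assume e: "\<And>p. p \<in> I \<Longrightarrow> fst p \<noteq> v k \<Longrightarrow> z p = z' p"
      have "mix (u ` {..<k}) z = mix (u ` {..<k}) z'"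
      proof (rule mix_cong)
        fix p assume "p \<in> u ` {..<k} \<times> {..<N}"
        then have p: "fst p \<in> u ` {..<k}" "snd p < N" by (auto simp only: mem_Times_iff lessThan_iff)
        then have "fst p \<noteq> v k" "fst p \<in> {..K}" using v_notin[OF k] subsetD[OF SK[OF k]] by metis+
        then show "z p = z' p" using p by (intro e) (auto simp only: mem_Times_iff lessThan_iff)
      qed
      then show "ennreal (mix (u ` {..<k}) z) = ennreal (mix (u ` {..<k}) z')" by simp
      show "pm k z t = pm k z' t" if "t < N" for t
        using prv[OF k] prK[OF k] that by (intro pm_cong e) auto
    qed (use vK[OF k] s[OF k] measurable_mix[OF SK[OF k]] pmm k in auto)
    also have "\<dots> = 1" by (rule mix_integral[OF SK[OF k]])
    finally show ?thesis .
  qed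

  have okshm: "(\<lambda>z. okf (u k) b (sh k b z)) \<in> borel_measurable \<mu>" if k: "k < m" for k b
  proof (rule measurable_okf)
    show "u k \<le> K" using u[OF k] by simp
    show "(\<lambda>z. sh k b z (u k, t)) \<in> borel_measurable \<mu>" if "t < N" for t
      unfolding sh_def
      by (intro borel_measurable_add borel_measurable_const measurable_comp_mu) (use u[OF k] that in auto)
  qed
  have shQ: "Q k (sh k b z) = (\<Prod>t<N. gkern n0 (s k) (pm k z t) (z (u k, t) + own b (u k, t)))" if k: "k < m" for k b z
  proof -
    have "pm k (sh k b z) t = pm k z t" for t
      using prv[of k] k by (intro pm_cong) (auto simp: sh_def v_def)
    then show ?thesis using k by (simp add: Q_def v_def sh_def)
  qed
  have uc: "(\<lambda>z. z (u k, t)) \<in> borel_measurable \<mu>" if "k < m" "t < N" for k t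
    using u[OF that(1)] that by (intro measurable_comp_mu) auto
  have Qshm: "(\<lambda>z. Q k (sh k b z)) \<in> borel_measurable \<mu>" if k: "k < m" for k b
    unfolding shQ[OF k]
    by (intro borel_measurable_prod measurable_gkern pmm borel_measurable_add borel_measurable_const uc) (use k in auto)
  have Em: "E k b \<in> borel_measurable \<mu>" if k: "k < m" for k b
    unfolding E_def by (intro borel_measurable_prod measurable_compose[OF uc[OF k] measurable_ell]) auto
  have \<Phi>m: "\<Phi> k b \<in> borel_measurable \<mu>" if k: "k < m" for k b
    unfolding \<Phi>_def using SK[of k] SK[of "Suc k"] k
    by (intro borel_measurable_divide borel_measurable_times okshm Qshm Em measurable_mix) auto
  have \<Phi>pos: "\<Phi> k b z > 0" if k: "k < m" for k b z
    unfolding \<Phi>_def using okf_pos[of "u k"] u[OF k] Qpos[of k] k Epos mix_pos by simp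
  have S0K: "insert 0 (u ` {..<m}) \<subseteq> {..K}" using SK[of m] by simp
  have ok0m: "okf 0 a \<in> borel_measurable \<mu>" for a
    by (rule measurable_okf) (auto intro!: measurable_comp_mu)
  have \<Phi>0m: "\<Phi>0 a \<in> borel_measurable \<mu>" for a
    unfolding \<Phi>0_def using SK[of m] S0K
    by (intro borel_measurable_divide borel_measurable_times ok0m Qm measurable_mix measurable_LL) auto
  have \<Phi>0pos: "\<Phi>0 a z > 0" for a z
    unfolding \<Phi>0_def using okf_pos[of 0] Qpos[of m] LL_pos mix_pos by simp
  have ok_sh_cong: "okf (u k) b (sh k b z) = okf (u k) b (sh k b z')" if "\<And>t. t < N \<Longrightarrow> z (u k, t) = z' (u k, t)" for k b z z'
    by (rule okf_cong) (simp add: sh_def that)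
  have \<Phi>_cong: "\<Phi> k b z = \<Phi> k b z'" if k: "k < m" and e: "\<And>p. p \<in> u ` {..<Suc k} \<times> {..<N} \<Longrightarrow> z p = z' p" for k b z z'
  proof -
    have uk: "t < N \<Longrightarrow> z (u k, t) = z' (u k, t)" for t using e by auto
    have "Q k (sh k b z) = Q k (sh k b z')"
      by (rule Q_cong) (use e k in \<open>auto simp: sh_def v_def\<close>)
    moreover have "E k b z = E k b z'" unfolding E_def by (rule prod.cong) (auto simp: uk)
    moreover have "mix (u ` {..<k}) z = mix (u ` {..<k}) z'" by (rule mix_cong) (use e in auto)
    moreover have "mix (u ` {..<Suc k}) z = mix (u ` {..<Suc k}) z'" by (rule mix_cong) (use e in auto)
    ultimately show ?thesis unfolding \<Phi>_def using ok_sh_cong[of z k z' b] uk by (simp only:)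
  qed
  have \<Phi>0_cong: "\<Phi>0 a z = \<Phi>0 a z'" if e: "\<And>p. p \<in> insert 0 (u ` {..<m}) \<times> {..<N} \<Longrightarrow> z p = z' p" for a z z'
  proof -
    have "okf 0 a z = okf 0 a z'" by (rule okf_cong) (use e in auto)
    moreover have "Q m z = Q m z'" by (rule Q_cong) (use e in \<open>auto simp: v_def\<close>)
    moreover have "mix (u ` {..<m}) z = mix (u ` {..<m}) z'" by (rule mix_cong) (use e in auto)
    moreover have "LL (insert 0 (u ` {..<m})) a z = LL (insert 0 (u ` {..<m})) a z'" by (rule LL_cong) (use e in auto)
    ultimately show ?thesis unfolding \<Phi>0_def by (simp only:)
  qed

  have U2k: "(\<Sum>w\<in>W. \<integral>\<^sup>+z. ennreal (U k w z) \<partial>\<mu>) \<le> ennreal (2 * PM)" if k: "k < m" for k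
  proof -
    let ?S = "u ` {..<Suc k}"
    have SuK: "?S \<subseteq> {..K}" using SK[of "Suc k"] k by simp
    have ukK: "u k \<le> K" "u k \<noteq> 0" using u[OF k] by auto
    define H where "H a b = (\<integral>\<^sup>+z. ennreal (\<Phi> k b z) * ennreal (LL ?S a z) \<partial>\<mu>)" for a b
    have "(\<Sum>w\<in>W. \<integral>\<^sup>+z. ennreal (U k w z) \<partial>\<mu>) = (\<Sum>w\<in>W. H (w 0) (w (u k)))"
    proof (rule sum.cong[OF refl])
      fix w
      show "(\<integral>\<^sup>+z. ennreal (U k w z) \<partial>\<mu>) = H (w 0) (w (u k))"
        unfolding H_def U_def if_P[OF k]
      proof (rule noise_shift_cs[OF _ SuK])
        show "(\<lambda>z. ennreal (\<Phi> k (w (u k)) z)) \<in> borel_measurable \<mu>"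
          by (rule measurable_compose[OF \<Phi>m[OF k] measurable_ennreal])
        fix z z' :: "nat \<times> nat \<Rightarrow> complex" assume "\<And>p. p \<in> ?S \<times> {..<N} \<Longrightarrow> z p = z' p"
        from \<Phi>_cong[OF k this] show "ennreal (\<Phi> k (w (u k)) z) = ennreal (\<Phi> k (w (u k)) z')" by simp
      qed
    qed
    also have "\<dots> \<le> ennreal (2 * PM)"
    proof (rule sum_W_two)
      define R where "R b z = okf (u k) b (sh k b z) * Q k (sh k b z) * E k b z * mix (u ` {..<k}) z" for b z
      have Rpos: "R b z > 0" for b z
        unfolding R_def using okf_pos[OF ukK(1)] Qpos[of k] k Epos mix_pos by simp
      \<comment> \<open>Averaging the likelihood over the message of user 0 reproduces the mixture
        in the denominator of \<open>\<Phi>\<close>. This is the only place where the larger mixture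
        has to be met, and it cancels without being evaluated.\<close>
      have sumH: "(\<Sum>a<M 0. H a b) = ennreal (real (M 0)) * (\<integral>\<^sup>+z. ennreal (R b z) \<partial>\<mu>)" for b
      proof -
        note [measurable] = \<Phi>m[OF k] measurable_LL[OF SuK]
        have "(\<Sum>a<M 0. H a b) = (\<integral>\<^sup>+z. (\<Sum>a<M 0. ennreal (\<Phi> k b z) * ennreal (LL ?S a z)) \<partial>\<mu>)"
          unfolding H_def by (rule nn_integral_sum[symmetric]) measurable
        also have "\<dots> = (\<integral>\<^sup>+z. ennreal (real (M 0)) * ennreal (R b z) \<partial>\<mu>)"
        proof (rule nn_integral_cong)
          fix z
          have "(\<Sum>a<M 0. ennreal (\<Phi> k b z) * ennreal (LL ?S a z)) = ennreal (\<Sum>a<M 0. \<Phi> k b z * LL ?S a z)"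
            using \<Phi>pos[OF k] LL_pos by (simp add: ennreal_mult less_imp_le flip: sum_ennreal)
          also have "(\<Sum>a<M 0. \<Phi> k b z * LL ?S a z) = \<Phi> k b z * (real (M 0) * mix ?S z)"
            using M_real_pos[of 0] by (simp add: mix_def flip: sum_distrib_left)
          also have "\<dots> = real (M 0) * R b z"
            unfolding \<Phi>_def R_def using mix_pos[of ?S z] by simp
          finally show "(\<Sum>a<M 0. ennreal (\<Phi> k b z) * ennreal (LL ?S a z)) = ennreal (real (M 0)) * ennreal (R b z)"
            using Rpos[of b z] by (simp add: ennreal_mult)
        qed
        also have "\<dots> = ennreal (real (M 0)) * (\<integral>\<^sup>+z. ennreal (R b z) \<partial>\<mu>)"
        proof (rule nn_integral_cmult)
          show "(\<lambda>z. ennreal (R b z)) \<in> borel_measurable \<mu>"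
            unfolding R_def using SK[of k] k
            by (intro measurable_compose[OF _ measurable_ennreal] borel_measurable_times okshm Qshm Em measurable_mix) auto
        qed
        finally show ?thesis .
      qed
      have Rsh: "(\<integral>\<^sup>+z. ennreal (R b z) \<partial>\<mu>) = (\<integral>\<^sup>+z. ennreal (okf (u k) b z * (Q k z * mix (u ` {..<k}) z)) \<partial>\<mu>)" for b
      proof -
        define d where "d p = (if fst p = u k then own b p else 0)" for p
        define T where "T z = okf (u k) b z * (Q k z * mix (u ` {..<k}) z) / (\<Prod>p\<in>?S \<times> {..<N}. ell n0 (d p) (z p))" for z
        have Dpos: "(\<Prod>p\<in>?S \<times> {..<N}. ell n0 (d p) (z p)) > 0" for z by (rule prod_pos) simp
        have RT: "R b z = T (\<lambda>p. z p + d p)" for z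
        proof -
          have shd: "sh k b z = (\<lambda>p. z p + d p)" by (auto simp: sh_def d_def)
          have mx: "mix (u ` {..<k}) (\<lambda>p. z p + d p) = mix (u ` {..<k}) z"
          proof (rule mix_cong)
            fix p assume "p \<in> u ` {..<k} \<times> {..<N}"
            then have "fst p \<in> u ` {..<k}" by (simp only: mem_Times_iff)
            moreover have "u k \<notin> u ` {..<k}" using v_notin[of k] k by (simp only: v_def if_True less_imp_le not_False_eq_True)
            ultimately have "fst p \<noteq> u k" by metis
            then show "z p + d p = z p" by (simp add: d_def)
          qed
          have "(\<Prod>p\<in>?S \<times> {..<N}. ell n0 (d p) (z p + d p)) = (\<Prod>p\<in>{u k} \<times> {..<N}. ell n0 (d p) (z p + d p))"
            by (rule prod.mono_neutral_cong_right) (auto simp: d_def ell_def)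
          also have "\<dots> = (\<Prod>t<N. ell n0 (own b (u k, t)) (z (u k, t) + own b (u k, t)))"
            by (rule prod.reindex_bij_witness[of _ "\<lambda>t. (u k, t)" snd]) (auto simp: d_def)
          also have "\<dots> = (\<Prod>t<N. inverse (ell n0 (- own b (u k, t)) (z (u k, t))))"
            by (rule prod.cong) (auto simp: ell_def diff_divide_distrib simp flip: exp_minus)
          also have "\<dots> = inverse (E k b z)" unfolding E_def
            using prod_inversef[of "\<lambda>t. ell n0 (- own b (u k, t)) (z (u k, t))" "{..<N}"] by (simp add: comp_def)
          finally show ?thesis unfolding R_def T_def shd mx by (simp add: field_simps)
        qed
        have Dm: "(\<lambda>z. \<Prod>p\<in>?S \<times> {..<N}. ell n0 (d p) (z p)) \<in> borel_measurable \<mu>"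
          by (intro borel_measurable_prod measurable_compose[OF measurable_comp_mu measurable_ell]) (use SuK in auto)
        have okm: "okf (u k) b \<in> borel_measurable \<mu>"
          by (rule measurable_okf[OF ukK(1)]) (use uc[OF k] in auto)
        have Tm: "T \<in> borel_measurable \<mu>"
          unfolding T_def using k SK[of k] by (intro borel_measurable_divide borel_measurable_times okm Qm measurable_mix Dm) auto
        have Tpos: "T z \<ge> 0" for z
          unfolding T_def using okf_pos[OF ukK(1), of b z] Qpos[of k z] k mix_pos[of "u ` {..<k}" z] Dpos[of z] by simp
        have Tc: "T z = T z'" if e: "\<And>p. p \<in> ?S \<times> {..<N} \<Longrightarrow> z p = z' p" for z z'
        proof -
          have "okf (u k) b z = okf (u k) b z'" by (rule okf_cong) (use e in auto)
          moreover have "Q k z = Q k z'" by (rule Q_cong) (use e k in \<open>auto simp: v_def\<close>)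
          moreover have "mix (u ` {..<k}) z = mix (u ` {..<k}) z'" by (rule mix_cong) (use e in auto)
          moreover have "(\<Prod>p\<in>?S \<times> {..<N}. ell n0 (d p) (z p)) = (\<Prod>p\<in>?S \<times> {..<N}. ell n0 (d p) (z' p))"
            by (rule prod.cong) (use e in auto)
          ultimately show ?thesis unfolding T_def by (simp only:)
        qed
        have "(\<integral>\<^sup>+z. ennreal (R b z) \<partial>\<mu>) = (\<integral>\<^sup>+z. ennreal (T z) * ennreal (\<Prod>p\<in>?S \<times> {..<N}. ell n0 (d p) (z p)) \<partial>\<mu>)"
          unfolding RT
        proof (rule noise_shift[OF _ SuK])
          show "(\<lambda>z. ennreal (T z)) \<in> borel_measurable \<mu>"
            by (rule measurable_compose[OF Tm measurable_ennreal])
          fix z z' :: "nat \<times> nat \<Rightarrow> complex" assume "\<And>p. p \<in> ?S \<times> {..<N} \<Longrightarrow> z p = z' p"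
          from Tc[OF this] show "ennreal (T z) = ennreal (T z')" by simp
        qed
        also have "\<dots> = (\<integral>\<^sup>+z. ennreal (okf (u k) b z * (Q k z * mix (u ` {..<k}) z)) \<partial>\<mu>)"
        proof (rule nn_integral_cong)
          fix z
          have "T z * (\<Prod>p\<in>?S \<times> {..<N}. ell n0 (d p) (z p)) = okf (u k) b z * (Q k z * mix (u ` {..<k}) z)"
            unfolding T_def using Dpos[of z] by simp
          then show "ennreal (T z) * ennreal (\<Prod>p\<in>?S \<times> {..<N}. ell n0 (d p) (z p)) = ennreal (okf (u k) b z * (Q k z * mix (u ` {..<k}) z))"
            using Tpos[of z] Dpos[of z] by (simp flip: ennreal_mult)
        qed
        finally show ?thesis .
      qed
      have "(\<Sum>a<M 0. \<Sum>b<M (u k). H a b) = (\<Sum>b<M (u k). \<Sum>a<M 0. H a b)" by (rule sum.swap)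
      also have "\<dots> = ennreal (real (M 0)) * (\<Sum>b<M (u k). \<integral>\<^sup>+z. ennreal (okf (u k) b z * (Q k z * mix (u ` {..<k}) z)) \<partial>\<mu>)"
        unfolding sumH Rsh by (simp add: sum_distrib_left)
      also have "\<dots> \<le> ennreal (real (M 0)) * ennreal (2 * real (M (u k)))"
      proof (intro mult_left_mono sum_okf_integral_le ukK)
        show "(\<lambda>z. Q k z * mix (u ` {..<k}) z) \<in> borel_measurable \<mu>"
          using SK[of k] k by (intro borel_measurable_times Qm measurable_mix) auto
        show "0 \<le> Q k z * mix (u ` {..<k}) z" for z
          using Qpos[of k z] k mix_pos[of "u ` {..<k}" z] by simp
      qed (use Qmix[of k] k in auto)
      finally show "(\<Sum>a<M 0. \<Sum>b<M (u k). H a b) \<le> ennreal (2 * real (M 0) * real (M (u k)))"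
        by (simp add: mult_ac flip: ennreal_mult)
    qed (use ukK in auto)
    finally show ?thesis .
  qed

  have U2m: "(\<Sum>w\<in>W. \<integral>\<^sup>+z. ennreal (U m w z) \<partial>\<mu>) \<le> ennreal (2 * PM)"
  proof -
    define H where "H a = (\<integral>\<^sup>+z. ennreal (okf 0 a z * (Q m z * mix (u ` {..<m}) z)) \<partial>\<mu>)" for a
    have "(\<Sum>w\<in>W. \<integral>\<^sup>+z. ennreal (U m w z) \<partial>\<mu>) = (\<Sum>w\<in>W. H (w 0))"
    proof (rule sum.cong[OF refl])
      fix w :: "nat \<Rightarrow> nat"
      have "(\<integral>\<^sup>+z. ennreal (U m w z) \<partial>\<mu>) = (\<integral>\<^sup>+z. ennreal (\<Phi>0 (w 0) z) * ennreal (LL (insert 0 (u ` {..<m})) (w 0) z) \<partial>\<mu>)"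
        unfolding U_def if_not_P[OF less_irrefl]
      proof (rule noise_shift_cs[OF _ S0K])
        show "(\<lambda>z. ennreal (\<Phi>0 (w 0) z)) \<in> borel_measurable \<mu>"
          by (rule measurable_compose[OF \<Phi>0m measurable_ennreal])
        fix z z' :: "nat \<times> nat \<Rightarrow> complex" assume "\<And>p. p \<in> insert 0 (u ` {..<m}) \<times> {..<N} \<Longrightarrow> z p = z' p"
        from \<Phi>0_cong[OF this] show "ennreal (\<Phi>0 (w 0) z) = ennreal (\<Phi>0 (w 0) z')" by simp
      qed
      also have "\<dots> = H (w 0)" unfolding H_def
      proof (rule nn_integral_cong)
        fix z
        have "\<Phi>0 (w 0) z * LL (insert 0 (u ` {..<m})) (w 0) z = okf 0 (w 0) z * (Q m z * mix (u ` {..<m}) z)"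
          unfolding \<Phi>0_def using LL_pos[of "insert 0 (u ` {..<m})" "w 0" z] by simp
        then show "ennreal (\<Phi>0 (w 0) z) * ennreal (LL (insert 0 (u ` {..<m})) (w 0) z) = ennreal (okf 0 (w 0) z * (Q m z * mix (u ` {..<m}) z))"
          using \<Phi>0pos[of "w 0" z] LL_pos[of "insert 0 (u ` {..<m})" "w 0" z] by (simp flip: ennreal_mult)
      qed
      finally show "(\<integral>\<^sup>+z. ennreal (U m w z) \<partial>\<mu>) = H (w 0)" .
    qed
    also have "\<dots> \<le> ennreal (2 * PM)"
    proof (rule sum_W_one)
      show "(\<Sum>a<M 0. H a) \<le> ennreal (2 * real (M 0))"
        unfolding H_def
      proof (rule sum_okf_integral_le)
        show "(\<lambda>z. Q m z * mix (u ` {..<m}) z) \<in> borel_measurable \<mu>"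
          using SK[of m] by (intro borel_measurable_times Qm measurable_mix) auto
        show "0 \<le> Q m z * mix (u ` {..<m}) z" for z
          using Qpos[of m z] mix_pos[of "u ` {..<m}" z] by simp
      qed (use Qmix[of m] in auto)
    qed simp
    finally show ?thesis .
  qed

  define A where "A k b t = (if k < m then hdir (u k) * (enc (u k) b t - encm (u k) t) else 0)" for k b t
  define e where "e k w z t = A k (w (v k)) t + (gain (v k) - \<alpha> k * gain (pr k)) * enc 0 (w 0) t + z (v k, t) - \<alpha> k * z (pr k, t)" for k w z t
  have e_eq: "yy w z (v k, t) - pm k (\<lambda>p. z p + cs (w 0) p) t = e k w z t" if "k \<le> m" for k w z t
  proof (cases "k < m")
    case True
    then have "u k \<noteq> 0" using u[OF True] by simp
    then show ?thesis using True
      by (simp add: yy_def pm_def e_def A_def \<kappa>_def v_def own_def cs_def algebra_simps)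
  next
    case False
    then show ?thesis by (simp add: yy_def pm_def e_def A_def \<kappa>_def v_def own_def cs_def algebra_simps)
  qed
  have okyy: "okf (u k) (w (u k)) (sh k (w (u k)) (\<lambda>p. z p + cs (w 0) p)) = okf (v k) (w (v k)) (yy w z)" if "k < m" for k w z
    using that by (simp add: v_def, intro okf_cong) (simp add: sh_def yy_def)
  have lnUk: "ln (U k w z) = ln (okf (v k) (w (v k)) (yy w z)) +
     (\<Sum>t<N. ln (n0 / s k) + (cmod (z (v k, t)))\<^sup>2 / n0 - (cmod (e k w z t))\<^sup>2 / s k) +
     (\<Sum>t<N. ln (ell n0 (cs (w 0) (v k, t)) (z (v k, t) + cs (w 0) (v k, t)))) +
     (ln (mix (u ` {..<k}) (\<lambda>p. z p + cs (w 0) p)) - ln (mix (u ` {..<Suc k}) (\<lambda>p. z p + cs (w 0) p)))" if k: "k < m" for k w z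
  proof -
    let ?s = "\<lambda>p. z p + cs (w 0) p" and ?b = "w (u k)"
    have ukK: "u k \<le> K" using u[OF k] by simp
    have "ln (U k w z) = ln (okf (v k) (w (v k)) (yy w z)) + ln (Q k (sh k ?b ?s)) + ln (E k ?b ?s) + ln (mix (u ` {..<k}) ?s) - ln (mix (u ` {..<Suc k}) ?s)"
      using k unfolding U_def \<Phi>_def okyy[OF k]
      using okf_pos[OF vK[of k], of "w (v k)" "yy w z"] Qpos[of k "sh k ?b ?s"] Epos[of k ?b ?s] mix_pos[of "u ` {..<k}" ?s] mix_pos[of "u ` {..<Suc k}" ?s]
      by (simp only: if_True ln_div ln_mult) (simp add: ln_div ln_mult)
    also have "ln (Q k (sh k ?b ?s)) = (\<Sum>t<N. ln (gkern n0 (s k) (pm k ?s t) (?s (u k, t) + own ?b (u k, t))))"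
      unfolding shQ[OF k] using k by (intro ln_prod) (auto simp: gkern_nz n0 s)
    also have "ln (E k ?b ?s) = (\<Sum>t<N. ln (ell n0 (- own ?b (u k, t)) (?s (u k, t))))"
      unfolding E_def by (intro ln_prod) auto
    finally have 1: "ln (U k w z) = ln (okf (v k) (w (v k)) (yy w z)) + (\<Sum>t<N. ln (gkern n0 (s k) (pm k ?s t) (?s (u k, t) + own ?b (u k, t))) + ln (ell n0 (- own ?b (u k, t)) (?s (u k, t))))
       + (ln (mix (u ` {..<k}) ?s) - ln (mix (u ` {..<Suc k}) ?s))"
      by (simp add: sum.distrib)
    have 2: "ln (gkern n0 (s k) (pm k ?s t) (?s (u k, t) + own ?b (u k, t))) + ln (ell n0 (- own ?b (u k, t)) (?s (u k, t))) =
       (ln (n0 / s k) + (cmod (z (v k, t)))\<^sup>2 / n0 - (cmod (e k w z t))\<^sup>2 / s k) + ln (ell n0 (cs (w 0) (v k, t)) (z (v k, t) + cs (w 0) (v k, t)))" for t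
    proof -
      have h: "?s (u k, t) + own ?b (u k, t) - pm k ?s t = e k w z t"
        using e_eq[of k w z t] k by (simp add: yy_def v_def)
      show ?thesis
        unfolding ln_gkern[OF s[OF less_imp_le[OF k]]] ln_ell h using k by (simp add: v_def diff_divide_distrib)
    qed
    show ?thesis unfolding 1 2 by (simp add: sum.distrib)
  qed
  \<comment> \<open>The likelihood in the denominator of \<open>\<Phi>0\<close> covers receiver 0
    and the whole chain, so its logarithm cancels the \<open>ell\<close> terms left over by each of
    the test functions.\<close>
  have lnUm: "ln (U m w z) = ln (okf (v m) (w (v m)) (yy w z)) +
     (\<Sum>t<N. ln (n0 / s m) + (cmod (z (v m, t)))\<^sup>2 / n0 - (cmod (e m w z t))\<^sup>2 / s m) +
     (\<Sum>t<N. ln (ell n0 (cs (w 0) (v m, t)) (z (v m, t) + cs (w 0) (v m, t)))) +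
     (ln (mix (u ` {..<m}) (\<lambda>p. z p + cs (w 0) p)) - (\<Sum>k\<le>m. \<Sum>t<N. ln (ell n0 (cs (w 0) (v k, t)) (z (v k, t) + cs (w 0) (v k, t)))))" for w z
  proof -
    let ?s = "\<lambda>p. z p + cs (w 0) p"
    have v0: "v m = 0" by (simp add: v_def)
    have ok: "okf 0 (w 0) ?s = okf 0 (w 0) (yy w z)" by (rule okf_cong) (simp add: yy_def own_def)
    have lnLL: "ln (LL (insert 0 (u ` {..<m})) (w 0) ?s) = (\<Sum>k\<le>m. \<Sum>t<N. ln (ell n0 (cs (w 0) (v k, t)) (?s (v k, t))))"
    proof -
      have im: "insert 0 (u ` {..<m}) = v ` {..m}" by (auto simp: v_def image_iff)
      have injv: "inj_on v {..m}"
      proof (rule inj_onI)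
        fix x y assume "x \<in> {..m}" "y \<in> {..m}" "v x = v y"
        then show "x = y" using inj_onD[OF inj, of x y] u[of x] u[of y] by (auto simp: v_def split: if_splits)
      qed
      have "ln (LL (insert 0 (u ` {..<m})) (w 0) ?s) = (\<Sum>p\<in>(v ` {..m}) \<times> {..<N}. ln (ell n0 (cs (w 0) p) (?s p)))"
        unfolding LL_def im by (intro ln_prod) auto
      also have "\<dots> = (\<Sum>i\<in>v ` {..m}. \<Sum>t<N. ln (ell n0 (cs (w 0) (i, t)) (?s (i, t))))"
        by (subst sum.cartesian_product) (simp add: case_prod_beta)
      also have "\<dots> = (\<Sum>k\<le>m. \<Sum>t<N. ln (ell n0 (cs (w 0) (v k, t)) (?s (v k, t))))"
        by (simp add: sum.reindex[OF injv])
      finally show ?thesis .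
    qed
    have "ln (U m w z) = ln (okf 0 (w 0) (yy w z)) + ln (Q m ?s) + ln (mix (u ` {..<m}) ?s) - ln (LL (insert 0 (u ` {..<m})) (w 0) ?s)"
      unfolding U_def \<Phi>0_def ok
      using okf_pos[of 0 "w 0" "yy w z"] Qpos[of m ?s] mix_pos[of "u ` {..<m}" ?s] LL_pos[of "insert 0 (u ` {..<m})" "w 0" ?s]
      by (simp add: ln_div ln_mult)
    also have "ln (Q m ?s) = (\<Sum>t<N. ln (gkern n0 (s m) (pm m ?s t) (?s (v m, t))))"
      unfolding Q_def by (intro ln_prod) (auto simp: gkern_nz n0 s)
    also have "\<dots> = (\<Sum>t<N. (ln (n0 / s m) + (cmod (z (v m, t)))\<^sup>2 / n0 - (cmod (e m w z t))\<^sup>2 / s m) + ln (ell n0 (cs (w 0) (v m, t)) (z (v m, t) + cs (w 0) (v m, t))))"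
    proof (rule sum.cong[OF refl])
      fix t
      have h: "?s (v m, t) - pm m ?s t = e m w z t"
        using e_eq[of m w z t] by (simp add: yy_def v_def own_def)
      show "ln (gkern n0 (s m) (pm m ?s t) (?s (v m, t))) = (ln (n0 / s m) + (cmod (z (v m, t)))\<^sup>2 / n0 - (cmod (e m w z t))\<^sup>2 / s m) + ln (ell n0 (cs (w 0) (v m, t)) (z (v m, t) + cs (w 0) (v m, t)))"
        unfolding ln_gkern[OF s[OF order_refl]] ln_ell h by (simp add: diff_divide_distrib)
    qed
    finally show ?thesis unfolding lnLL by (simp add: sum.distrib v0)
  qed
  have lnU: "(\<Sum>k\<le>m. ln (U k w z)) = (\<Sum>k\<le>m. ln (okf (v k) (w (v k)) (yy w z)) +
     (\<Sum>t<N. ln (n0 / s k) + (cmod (z (v k, t)))\<^sup>2 / n0 - (cmod (e k w z t))\<^sup>2 / s k))" for w z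
  proof -
    let ?m = "\<lambda>k. ln (mix (u ` {..<k}) (\<lambda>p. z p + cs (w 0) p))"
    have tel: "(\<Sum>k<m. ?m k - ?m (Suc k)) = - ?m m"
      using sum_lessThan_telescope'[of ?m m] by (simp add: mix_empty)
    have "{..m} = insert m {..<m}" by auto
    then have "(\<Sum>k\<le>m. ln (U k w z)) = ln (U m w z) + (\<Sum>k<m. ln (U k w z))" by simp
    also have "(\<Sum>k<m. ln (U k w z)) = (\<Sum>k<m. ln (okf (v k) (w (v k)) (yy w z)) +
       (\<Sum>t<N. ln (n0 / s k) + (cmod (z (v k, t)))\<^sup>2 / n0 - (cmod (e k w z t))\<^sup>2 / s k)) +
       (\<Sum>k<m. \<Sum>t<N. ln (ell n0 (cs (w 0) (v k, t)) (z (v k, t) + cs (w 0) (v k, t)))) + (\<Sum>k<m. ?m k - ?m (Suc k))"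
      by (simp only: sum.distrib[symmetric]) (intro sum.cong refl, simp only: lnUk lessThan_iff)
    finally show ?thesis
      unfolding tel lnUm lessThan_Suc_atMost[symmetric] by (simp only: sum.lessThan_Suc)
  qed

  have "(\<Sum>j\<in>{..m}. (1 - eps) * ln (real (M (v j)))) \<le> real N * (\<Sum>j\<in>{..m}. ln (s j / n0)) + real (card {..m}) * ln 2"
  proof (rule converse_core[where U=U and e=e and usr=v and s=s and eps=eps])
    fix k w assume k: "k \<in> {..m}"
    have shc: "(\<lambda>z. \<lambda>p\<in>I. z p + cs (w 0) p) \<in> measurable \<mu> \<mu>" for w :: "nat \<Rightarrow> nat"
      by (rule measurable_restrict) measurable
    show "U k w \<in> borel_measurable \<mu>"
    proof (cases "k < m")
      case True
      have "U k w = (\<lambda>z. \<Phi> k (w (u k)) (\<lambda>p\<in>I. z p + cs (w 0) p))"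
        unfolding U_def using True SK[of "Suc k"] by (simp, intro ext \<Phi>_cong) auto
      then show ?thesis using measurable_compose[OF shc \<Phi>m[OF True]] by simp
    next
      case False
      then have km: "k = m" using k by simp
      have "U k w = (\<lambda>z. \<Phi>0 (w 0) (\<lambda>p\<in>I. z p + cs (w 0) p))"
        unfolding U_def km using S0K by (simp, intro ext \<Phi>0_cong) auto
      then show ?thesis using measurable_compose[OF shc \<Phi>0m] by simp
    qed
    show "U k w z > 0" for z using \<Phi>pos \<Phi>0pos by (simp add: U_def)
    show "(\<Sum>w\<in>W. \<integral>\<^sup>+z. ennreal (U k w z) \<partial>\<mu>) \<le> ennreal (2 * PM)"
      using U2k U2m k by (cases "k < m") auto
  next
    fix k assume k: "k \<in> {..m}"
    define pA where "pA = (if k < m then (cmod (hdir (u k)))\<^sup>2 * P (u k) else 0)"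
    have sk: "s k = pA + (cmod (gain (v k) - \<alpha> k * gain (pr k)))\<^sup>2 * P 0 + n0 + (cmod (\<alpha> k))\<^sup>2 * n0"
      by (simp add: s_def pA_def)
    have pos: "pA \<ge> 0" using u Pnn by (auto simp: pA_def)
    have c1: "pr k \<noteq> v k \<or> \<alpha> k = 0" using prv[of k] \<alpha>0 k by (cases "k = 0") auto
    have c2: "\<forall>b t. A k b t = 0" if "v k = 0" using that u by (force simp: v_def A_def split: if_splits)
    have c3: "(\<Sum>b<M (v k). A k b t) = 0" if "v k \<noteq> 0" for t
      using that centered(1)[of "u k" "P (u k)"] u[of k] P[of "u k"] by (auto simp: v_def A_def split: if_splits)
    have c4: "(\<Sum>b<M (v k). \<Sum>t<N. (cmod (A k b t))\<^sup>2) \<le> real (M (v k)) * (real N * pA)"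
      using centered(2)[of "u k" "P (u k)" "hdir (u k)"] u[of k] P[of "u k"] by (auto simp: v_def A_def pA_def)
    have vk: "v k \<le> K" "pr k \<le> K" using vK prK k by auto
    note R = residual_sq[where i="v k" and i'="pr k" and \<alpha>="\<alpha> k" and A="A k" and pA=pA and ?p0.0="P 0" and B="gain (v k) - \<alpha> k * gain (pr k)", OF vk c1 c2 c3 c4 P[of 0] pos]
    show "integrable \<mu> (\<lambda>z. (cmod (e k w z t))\<^sup>2)" if "t < N" for w t
      unfolding e_def by (rule R(1)) (use that in auto)
    show "(\<Sum>w\<in>W. \<Sum>t<N. integral\<^sup>L \<mu> (\<lambda>z. (cmod (e k w z t))\<^sup>2)) \<le> PM * (real N * s k)"
      unfolding e_def sk by (rule R(2)) auto
  qed (use lnU s vK err in auto)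
  then show ?thesis by (simp add: add.commute)
qed

end

section \<open>Passage to the limit and the outer region\<close>

text \<open>The additive constant disappears after division by the block length, and the factor
  \<open>1 - eps\<close> when \<open>eps\<close> then tends to 0.\<close>

lemma rate_limit:
  fixes R B c :: real
  assumes "\<And>eps. 0 < eps \<Longrightarrow> eps < 1 \<Longrightarrow> \<exists>N0. \<forall>N\<ge>N0. (1 - eps) * (real N * R) \<le> real N * B + c"
  shows "R \<le> B"
proof (rule ccontr)
  assume "\<not> R \<le> B"
  then have RB: "R - B > 0" by simp
  \<comment> \<open>Chosen so that \<open>eps * \<bar>R\<bar>\<close> uses up at most half of the
    gap \<open>R - B\<close>; the added 1 avoids a division by zero.\<close>
  define eps where "eps = min (1/2) ((R - B) / (2 * (\<bar>R\<bar> + 1)))"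
  have e: "0 < eps" "eps < 1" using RB by (auto simp: eps_def)
  have "eps * (\<bar>R\<bar> + 1) \<le> (R - B) / (2 * (\<bar>R\<bar> + 1)) * (\<bar>R\<bar> + 1)"
    by (rule mult_right_mono) (auto simp: eps_def)
  also have "\<dots> = (R - B) / 2" by (simp add: field_simps)
  finally have "eps * \<bar>R\<bar> \<le> (R - B) / 2" using e by (simp add: algebra_simps)
  moreover have "eps * R \<le> eps * \<bar>R\<bar>" using e by (intro mult_left_mono) auto
  ultimately have "eps * R \<le> (R - B) / 2" by linarith
  then have d: "(1 - eps) * R - B \<ge> (R - B) / 2" by (simp add: field_simps)
  obtain N0 where N0: "\<And>N. N \<ge> N0 \<Longrightarrow> (1 - eps) * (real N * R) \<le> real N * B + c"
    using assms[OF e] by auto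
  obtain N1 :: nat where N1: "real N1 > c / ((R - B) / 2)" using reals_Archimedean2 by blast
  define N where "N = max N0 N1"
  have "real N * ((R - B) / 2) \<le> real N * ((1 - eps) * R - B)"
    by (rule mult_left_mono[OF d]) simp
  also have "\<dots> \<le> c" using N0[of N] by (simp add: N_def algebra_simps)
  finally have "real N \<le> c / ((R - B) / 2)" using RB by (simp add: field_simps)
  moreover have "real N1 \<le> real N" by (simp add: N_def)
  ultimately show False using N1 by linarith
qed

text \<open>\<open>a\<close> is the coefficient of the best linear prediction of
  \<open>g * x + z\<close> from \<open>h * x + z'\<close>, for a signal of power \<open>P\<close>
  and two noises of variance \<open>n\<close>. The error variance has the form of a quotient INR /
  (1 + INR) plus 1, which is how the quotients of neighbouring INR values enter the sum-rate
  bound.\<close>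

lemma lmmse:
  fixes g h :: complex
  assumes n: "n > 0" and P: "P \<ge> 0"
  defines "a \<equiv> g * cnj h * of_real (P / (n + (cmod h)\<^sup>2 * P))"
  shows "(cmod (g - a * h))\<^sup>2 * P + n + (cmod a)\<^sup>2 * n = n * (1 + ((cmod g)\<^sup>2 * P / n) / (1 + (cmod h)\<^sup>2 * P / n))"
proof -
  define D where "D = n + (cmod h)\<^sup>2 * P"
  have D: "D > 0" using n P by (simp add: D_def add_pos_nonneg)
  have "a * h = g * of_real ((cmod h)\<^sup>2 * P / D)"
  proof -
    have "cnj h * h = of_real ((cmod h)\<^sup>2)" by (simp only: complex_norm_square mult.commute)
    moreover have "a * h = g * (cnj h * h) * of_real (P / D)" by (simp add: a_def D_def)
    ultimately show ?thesis by (simp only: of_real_mult[symmetric] mult.assoc times_divide_eq_right)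
  qed
  then have "g - a * h = g * of_real (1 - (cmod h)\<^sup>2 * P / D)" by (simp add: algebra_simps)
  also have "1 - (cmod h)\<^sup>2 * P / D = n / D" using D by (simp add: field_simps) (simp add: D_def)
  finally have 1: "(cmod (g - a * h))\<^sup>2 = (cmod g)\<^sup>2 * (n / D)\<^sup>2"
    by (simp only: norm_mult norm_of_real power_mult_distrib power2_abs)
  have 2: "(cmod a)\<^sup>2 = (cmod g)\<^sup>2 * (cmod h)\<^sup>2 * (P / D)\<^sup>2"
    by (simp only: a_def D_def[symmetric] norm_mult norm_of_real power_mult_distrib power2_abs complex_mod_cnj)
  have "(cmod (g - a * h))\<^sup>2 * P + (cmod a)\<^sup>2 * n = (cmod g)\<^sup>2 * P * n * (n + (cmod h)\<^sup>2 * P) / D\<^sup>2"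
    unfolding 1 2 by (simp add: power_divide power2_eq_square add_divide_distrib algebra_simps)
  also have "\<dots> = (cmod g)\<^sup>2 * P * n / D"
    unfolding D_def[symmetric] using D by (simp add: power2_eq_square)
  also have "\<dots> = n * (((cmod g)\<^sup>2 * P / n) / (1 + (cmod h)\<^sup>2 * P / n))"
  proof -
    have "1 + (cmod h)\<^sup>2 * P / n = D / n" using n by (simp add: D_def field_simps)
    then show ?thesis using n D by simp
  qed
  finally show ?thesis by (simp add: algebra_simps)
qed

lemma good_code_channel_code:
  assumes "n0 > 0" and g: "good_code K hdir hc P n0 N M enc dec eps"
  shows "channel_code K N n0 M dec"
    and "\<And>i. i \<le> K \<Longrightarrow> (\<Sum>b<M i. \<Sum>t<N. (cmod (enc i b t))\<^sup>2) \<le> real (M i) * (real N * P i)"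
    and "err_prob K N hdir hc n0 M enc dec \<le> eps"
proof -
  show "channel_code K N n0 M dec"
    using assms by unfold_locales (auto simp: good_code_def)
  show "(\<Sum>b<M i. \<Sum>t<N. (cmod (enc i b t))\<^sup>2) \<le> real (M i) * (real N * P i)" if i: "i \<le> K" for i
  proof -
    have "M i \<ge> 1" "(\<Sum>m<M i. \<Sum>t<N. (cmod (enc i m t))\<^sup>2) / real (M i) \<le> real N * P i"
      using g i unfolding good_code_def by auto
    then show ?thesis by (simp add: divide_le_eq mult.commute)
  qed
  show "err_prob K N hdir hc n0 M enc dec \<le> eps" using g by (simp add: good_code_def)
qed

lemma achievable_code:
  assumes r: "r \<in> achievable K hdir hc P n0" and "0 < eps"
  obtains N0 where "\<And>N. N \<ge> N0 \<Longrightarrow> \<exists>M enc dec. good_code K hdir hc P n0 N M enc dec eps \<and>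
      (\<forall>i\<le>K. real N * r i * ln 2 \<le> ln (real (M i)))"
proof -
  obtain N0 where N0: "\<And>N. N \<ge> N0 \<Longrightarrow> \<exists>M enc dec.
        (\<forall>i\<le>K. real (M i) \<ge> 2 powr (real N * r i)) \<and> good_code K hdir hc P n0 N M enc dec eps"
    using assms unfolding achievable_def by blast
  have "\<exists>M enc dec. good_code K hdir hc P n0 N M enc dec eps \<and> (\<forall>i\<le>K. real N * r i * ln 2 \<le> ln (real (M i)))" if N: "N \<ge> N0" for N
  proof -
    obtain M enc dec where g: "\<forall>i\<le>K. real (M i) \<ge> 2 powr (real N * r i)" "good_code K hdir hc P n0 N M enc dec eps"
      using N0[OF N] by blast
    have "real N * r i * ln 2 \<le> ln (real (M i))" if "i \<le> K" for i
    proof -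
      have "ln (2 powr (real N * r i)) \<le> ln (real (M i))"
        using g(1) that by (intro ln_mono) (auto intro: less_le_trans)
      then show ?thesis by (simp add: ln_powr)
    qed
    then show ?thesis using g by blast
  qed
  then show ?thesis using that by blast
qed

lemma log_rate_bound:
  assumes "\<And>eps. 0 < eps \<Longrightarrow> eps < 1 \<Longrightarrow> \<exists>N0. \<forall>N\<ge>N0. (1 - eps) * (real N * R * ln 2) \<le> real N * B + c"
  shows "R \<le> B / ln 2"
proof (rule rate_limit)
  fix eps :: real assume "0 < eps" "eps < 1"
  then obtain N0 where N0: "\<And>N. N \<ge> N0 \<Longrightarrow> (1 - eps) * (real N * R * ln 2) \<le> real N * B + c"
    using assms by blast
  have "(1 - eps) * (real N * R) \<le> real N * (B / ln 2) + c / ln 2" if "N \<ge> N0" for N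
    using divide_right_mono[OF N0[OF that], of "ln 2"] by (simp add: add_divide_distrib)
  then show "\<exists>N0. \<forall>N\<ge>N0. (1 - eps) * (real N * R) \<le> real N * (B / ln 2) + c / ln 2" by blast
qed

lemma achievable_subset_outer:
  fixes K :: nat and hdir hc :: "nat \<Rightarrow> complex" and P :: "nat \<Rightarrow> real" and n0 :: real
  assumes n0: "n0 > 0" and P: "\<forall>i\<le>K. P i \<ge> 0"
  shows "achievable K hdir hc P n0 \<subseteq> outer_region K hdir hc P n0"
proof
  fix r assume r: "r \<in> achievable K hdir hc P n0"
  have single: "r i \<le> log 2 (1 + SNR hdir P n0 i)" if i: "1 \<le> i" "i \<le> K" for i
  proof -
    have "r i \<le> ln (1 + SNR hdir P n0 i) / ln 2"
    proof (rule log_rate_bound)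
      fix eps :: real assume eps: "0 < eps" "eps < 1"
      obtain N0 where N0: "\<And>N. N \<ge> N0 \<Longrightarrow> \<exists>M enc dec. good_code K hdir hc P n0 N M enc dec eps \<and>
          (\<forall>i\<le>K. real N * r i * ln 2 \<le> ln (real (M i)))"
        using achievable_code[OF r eps(1)] by blast
      have "(1 - eps) * (real N * r i * ln 2) \<le> real N * ln (1 + SNR hdir P n0 i) + ln 2" if N: "N \<ge> N0" for N
      proof -
        obtain M enc dec where g: "good_code K hdir hc P n0 N M enc dec eps" and
          m: "\<And>i. i \<le> K \<Longrightarrow> real N * r i * ln 2 \<le> ln (real (M i))" using N0[OF N] by blast
        note gc = good_code_channel_code[OF n0 g]
        interpret channel_code K N n0 hdir hc M enc dec by (rule gc(1))
        have "(1 - eps) * ln (real (M i)) \<le> real N * ln (((cmod (hdir i))\<^sup>2 * P i + n0) / n0) + ln 2"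
          by (rule single_user_bound[OF i gc(2)[OF i(2)] _ gc(2)[of 0] gc(3)]) (use P i in auto)
        also have "((cmod (hdir i))\<^sup>2 * P i + n0) / n0 = 1 + SNR hdir P n0 i"
          using n0 by (simp add: SNR_def add_divide_distrib)
        finally have "(1 - eps) * ln (real (M i)) \<le> real N * ln (1 + SNR hdir P n0 i) + ln 2" .
        moreover have "(1 - eps) * (real N * r i * ln 2) \<le> (1 - eps) * ln (real (M i))"
          using eps m[OF i(2)] by (intro mult_left_mono) auto
        ultimately show ?thesis by linarith
      qed
      then show "\<exists>N0. \<forall>N\<ge>N0. (1 - eps) * (real N * r i * ln 2) \<le> real N * ln (1 + SNR hdir P n0 i) + ln 2" by blast
    qed
    then show ?thesis by (simp add: log_def)
  qed
  \<comment> \<open>Position \<open>m\<close> of the chain is user 0, whose signal is predicted from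
    the last receiver; position 0 has no predecessor, which amounts to an INR of 0 in the
    denominator.\<close>
  have chain: "(\<Sum>k\<le>m. r (if k < m then u k else 0)) \<le> (\<Sum>k\<le>m. ln (
        (if k < m then 1 + SNR hdir P n0 (u k) else 1) +
        ((if k < m then INR hc P n0 (u k) else SNR hdir P n0 0) / (1 + (if k = 0 then 0 else INR hc P n0 (u (k - 1))))))) / ln 2"
    if inj: "inj_on u {..<m}" and u: "\<And>k. k < m \<Longrightarrow> 1 \<le> u k \<and> u k \<le> K" for m and u :: "nat \<Rightarrow> nat"
  proof -
    define v where "v k = (if k < m then u k else 0)" for k
    define pr where "pr k = (if k = 0 then 0 else u (k - 1))" for k
    define gn where "gn i = (if i = 0 then hdir 0 else hc i)" for i :: nat
    \<comment> \<open>The coefficient of \<open>lmmse\<close>, which makes \<open>s k / n0\<close>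
      the \<open>k\<close>-th factor of the bound; without a predecessor nothing is
      predicted.\<close>
    define \<alpha> where "\<alpha> k = (if k = 0 then 0 else gn (v k) * cnj (gn (pr k)) * of_real (P 0 / (n0 + (cmod (gn (pr k)))\<^sup>2 * P 0)))" for k :: nat
    define s where "s k = (if k < m then (cmod (hdir (u k)))\<^sup>2 * P (u k) else 0) +
      (cmod (gn (v k) - \<alpha> k * gn (pr k)))\<^sup>2 * P 0 + n0 + (cmod (\<alpha> k))\<^sup>2 * n0" for k
    define F where "F k = (if k < m then 1 + SNR hdir P n0 (u k) else 1) +
        ((if k < m then INR hc P n0 (u k) else SNR hdir P n0 0) / (1 + (if k = 0 then 0 else INR hc P n0 (u (k - 1)))))" for k
    have sF: "s k / n0 = F k" if k: "k \<le> m" for k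
    proof -
      have gv: "(cmod (gn (v k)))\<^sup>2 * P 0 / n0 = (if k < m then INR hc P n0 (u k) else SNR hdir P n0 0)"
        using u[of k] by (auto simp: gn_def v_def INR_def SNR_def)
      have "(cmod (gn (v k) - \<alpha> k * gn (pr k)))\<^sup>2 * P 0 + n0 + (cmod (\<alpha> k))\<^sup>2 * n0 =
          n0 * (1 + (if k < m then INR hc P n0 (u k) else SNR hdir P n0 0) / (1 + (if k = 0 then 0 else INR hc P n0 (u (k - 1)))))"
      proof (cases "k = 0")
        case True
        then show ?thesis using n0 gv by (simp add: \<alpha>_def field_simps)
      next
        case False
        then have gp: "(cmod (gn (pr k)))\<^sup>2 * P 0 / n0 = INR hc P n0 (u (k - 1))"
        proof -
          have "k - 1 < m" using False k by simp
          then have "u (k - 1) \<noteq> 0" using u[of "k - 1"] by simp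
          then show ?thesis using False by (simp add: gn_def pr_def INR_def)
        qed
        show ?thesis
          using lmmse[OF n0, of "P 0" "gn (v k)" "gn (pr k)"] P False unfolding gv gp by (simp add: \<alpha>_def)
      qed
      then have "s k = (if k < m then (cmod (hdir (u k)))\<^sup>2 * P (u k) else 0) +
         n0 * (1 + (if k < m then INR hc P n0 (u k) else SNR hdir P n0 0) / (1 + (if k = 0 then 0 else INR hc P n0 (u (k - 1)))))"
        unfolding s_def by linarith
      then show ?thesis using n0 by (simp add: F_def SNR_def add_divide_distrib)
    qed
    have "(\<Sum>k\<le>m. r (v k)) \<le> (\<Sum>k\<le>m. ln (F k)) / ln 2"
    proof (rule log_rate_bound)
      fix eps :: real assume eps: "0 < eps" "eps < 1"
      obtain N0 where N0: "\<And>N. N \<ge> N0 \<Longrightarrow> \<exists>M enc dec. good_code K hdir hc P n0 N M enc dec eps \<and>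
          (\<forall>i\<le>K. real N * r i * ln 2 \<le> ln (real (M i)))"
        using achievable_code[OF r eps(1)] by blast
      have "(1 - eps) * (real N * (\<Sum>k\<le>m. r (v k)) * ln 2) \<le> real N * (\<Sum>k\<le>m. ln (F k)) + real (m + 1) * ln 2" if N: "N \<ge> N0" for N
      proof -
        obtain M enc dec where g: "good_code K hdir hc P n0 N M enc dec eps" and
          m: "\<And>i. i \<le> K \<Longrightarrow> real N * r i * ln 2 \<le> ln (real (M i))" using N0[OF N] by blast
        note gc = good_code_channel_code[OF n0 g]
        interpret channel_code K N n0 hdir hc M enc dec by (rule gc(1))
        have "(\<Sum>k\<le>m. (1 - eps) * ln (real (M (v k)))) \<le> real N * (\<Sum>k\<le>m. ln (s k / n0)) + real (m + 1) * ln 2"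
          unfolding s_def gn_def v_def pr_def
          by (rule chain_bound[OF inj u]) (use gc P in \<open>auto simp: \<alpha>_def\<close>)
        also have "(\<Sum>k\<le>m. ln (s k / n0)) = (\<Sum>k\<le>m. ln (F k))"
          by (rule sum.cong) (auto simp: sF)
        finally have "(\<Sum>k\<le>m. (1 - eps) * ln (real (M (v k)))) \<le> real N * (\<Sum>k\<le>m. ln (F k)) + real (m + 1) * ln 2" .
        moreover have "(1 - eps) * (real N * (\<Sum>k\<le>m. r (v k)) * ln 2) = (\<Sum>k\<le>m. (1 - eps) * (real N * r (v k) * ln 2))"
          by (simp add: sum_distrib_left sum_distrib_right)
        moreover have "\<dots> \<le> (\<Sum>k\<le>m. (1 - eps) * ln (real (M (v k))))"
          using eps u by (intro sum_mono mult_left_mono m) (auto simp: v_def)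
        ultimately show ?thesis by linarith
      qed
      then show "\<exists>N0. \<forall>N\<ge>N0. (1 - eps) * (real N * (\<Sum>k\<le>m. r (v k)) * ln 2) \<le> real N * (\<Sum>k\<le>m. ln (F k)) + real (m + 1) * ln 2" by blast
    qed
    then show ?thesis unfolding F_def v_def .
  qed
  \<comment> \<open>In the chain without receivers only the term of user 0 remains, and it is the
    individual constraint.\<close>
  have r0: "r 0 \<le> log 2 (1 + SNR hdir P n0 0)"
    using chain[of undefined 0] by (simp add: log_def)
  have sumb: "r 0 + (\<Sum>i\<in>S. r i) \<le> sum_bound hdir hc P n0 S" if S: "S \<subseteq> {1..K}" "S \<noteq> {}" for S
  proof -
    define ss where "ss = sorted_list_of_set S"
    define m where "m = length ss"
    have fin: "finite S" using S finite_subset by blast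
    have ss: "set ss = S" "distinct ss" using fin by (auto simp: ss_def)
    have m: "m > 0" using ss(1) S(2) unfolding m_def by (cases ss) auto
    let ?u = "\<lambda>k. ss ! k"
    have inj: "inj_on ?u {..<m}" using ss(2) by (auto simp: inj_on_def m_def nth_eq_iff_index_eq)
    have im: "?u ` {..<m} = S" using ss(1) by (auto simp: m_def set_conv_nth)
    have u: "1 \<le> ?u k \<and> ?u k \<le> K" if "k < m" for k using im S(1) that by force
    let ?F = "\<lambda>k. ln ((if k < m then 1 + SNR hdir P n0 (?u k) else 1) +
        ((if k < m then INR hc P n0 (?u k) else SNR hdir P n0 0) / (1 + (if k = 0 then 0 else INR hc P n0 (?u (k - 1))))))"
    have split: "{..m} = insert m (insert 0 {1..<m})" using m by auto
    have "(\<Sum>k\<le>m. r (if k < m then ?u k else 0)) = r 0 + (\<Sum>k<m. r (?u k))"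
      by (simp add: lessThan_Suc_atMost[symmetric])
    also have "(\<Sum>k<m. r (?u k)) = (\<Sum>i\<in>S. r i)"
      using sum.reindex[OF inj, of r] im by simp
    finally have "r 0 + (\<Sum>i\<in>S. r i) \<le> (\<Sum>k\<le>m. ?F k) / ln 2"
      using chain[OF inj u] by simp
    also have "(\<Sum>k\<le>m. ?F k) = ?F m + (?F 0 + (\<Sum>k\<in>{1..<m}. ?F k))"
      unfolding split using m by simp
    also have "\<dots> / ln 2 = sum_bound hdir hc P n0 S"
      unfolding sum_bound_def Let_def ss_def[symmetric] m_def[symmetric] using m
      by (simp add: log_def add_divide_distrib sum_divide_distrib add.assoc)
    finally show ?thesis .
  qed
  have ri: "r i \<le> log 2 (1 + SNR hdir P n0 i)" if "i \<le> K" for i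
    using r0 single[of i] that by (cases "i = 0") auto
  show "r \<in> outer_region K hdir hc P n0"
    using r ri sumb unfolding outer_region_def achievable_def by blast
qed

text \<open>Each constraint is a continuous condition on finitely many coordinates, so the converse
  passes from achievable tuples to their closure.\<close>

lemma closed_outer_region: "closed (outer_region K hdir hc P n0)"
proof -
  have [simp]: "continuous_on UNIV (\<lambda>r :: nat \<Rightarrow> real. r 0 + (\<Sum>i\<in>S. r i))" for S
    by (intro continuous_on_add continuous_on_sum continuous_on_product_coordinates)
  show ?thesis
    unfolding outer_region_def
    by (intro closed_Collect_conj closed_Collect_all closed_Collect_imp closed_Collect_le closed_Collect_eq
        continuous_on_product_coordinates continuous_on_const) auto
qed

lemma capacity_subset_outer:
  assumes "n0 > 0" and "\<forall>i\<le>K. P i \<ge> 0"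
  shows "capacity_region K hdir hc P n0 \<subseteq> outer_region K hdir hc P n0"
  unfolding capacity_region_def
  by (rule closure_minimal[OF achievable_subset_outer[OF assms] closed_outer_region])

section \<open>Random Gaussian codewords\<close>

lemma (in prob_space) indep_sum_sq:
  fixes X :: "nat \<Rightarrow> 'a \<Rightarrow> real"
  assumes ind: "indep_vars (\<lambda>_. borel) X {..<N}"
    and sq: "\<And>t. t < N \<Longrightarrow> integrable M (\<lambda>w. (X t w)\<^sup>2)"
    and mean: "\<And>t. t < N \<Longrightarrow> expectation (X t) = 0"
    and V: "\<And>t. t < N \<Longrightarrow> expectation (\<lambda>w. (X t w)\<^sup>2) \<le> V"
  shows "integrable M (\<lambda>w. (\<Sum>t<N. X t w)\<^sup>2)" and "expectation (\<lambda>w. (\<Sum>t<N. X t w)\<^sup>2) \<le> real N * V"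
proof -
  have rv: "t < N \<Longrightarrow> random_variable borel (X t)" for t using ind by (simp add: indep_vars_def)
  have int: "t < N \<Longrightarrow> integrable M (X t)" for t
    by (rule square_integrable_imp_integrable[OF rv sq])
  have cross: "integrable M (\<lambda>w. X s w * X t w) \<and> expectation (\<lambda>w. X s w * X t w) = (if s = t then expectation (\<lambda>w. (X t w)\<^sup>2) else 0)"
    if "s < N" "t < N" for s t
  proof (cases "s = t")
    case True then show ?thesis using sq[OF that(1)] by (simp add: power2_eq_square)
  next
    case False
    have i: "indep_vars (\<lambda>_. borel) X {s, t}" by (rule indep_vars_subset[OF ind]) (use that in auto)
    have "integrable M (\<lambda>w. \<Prod>i\<in>{s, t}. X i w)" "expectation (\<lambda>w. \<Prod>i\<in>{s, t}. X i w) = (\<Prod>i\<in>{s, t}. expectation (X i))"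
      using int that by (auto intro!: indep_vars_integrable[OF _ i] indep_vars_lebesgue_integral[OF _ i] simp del: prod.insert)
    then show ?thesis using False mean that by simp
  qed
  have eq: "(\<Sum>t<N. X t w)\<^sup>2 = (\<Sum>s<N. \<Sum>t<N. X s w * X t w)" for w
    by (simp add: power2_eq_square sum_product)
  show "integrable M (\<lambda>w. (\<Sum>t<N. X t w)\<^sup>2)"
    unfolding eq using cross by (intro Bochner_Integration.integrable_sum) auto
  have "expectation (\<lambda>w. (\<Sum>t<N. X t w)\<^sup>2) = (\<Sum>s<N. \<Sum>t<N. expectation (\<lambda>w. X s w * X t w))"
    unfolding eq using cross by (subst Bochner_Integration.integral_sum, auto intro!: Bochner_Integration.integrable_sum)
  also have "\<dots> = (\<Sum>s<N. \<Sum>t<N. if s = t then expectation (\<lambda>w. (X t w)\<^sup>2) else 0)"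
    using cross by (intro sum.cong refl) auto
  also have "\<dots> = (\<Sum>s<N. expectation (\<lambda>w. (X s w)\<^sup>2))"
    by (intro sum.cong refl) (simp add: sum.delta)
  also have "\<dots> \<le> (\<Sum>s<N. V)" using V by (intro sum_mono) auto
  finally show "expectation (\<lambda>w. (\<Sum>t<N. X t w)\<^sup>2) \<le> real N * V" by simp
qed

text \<open>Two applications of Cauchy-Schwarz reduce the sum to fourth moments of single
  coordinates. The price is the squared number of summands, harmless because that number is bounded
  in terms of \<open>K\<close> wherever the lemma is applied.\<close>

lemma gauss_PiM_lincomb_fourth:
  assumes v: "\<And>i. v i > 0" and A: "finite A" "A \<subseteq> I"
  shows "(\<integral>\<^sup>+w. ennreal ((cmod (\<Sum>i\<in>A. a i * w i))^4) \<partial>PiM I (\<lambda>i. cgauss (v i))) \<le>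
    ennreal (16 * (real (card A))\<^sup>2 * (\<Sum>i\<in>A. (cmod (a i))\<^sup>2 * v i)\<^sup>2)"
proof -
  let ?P = "PiM I (\<lambda>i. cgauss (v i))"
  define s where "s = (\<Sum>i\<in>A. (cmod (a i))\<^sup>2 * v i)"
  have pt: "(cmod (\<Sum>i\<in>A. a i * w i))^4 \<le> s\<^sup>2 * (real (card A) * (\<Sum>i\<in>A. (cmod (w i))^4 / (v i)\<^sup>2))" for w
  proof -
    have "(cmod (\<Sum>i\<in>A. a i * w i))\<^sup>2 \<le> (\<Sum>i\<in>A. (cmod (a i) * sqrt (v i)) * (cmod (w i) / sqrt (v i)))\<^sup>2"
    proof (rule power_mono)
      have "cmod (\<Sum>i\<in>A. a i * w i) \<le> (\<Sum>i\<in>A. cmod (a i * w i))" by (rule norm_sum)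
      also have "\<dots> = (\<Sum>i\<in>A. (cmod (a i) * sqrt (v i)) * (cmod (w i) / sqrt (v i)))"
        using v by (intro sum.cong refl) (simp add: norm_mult less_imp_neq[symmetric])
      finally show "cmod (\<Sum>i\<in>A. a i * w i) \<le> (\<Sum>i\<in>A. (cmod (a i) * sqrt (v i)) * (cmod (w i) / sqrt (v i)))" .
    qed simp
    also have "\<dots> \<le> (\<Sum>i\<in>A. (cmod (a i) * sqrt (v i))\<^sup>2) * (\<Sum>i\<in>A. (cmod (w i) / sqrt (v i))\<^sup>2)"
      by (rule Cauchy_Schwarz_ineq_sum)
    also have "\<dots> = s * (\<Sum>i\<in>A. (cmod (w i))\<^sup>2 / v i)"
      using v by (simp add: s_def power_mult_distrib power_divide less_imp_le)
    finally have 1: "(cmod (\<Sum>i\<in>A. a i * w i))\<^sup>2 \<le> s * (\<Sum>i\<in>A. (cmod (w i))\<^sup>2 / v i)" .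
    have "(cmod (\<Sum>i\<in>A. a i * w i))^4 = ((cmod (\<Sum>i\<in>A. a i * w i))\<^sup>2)\<^sup>2" by simp
    also have "\<dots> \<le> (s * (\<Sum>i\<in>A. (cmod (w i))\<^sup>2 / v i))\<^sup>2" by (rule power_mono[OF 1]) simp
    also have "\<dots> = s\<^sup>2 * (\<Sum>i\<in>A. 1 * ((cmod (w i))\<^sup>2 / v i))\<^sup>2" by (simp add: power_mult_distrib)
    also have "\<dots> \<le> s\<^sup>2 * ((\<Sum>i\<in>A. 1\<^sup>2) * (\<Sum>i\<in>A. ((cmod (w i))\<^sup>2 / v i)\<^sup>2))"
      by (intro mult_left_mono Cauchy_Schwarz_ineq_sum) simp
    also have "\<dots> = s\<^sup>2 * (real (card A) * (\<Sum>i\<in>A. (cmod (w i))^4 / (v i)\<^sup>2))"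
      by (simp add: power_divide flip: power_mult)
    finally show ?thesis .
  qed
  have "(\<integral>\<^sup>+w. ennreal ((cmod (\<Sum>i\<in>A. a i * w i))^4) \<partial>?P) \<le>
     (\<integral>\<^sup>+w. ennreal (s\<^sup>2 * real (card A)) * (\<Sum>i\<in>A. ennreal (1 / (v i)\<^sup>2) * ennreal ((cmod (w i))^4)) \<partial>?P)"
  proof (rule nn_integral_mono)
    fix w
    have "(\<Sum>i\<in>A. ennreal (1 / (v i)\<^sup>2) * ennreal ((cmod (w i))^4)) = (\<Sum>i\<in>A. ennreal ((cmod (w i))^4 / (v i)\<^sup>2))"
      by (intro sum.cong refl) (simp flip: ennreal_mult)
    also have "\<dots> = ennreal (\<Sum>i\<in>A. (cmod (w i))^4 / (v i)\<^sup>2)" by (rule sum_ennreal) simp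
    finally show "ennreal ((cmod (\<Sum>i\<in>A. a i * w i))^4) \<le> ennreal (s\<^sup>2 * real (card A)) * (\<Sum>i\<in>A. ennreal (1 / (v i)\<^sup>2) * ennreal ((cmod (w i))^4))"
      using pt[of w] by (simp add: sum_nonneg mult.assoc ennreal_leI flip: ennreal_mult)
  qed
  also have "\<dots> = ennreal (s\<^sup>2 * real (card A)) * (\<Sum>i\<in>A. ennreal (1 / (v i)\<^sup>2) * (\<integral>\<^sup>+w. ennreal ((cmod (w i))^4) \<partial>?P))"
  proof -
    have m: "(\<lambda>w. ennreal ((cmod (w i))^4)) \<in> borel_measurable ?P" if "i \<in> A" for i
      by measurable (use that A(2) in auto)
    show ?thesis
      using m by (subst nn_integral_cmult; (subst nn_integral_sum)?) (auto simp: nn_integral_cmult)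
  qed
  also have "\<dots> \<le> ennreal (s\<^sup>2 * real (card A)) * (\<Sum>i\<in>A. ennreal 16)"
  proof (intro mult_left_mono sum_mono)
    fix i assume i: "i \<in> A"
    have "(\<integral>\<^sup>+w. ennreal ((cmod (w i))^4) \<partial>?P) = (\<integral>\<^sup>+z. ennreal ((cmod z)^4) \<partial>cgauss (v i))"
      by (rule nn_integral_gauss_PiM_component[where v=v and f="\<lambda>z. ennreal ((cmod z)^4)", OF v]) (use i A in auto)
    also have "\<dots> \<le> ennreal (16 * (v i)\<^sup>2)" by (rule nn_integral_cgauss_fourth[OF v])
    finally have "ennreal (1 / (v i)\<^sup>2) * (\<integral>\<^sup>+w. ennreal ((cmod (w i))^4) \<partial>?P) \<le> ennreal (1 / (v i)\<^sup>2) * ennreal (16 * (v i)\<^sup>2)"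
      by (rule mult_left_mono) simp
    also have "\<dots> = ennreal 16" using v[of i] by (simp flip: ennreal_mult)
    finally show "ennreal (1 / (v i)\<^sup>2) * (\<integral>\<^sup>+w. ennreal ((cmod (w i))^4) \<partial>?P) \<le> ennreal 16" .
  qed simp
  also have "(\<Sum>i\<in>A. ennreal 16) = ennreal (real (card A) * 16)"
    by (simp add: ennreal_of_nat_eq_real_of_nat ennreal_mult)
  also have "ennreal (s\<^sup>2 * real (card A)) * \<dots> = ennreal (16 * (real (card A))\<^sup>2 * s\<^sup>2)"
    by (subst ennreal_mult[symmetric], simp, simp) (simp add: power2_eq_square mult_ac)
  finally show ?thesis by (simp add: s_def)
qed

text \<open>A weak law in mean square: the sets \<open>A t\<close> are disjoint, so the time slots
  are independent, and their variances are bounded by fourth moments. It is applied to the effective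
  noise, to the noise plus those components of the true codeword that a candidate misses, and to the
  transmitted power.\<close>

lemma gauss_quad_lln:
  fixes v :: "'i \<Rightarrow> real" and A :: "nat \<Rightarrow> 'i set"
  assumes v: "\<And>i. v i > 0"
    and A: "\<And>t. t < N \<Longrightarrow> finite (A t) \<and> A t \<subseteq> I" and disj: "disjoint_family_on A {..<N}"
    and s: "\<And>t. t < N \<Longrightarrow> (\<Sum>i\<in>A t. (cmod (a i))\<^sup>2 * v i) = s" and spos: "s > 0"
    and n: "\<And>t. t < N \<Longrightarrow> card (A t) \<le> n"
  shows "(\<integral>\<^sup>+w. ennreal ((\<Sum>t<N. (cmod (\<Sum>i\<in>A t. a i * w i))\<^sup>2 / s - 1)\<^sup>2) \<partial>PiM I (\<lambda>i. cgauss (v i))) \<le>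
    ennreal (16 * (real n)\<^sup>2 * real N)"
proof -
  let ?P = "PiM I (\<lambda>i. cgauss (v i))"
  interpret prob_space ?P by (rule prob_space_PiM) (rule prob_space_cgauss[OF v])
  define X where "X t w = (cmod (\<Sum>i\<in>A t. a i * w i))\<^sup>2 / s - 1" for t and w :: "'i \<Rightarrow> complex"
  have ind: "indep_vars (\<lambda>_. borel) X {..<N}"
  proof -
    have 1: "indep_vars (\<lambda>t. PiM (A t) (\<lambda>_. borel)) (\<lambda>t w. restrict (\<lambda>i. w i) (A t)) {..<N}"
      by (rule indep_vars_restrict[OF gauss_PiM_indep[where v=v, OF v]]) (use A disj in auto)
    have 2: "X t \<in> measurable (PiM (A t) (\<lambda>_. borel)) borel" for t
      unfolding X_def by measurable
    have "indep_vars (\<lambda>_. borel) (\<lambda>t w. X t (restrict (\<lambda>i. w i) (A t))) {..<N}"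
      by (rule indep_vars_compose2[OF 1]) (rule 2)
    moreover have "X t (restrict (\<lambda>i. w i) (A t)) = X t w" for t w by (simp add: X_def)
    ultimately show ?thesis by simp
  qed
  have rv: "t < N \<Longrightarrow> random_variable borel (X t)" for t using ind by (simp add: indep_vars_def)
  have mom: "integrable ?P (\<lambda>w. (cmod (\<Sum>i\<in>A t. a i * w i))\<^sup>2)" "expectation (\<lambda>w. (cmod (\<Sum>i\<in>A t. a i * w i))\<^sup>2) = s" if t: "t < N" for t
    using gauss_PiM_lincomb_sq[where v=v and A="A t" and I=I and k=0 and a=a, OF v] A[OF t] s[OF t] by auto
  have mean: "expectation (X t) = 0" if "t < N" for t
    unfolding X_def using mom[OF that] spos by (simp add: prob_space)
  have fourth: "integrable ?P (\<lambda>w. ((cmod (\<Sum>i\<in>A t. a i * w i))\<^sup>2 / s)\<^sup>2) \<and> expectation (\<lambda>w. ((cmod (\<Sum>i\<in>A t. a i * w i))\<^sup>2 / s)\<^sup>2) \<le> 16 * (real n)\<^sup>2" if t: "t < N" for t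
  proof -
    have m: "(\<lambda>w. (cmod (\<Sum>i\<in>A t. a i * w i))^4) \<in> borel_measurable ?P"
      by measurable (use A[OF t] in auto)
    have "(\<integral>\<^sup>+w. ennreal ((cmod (\<Sum>i\<in>A t. a i * w i))^4) \<partial>?P) \<le> ennreal (16 * (real (card (A t)))\<^sup>2 * s\<^sup>2)"
      using gauss_PiM_lincomb_fourth[where v=v and A="A t" and I=I and a=a, OF v] A[OF t] s[OF t] by simp
    also have "\<dots> \<le> ennreal (16 * (real n)\<^sup>2 * s\<^sup>2)"
      using n[OF t] spos by (intro ennreal_leI mult_mono power_mono) auto
    finally have b: "(\<integral>\<^sup>+w. ennreal ((cmod (\<Sum>i\<in>A t. a i * w i))^4) \<partial>?P) \<le> ennreal (16 * (real n)\<^sup>2 * s\<^sup>2)" .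
    have i: "integrable ?P (\<lambda>w. (cmod (\<Sum>i\<in>A t. a i * w i))^4)"
      by (rule integrableI_nonneg[OF m]) (use b in \<open>auto simp: le_less_trans\<close>)
    have "ennreal (expectation (\<lambda>w. (cmod (\<Sum>i\<in>A t. a i * w i))^4)) \<le> ennreal (16 * (real n)\<^sup>2 * s\<^sup>2)"
      using b nn_integral_eq_integral[OF i] by simp
    then have e: "expectation (\<lambda>w. (cmod (\<Sum>i\<in>A t. a i * w i))^4) \<le> 16 * (real n)\<^sup>2 * s\<^sup>2"
      by (subst (asm) ennreal_le_iff) auto
    have eq: "((cmod (\<Sum>i\<in>A t. a i * w i))\<^sup>2 / s)\<^sup>2 = (cmod (\<Sum>i\<in>A t. a i * w i))^4 / s\<^sup>2" for w
      by (simp add: power_divide flip: power_mult)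
    show ?thesis unfolding eq using i e spos by (simp add: divide_le_eq)
  qed
  have sq: "integrable ?P (\<lambda>w. (X t w)\<^sup>2)" "expectation (\<lambda>w. (X t w)\<^sup>2) \<le> 16 * (real n)\<^sup>2" if t: "t < N" for t
  proof -
    have eq: "(X t w)\<^sup>2 = ((cmod (\<Sum>i\<in>A t. a i * w i))\<^sup>2 / s)\<^sup>2 - 2 * ((cmod (\<Sum>i\<in>A t. a i * w i))\<^sup>2 / s) + 1" for w
      by (simp add: X_def power2_eq_square algebra_simps)
    show "integrable ?P (\<lambda>w. (X t w)\<^sup>2)"
      unfolding eq using fourth[OF t] mom[OF t] by (intro Bochner_Integration.integrable_add Bochner_Integration.integrable_diff) auto
    have "expectation (\<lambda>w. (X t w)\<^sup>2) = expectation (\<lambda>w. ((cmod (\<Sum>i\<in>A t. a i * w i))\<^sup>2 / s)\<^sup>2) - 2 * (s / s) + 1"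
      unfolding eq using fourth[OF t] mom[OF t] by (simp add: prob_space)
    then show "expectation (\<lambda>w. (X t w)\<^sup>2) \<le> 16 * (real n)\<^sup>2" using fourth[OF t] spos by simp
  qed
  note S = indep_sum_sq[OF ind sq(1) mean sq(2)]
  have "(\<integral>\<^sup>+w. ennreal ((\<Sum>t<N. X t w)\<^sup>2) \<partial>?P) = ennreal (expectation (\<lambda>w. (\<Sum>t<N. X t w)\<^sup>2))"
    by (rule nn_integral_eq_integral[OF S(1)]) auto
  also have "\<dots> \<le> ennreal (16 * (real n)\<^sup>2 * real N)"
    using S(2) by (intro ennreal_leI) (simp add: mult_ac)
  finally show ?thesis by (simp only: X_def)
qed

section \<open>Pairwise errors of minimum-distance decoding\<close>

text \<open>Iterates \<open>cgauss_exp_quad\<close> over the components. One step replaces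
  \<open>l\<close> by \<open>l / (1 + l * (cmod (\<alpha> k))\<^sup>2)\<close>, and these maps
  compose by adding the powers, whence the induction with arbitrary \<open>l\<close>.\<close>

lemma gauss_codeword_eliminate:
  fixes v :: "'i \<Rightarrow> real" and \<phi> :: "'k \<Rightarrow> nat \<Rightarrow> 'i" and y :: "nat \<Rightarrow> ('i \<Rightarrow> complex) \<Rightarrow> complex"
  assumes v: "\<And>i. v i > 0" and I: "finite I" and "finite A" and "l > 0"
    and "\<And>k t. k \<in> A \<Longrightarrow> t < N \<Longrightarrow> \<phi> k t \<in> I \<and> v (\<phi> k t) = 1"
    and "inj_on (\<lambda>(k, t). \<phi> k t) (A \<times> {..<N})"
    and "G \<in> borel_measurable (PiM I (\<lambda>i. cgauss (v i)))"
    and "\<And>t. t < N \<Longrightarrow> y t \<in> borel_measurable (PiM I (\<lambda>i. cgauss (v i)))"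
    and "\<And>w w'. (\<And>i. i \<in> I - (\<lambda>(k, t). \<phi> k t) ` (A \<times> {..<N}) \<Longrightarrow> w i = w' i) \<Longrightarrow> G w = G w'"
    and "\<And>t w w'. t < N \<Longrightarrow> (\<And>i. i \<in> I - (\<lambda>(k, t). \<phi> k t) ` (A \<times> {..<N}) \<Longrightarrow> w i = w' i) \<Longrightarrow> y t w = y t w'"
  shows "(\<integral>\<^sup>+w. G w * ennreal (\<Prod>t<N. exp (- l * (cmod (y t w - (\<Sum>k\<in>A. \<alpha> k * w (\<phi> k t))))\<^sup>2)) \<partial>PiM I (\<lambda>i. cgauss (v i))) =
    (\<integral>\<^sup>+w. G w * ennreal ((1 / (1 + l * (\<Sum>k\<in>A. (cmod (\<alpha> k))\<^sup>2)))^N *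
        (\<Prod>t<N. exp (- (l / (1 + l * (\<Sum>k\<in>A. (cmod (\<alpha> k))\<^sup>2))) * (cmod (y t w))\<^sup>2))) \<partial>PiM I (\<lambda>i. cgauss (v i)))"
  using assms(3-)
proof (induction A arbitrary: l G rule: finite_induct)
  case empty
  show ?case by simp
next
  case (insert k A)
  let ?P = "PiM I (\<lambda>i. cgauss (v i))"
  let ?im = "\<lambda>A. (\<lambda>(k, t). \<phi> k t) ` (A \<times> {..<N})"
  define l1 where "l1 = l / (1 + l * (cmod (\<alpha> k))\<^sup>2)"
  have D: "1 + l * (cmod (\<alpha> k))\<^sup>2 > 0" using insert.prems(1) by (simp add: add_pos_nonneg)
  have l1: "l1 > 0" using D insert.prems(1) by (simp add: l1_def)
  define y' where "y' t w = y t w - (\<Sum>k\<in>A. \<alpha> k * w (\<phi> k t))" for t w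
  have y'm: "y' t \<in> borel_measurable ?P" if "t < N" for t
  proof -
    have "(\<lambda>w. w (\<phi> j t)) \<in> borel_measurable ?P" if "j \<in> A" for j
      by measurable (use insert.prems(2)[of j t] that \<open>t < N\<close> in auto)
    then show ?thesis unfolding y'_def using insert.prems(5)[OF that]
      by (intro borel_measurable_diff borel_measurable_sum borel_measurable_times borel_measurable_const) auto
  qed
  have injk: "inj_on (\<phi> k) {..<N}"
  proof (rule inj_onI)
    fix s t assume "s \<in> {..<N}" "t \<in> {..<N}" "\<phi> k s = \<phi> k t"
    then show "s = t" using inj_onD[OF insert.prems(3), of "(k, s)" "(k, t)"] by auto
  qed
  define F where "F = \<phi> k ` {..<N}"
  have FI: "F \<subseteq> I" using insert.prems(2) by (auto simp: F_def)
  have FA: "?im (insert k A) = F \<union> ?im A" by (auto simp: F_def)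
  have FnA: "\<phi> j t \<notin> F" if "j \<in> A" "t < N" for j t
  proof
    assume "\<phi> j t \<in> F"
    then obtain s where "s < N" "\<phi> j t = \<phi> k s" by (auto simp: F_def)
    then have "(j, t) = (k, s)" using that by (intro inj_onD[OF insert.prems(3)]) auto
    then show False using that insert.hyps by simp
  qed
  \<comment> \<open>\<open>\<tau>\<close> recovers the time from a coordinate of component
    \<open>k\<close>, since the elimination lemma indexes its factors by coordinates.\<close>
  define \<tau> where "\<tau> = the_inv_into {..<N} (\<phi> k)"
  have \<tau>: "\<tau> (\<phi> k t) = t" if "t < N" for t
    unfolding \<tau>_def using injk that by (intro the_inv_into_f_f) auto
  have \<tau>F: "f \<in> F \<Longrightarrow> \<tau> f < N" for f using \<tau> by (auto simp: F_def)
  define h where "h f w x = ennreal (exp (- l * (cmod (y' (\<tau> f) w - \<alpha> k * x))\<^sup>2))" for f w x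
  have eq: "(\<Prod>f\<in>F. H (\<tau> f) f) = (\<Prod>t<N. H t (\<phi> k t))" for H :: "nat \<Rightarrow> 'i \<Rightarrow> ennreal"
    unfolding F_def by (subst prod.reindex[OF injk]) (auto intro!: prod.cong simp: \<tau>)
  have "(\<integral>\<^sup>+w. G w * ennreal (\<Prod>t<N. exp (- l * (cmod (y t w - (\<Sum>k\<in>insert k A. \<alpha> k * w (\<phi> k t))))\<^sup>2)) \<partial>?P) =
     (\<integral>\<^sup>+w. G w * (\<Prod>f\<in>F. h f w (w f)) \<partial>?P)"
  proof (intro nn_integral_cong arg_cong2[where f="(*)", OF refl])
    fix w
    have "(\<Prod>f\<in>F. h f w (w f)) = (\<Prod>t<N. ennreal (exp (- l * (cmod (y' t w - \<alpha> k * w (\<phi> k t)))\<^sup>2)))"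
      unfolding h_def by (rule eq[of "\<lambda>t f. ennreal (exp (- l * (cmod (y' t w - \<alpha> k * w f))\<^sup>2))"])
    also have "\<dots> = ennreal (\<Prod>t<N. exp (- l * (cmod (y' t w - \<alpha> k * w (\<phi> k t)))\<^sup>2))"
      by (rule prod_ennreal) simp
    also have "(\<Prod>t<N. exp (- l * (cmod (y' t w - \<alpha> k * w (\<phi> k t)))\<^sup>2)) = (\<Prod>t<N. exp (- l * (cmod (y t w - (\<Sum>k\<in>insert k A. \<alpha> k * w (\<phi> k t))))\<^sup>2))"
      using insert.hyps by (simp add: y'_def algebra_simps)
    finally show "ennreal (\<Prod>t<N. exp (- l * (cmod (y t w - (\<Sum>k\<in>insert k A. \<alpha> k * w (\<phi> k t))))\<^sup>2)) = (\<Prod>f\<in>F. h f w (w f))" by simp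
  qed
  also have "\<dots> = (\<integral>\<^sup>+w. G w * (\<Prod>f\<in>F. \<integral>\<^sup>+x. h f w x \<partial>cgauss (v f)) \<partial>?P)"
  proof (rule gauss_PiM_eliminate[where v=v, OF v I FI insert.prems(4)])
    fix f assume f: "f \<in> F"
    note [measurable] = y'm[OF \<tau>F[OF f]]
    show "(\<lambda>(w, x). h f w x) \<in> borel_measurable (?P \<Otimes>\<^sub>M borel)"
      unfolding h_def by measurable
  next
    fix w w' :: "'i \<Rightarrow> complex" assume e: "\<And>i. i \<in> I - F \<Longrightarrow> w i = w' i"
    show "G w = G w'" by (rule insert.prems(6)) (use e FA in auto)
    fix f assume f: "f \<in> F"
    have "y (\<tau> f) w = y (\<tau> f) w'" by (rule insert.prems(7)[OF \<tau>F[OF f]]) (use e FA in auto)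
    moreover have "w (\<phi> j (\<tau> f)) = w' (\<phi> j (\<tau> f))" if "j \<in> A" for j
      using FnA[OF that \<tau>F[OF f]] insert.prems(2)[of j] that \<tau>F[OF f] by (intro e) auto
    ultimately have "y' (\<tau> f) w = y' (\<tau> f) w'" unfolding y'_def by simp
    then show "h f w = h f w'" by (simp add: h_def fun_eq_iff)
  qed
  also have "\<dots> = (\<integral>\<^sup>+w. (ennreal ((1 / (1 + l * (cmod (\<alpha> k))\<^sup>2))^N) * G w) * ennreal (\<Prod>t<N. exp (- l1 * (cmod (y t w - (\<Sum>k\<in>A. \<alpha> k * w (\<phi> k t))))\<^sup>2)) \<partial>?P)"
  proof (intro nn_integral_cong)
    fix w
    have "(\<Prod>f\<in>F. \<integral>\<^sup>+x. h f w x \<partial>cgauss (v f)) = (\<Prod>f\<in>F. ennreal (1 / (1 + l * (cmod (\<alpha> k))\<^sup>2) * exp (- l1 * (cmod (y' (\<tau> f) w))\<^sup>2)))"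
    proof (rule prod.cong[OF refl])
      fix f assume f: "f \<in> F"
      then have vf: "v f = 1" using insert.prems(2)[of k] by (auto simp: F_def)
      show "(\<integral>\<^sup>+x. h f w x \<partial>cgauss (v f)) = ennreal (1 / (1 + l * (cmod (\<alpha> k))\<^sup>2) * exp (- l1 * (cmod (y' (\<tau> f) w))\<^sup>2))"
        unfolding h_def vf l1_def using cgauss_exp_quad[of 1 l "y' (\<tau> f) w" "\<alpha> k"] insert.prems(1) by simp
    qed
    also have "\<dots> = (\<Prod>t<N. ennreal (1 / (1 + l * (cmod (\<alpha> k))\<^sup>2) * exp (- l1 * (cmod (y' t w))\<^sup>2)))"
      by (rule eq)
    also have "\<dots> = ennreal (\<Prod>t<N. 1 / (1 + l * (cmod (\<alpha> k))\<^sup>2) * exp (- l1 * (cmod (y' t w))\<^sup>2))"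
      using D by (intro prod_ennreal) (simp add: less_imp_le)
    also have "\<dots> = ennreal ((1 / (1 + l * (cmod (\<alpha> k))\<^sup>2))^N * (\<Prod>t<N. exp (- l1 * (cmod (y' t w))\<^sup>2)))"
      by (subst prod.distrib) simp
    also have "\<dots> = ennreal ((1 / (1 + l * (cmod (\<alpha> k))\<^sup>2))^N) * ennreal (\<Prod>t<N. exp (- l1 * (cmod (y' t w))\<^sup>2))"
      using D by (intro ennreal_mult) (auto simp: less_imp_le intro!: prod_nonneg)
    finally show "G w * (\<Prod>f\<in>F. \<integral>\<^sup>+x. h f w x \<partial>cgauss (v f)) =
       (ennreal ((1 / (1 + l * (cmod (\<alpha> k))\<^sup>2))^N) * G w) * ennreal (\<Prod>t<N. exp (- l1 * (cmod (y t w - (\<Sum>k\<in>A. \<alpha> k * w (\<phi> k t))))\<^sup>2))"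
      by (simp add: y'_def mult_ac)
  qed
  also have "\<dots> = (\<integral>\<^sup>+w. (ennreal ((1 / (1 + l * (cmod (\<alpha> k))\<^sup>2))^N) * G w) * ennreal ((1 / (1 + l1 * (\<Sum>k\<in>A. (cmod (\<alpha> k))\<^sup>2)))^N *
        (\<Prod>t<N. exp (- (l1 / (1 + l1 * (\<Sum>k\<in>A. (cmod (\<alpha> k))\<^sup>2))) * (cmod (y t w))\<^sup>2))) \<partial>?P)"
  proof (rule insert.IH[OF l1])
    show "inj_on (\<lambda>(k, t). \<phi> k t) (A \<times> {..<N})" by (rule inj_on_subset[OF insert.prems(3)]) auto
    show "(\<lambda>w. ennreal ((1 / (1 + l * (cmod (\<alpha> k))\<^sup>2))^N) * G w) \<in> borel_measurable ?P"
      by (intro borel_measurable_times_ennreal borel_measurable_const insert.prems(4))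
  next
    fix w w' :: "'i \<Rightarrow> complex" assume e: "\<And>i. i \<in> I - ?im A \<Longrightarrow> w i = w' i"
    have "G w = G w'" by (rule insert.prems(6)) (use e FA in auto)
    then show "ennreal ((1 / (1 + l * (cmod (\<alpha> k))\<^sup>2))^N) * G w = ennreal ((1 / (1 + l * (cmod (\<alpha> k))\<^sup>2))^N) * G w'" by simp
    show "y t w = y t w'" if "t < N" for t by (rule insert.prems(7)[OF that]) (use e FA in auto)
  next
    show "\<phi> j t \<in> I \<and> v (\<phi> j t) = 1" if "j \<in> A" "t < N" for j t
      by (rule insert.prems(2)) (use that in auto)
    show "y t \<in> borel_measurable ?P" if "t < N" for t by (rule insert.prems(5)[OF that])
  qed
  also have "\<dots> = (\<integral>\<^sup>+w. G w * ennreal ((1 / (1 + l * (\<Sum>k\<in>insert k A. (cmod (\<alpha> k))\<^sup>2)))^N *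
        (\<Prod>t<N. exp (- (l / (1 + l * (\<Sum>k\<in>insert k A. (cmod (\<alpha> k))\<^sup>2))) * (cmod (y t w))\<^sup>2))) \<partial>?P)"
  proof (rule nn_integral_cong)
    fix w
    define S where "S = (\<Sum>k\<in>A. (cmod (\<alpha> k))\<^sup>2)"
    have S: "S \<ge> 0" by (simp add: S_def sum_nonneg)
    define d where "d = 1 + l * (cmod (\<alpha> k))\<^sup>2"
    have d: "d > 0" using D by (simp add: d_def)
    have S1: "(\<Sum>k\<in>insert k A. (cmod (\<alpha> k))\<^sup>2) = (cmod (\<alpha> k))\<^sup>2 + S" using insert.hyps by (simp add: S_def)
    have prod: "d * (1 + l1 * S) = 1 + l * ((cmod (\<alpha> k))\<^sup>2 + S)"
    proof -
      have "d * l1 = l" unfolding l1_def d_def[symmetric] using d by simp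
      then have "d * (1 + l1 * S) = d + l * S" by (simp add: distrib_left flip: mult.assoc)
      then show ?thesis by (simp add: d_def algebra_simps)
    qed
    have e1: "(1 / d)^N * (1 / (1 + l1 * S))^N = (1 / (1 + l * ((cmod (\<alpha> k))\<^sup>2 + S)))^N"
      unfolding prod[symmetric] by (simp flip: power_mult_distrib)
    have e2: "l1 / (1 + l1 * S) = l / (1 + l * ((cmod (\<alpha> k))\<^sup>2 + S))"
      unfolding prod[symmetric] by (simp add: l1_def d_def)
    have "ennreal ((1 / d)^N) * ennreal ((1 / (1 + l1 * S))^N * X) = ennreal ((1 / (1 + l * ((cmod (\<alpha> k))\<^sup>2 + S)))^N * X)" if "X \<ge> 0" for X
      unfolding e1[symmetric] using that d l1 S by (simp add: mult.assoc flip: ennreal_mult)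
    from this[of "\<Prod>t<N. exp (- (l1 / (1 + l1 * S)) * (cmod (y t w))\<^sup>2)"]
    show "(ennreal ((1 / (1 + l * (cmod (\<alpha> k))\<^sup>2))^N) * G w) * ennreal ((1 / (1 + l1 * (\<Sum>k\<in>A. (cmod (\<alpha> k))\<^sup>2)))^N *
        (\<Prod>t<N. exp (- (l1 / (1 + l1 * (\<Sum>k\<in>A. (cmod (\<alpha> k))\<^sup>2))) * (cmod (y t w))\<^sup>2))) =
       G w * ennreal ((1 / (1 + l * (\<Sum>k\<in>insert k A. (cmod (\<alpha> k))\<^sup>2)))^N *
        (\<Prod>t<N. exp (- (l / (1 + l * (\<Sum>k\<in>insert k A. (cmod (\<alpha> k))\<^sup>2))) * (cmod (y t w))\<^sup>2)))"
      unfolding S1 S_def[symmetric] d_def[symmetric] e2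
      by (simp add: mult.assoc mult.left_commute[of _ "G w"] prod_nonneg)
  qed
  finally show ?case .
qed

text \<open>Minimum-distance decoding of superposed Gaussian codewords: \<open>idx c k\<close> is the codeword that the
  candidate \<open>c\<close> selects in component \<open>k\<close>. A wrong candidate is a fresh Gaussian codeword
  in exactly the components in which it differs from \<open>c0\<close>; integrating these out turns
  the exponential bound on the pairwise error into a statement about the true codeword alone.\<close>
lemma gauss_receiver_error:
  fixes v :: "'i \<Rightarrow> real" and \<phi> :: "'k \<Rightarrow> nat \<Rightarrow> nat \<Rightarrow> 'i" and idx :: "'c \<Rightarrow> 'k \<Rightarrow> nat" and Z :: "nat \<Rightarrow> 'i set"
    and \<alpha> :: "'k \<Rightarrow> complex"
  assumes v: "\<And>i. v i > 0" and I: "finite I" and C: "finite C" and Cm: "finite Cm"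
    and \<phi>1: "\<And>k t c. k \<in> Cm \<Longrightarrow> t < N \<Longrightarrow> c \<in> insert c0 C \<Longrightarrow> \<phi> k (idx c k) t \<in> I \<and> v (\<phi> k (idx c k) t) = 1"
    and \<phi>inj: "\<And>k k' n n' t t'. k \<in> Cm \<Longrightarrow> k' \<in> Cm \<Longrightarrow> \<phi> k n t = \<phi> k' n' t' \<Longrightarrow> k = k' \<and> n = n' \<and> t = t'"
    and Z: "\<And>t. t < N \<Longrightarrow> finite (Z t) \<and> Z t \<subseteq> I" and Zdisj: "disjoint_family_on Z {..<N}"
    and Z\<phi>: "\<And>k n t t'. k \<in> Cm \<Longrightarrow> t' < N \<Longrightarrow> \<phi> k n t \<notin> Z t'"
    and \<nu>: "\<And>t. t < N \<Longrightarrow> (\<Sum>i\<in>Z t. (cmod (b i))\<^sup>2 * v i) = \<nu>" and \<nu>pos: "\<nu> > 0"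
    and n: "\<And>t. t < N \<Longrightarrow> card (Z t) + card Cm \<le> n" and \<eta>: "\<eta> > 0" and N: "N > 0"
  defines "X \<equiv> \<lambda>c t w. \<Sum>k\<in>Cm. \<alpha> k * w (\<phi> k (idx c k) t)"
    and "\<zeta> \<equiv> \<lambda>t w. \<Sum>i\<in>Z t. b i * w i"
  defines "E \<equiv> {w \<in> space (PiM I (\<lambda>i. cgauss (v i))). \<exists>c\<in>C.
      (\<Sum>t<N. (cmod (X c0 t w + \<zeta> t w - X c t w))\<^sup>2) \<le> (\<Sum>t<N. (cmod (\<zeta> t w))\<^sup>2)}"
    and "s \<equiv> \<lambda>c. \<Sum>k | k \<in> Cm \<and> idx c k \<noteq> idx c0 k. (cmod (\<alpha> k))\<^sup>2"
  shows "E \<in> sets (PiM I (\<lambda>i. cgauss (v i)))"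
    and "emeasure (PiM I (\<lambda>i. cgauss (v i))) E \<le>
      ennreal (2 ^ card Cm * (64 * (real n)\<^sup>2 / (real N * \<eta>\<^sup>2)) + (\<Sum>c\<in>C. exp (real N * \<eta>) * (1 / (1 + s c / \<nu>)) ^ N))"
proof -
  let ?P = "PiM I (\<lambda>i. cgauss (v i))"
  interpret prob_space ?P by (rule prob_space_PiM) (rule prob_space_cgauss[OF v])
  have Xm: "X c t \<in> borel_measurable ?P" if "c \<in> insert c0 C" "t < N" for c t
    unfolding X_def by measurable (use \<phi>1 that in auto)
  have \<zeta>m: "\<zeta> t \<in> borel_measurable ?P" if "t < N" for t
    unfolding \<zeta>_def by measurable (use Z that in auto)
  define D where "D c w = (\<Sum>t<N. (cmod (X c0 t w + \<zeta> t w - X c t w))\<^sup>2)" for c w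
  define D0 where "D0 w = (\<Sum>t<N. (cmod (\<zeta> t w))\<^sup>2)" for w
  have Dm: "D c \<in> borel_measurable ?P" if c: "c \<in> C" for c
    unfolding D_def
  proof (rule borel_measurable_sum)
    fix t assume "t \<in> {..<N}"
    then have [measurable]: "X c0 t \<in> borel_measurable ?P" "\<zeta> t \<in> borel_measurable ?P" "X c t \<in> borel_measurable ?P"
      using Xm \<zeta>m c by auto
    show "(\<lambda>w. (cmod (X c0 t w + \<zeta> t w - X c t w))\<^sup>2) \<in> borel_measurable ?P" by measurable
  qed
  have D0m[measurable]: "D0 \<in> borel_measurable ?P"
    unfolding D0_def
  proof (rule borel_measurable_sum)
    fix t assume "t \<in> {..<N}"
    then have [measurable]: "\<zeta> t \<in> borel_measurable ?P" using \<zeta>m by auto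
    show "(\<lambda>w. (cmod (\<zeta> t w))\<^sup>2) \<in> borel_measurable ?P" by measurable
  qed
  have Eeq: "E = (\<Union>c\<in>C. {w \<in> space ?P. D c w \<le> D0 w})"
    unfolding E_def D_def D0_def by auto
  have Dset: "{w \<in> space ?P. D c w \<le> D0 w} \<in> sets ?P" if "c \<in> C" for c
    using Dm[OF that] by measurable
  show "E \<in> sets ?P" unfolding Eeq using Dset C by auto

  define df where "df c = {k \<in> Cm. idx c k \<noteq> idx c0 k}" for c
  define sA where "sA A = (\<Sum>k\<in>A. (cmod (\<alpha> k))\<^sup>2)" for A
  have s_eq: "s c = sA (df c)" for c by (simp add: s_def sA_def df_def)
  have sA: "sA A \<ge> 0" for A by (simp add: sA_def sum_nonneg)
  \<comment> \<open>What a candidate that differs from the truth exactly in \<open>A\<close> leaves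
    unexplained before its own codewords are subtracted: the noise and the true codewords in
    \<open>A\<close>. No codeword of the candidate in \<open>A\<close> occurs in it.\<close>
  define yt where "yt A t w = \<zeta> t w + (\<Sum>k\<in>A. \<alpha> k * w (\<phi> k (idx c0 k) t))" for A t w
  have ytm: "yt A t \<in> borel_measurable ?P" if "A \<subseteq> Cm" "t < N" for A t
  proof -
    have "(\<lambda>w. w (\<phi> k (idx c0 k) t)) \<in> borel_measurable ?P" if "k \<in> A" for k
      by measurable (use \<phi>1[of k t c0] that \<open>A \<subseteq> Cm\<close> \<open>t < N\<close> in auto)
    then show ?thesis unfolding yt_def using \<zeta>m[OF that(2)]
      by (intro borel_measurable_add borel_measurable_sum borel_measurable_times borel_measurable_const) auto
  qed
  define Wz where "Wz w = (\<Sum>t<N. (cmod (\<zeta> t w))\<^sup>2 / \<nu> - 1)" for w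
  define Wy where "Wy A w = (\<Sum>t<N. (cmod (yt A t w))\<^sup>2 / (\<nu> + sA A) - 1)" for A w
  have Wzm[measurable]: "Wz \<in> borel_measurable ?P"
    unfolding Wz_def
  proof (rule borel_measurable_sum)
    fix t assume "t \<in> {..<N}"
    then have [measurable]: "\<zeta> t \<in> borel_measurable ?P" using \<zeta>m by auto
    show "(\<lambda>w. (cmod (\<zeta> t w))\<^sup>2 / \<nu> - 1) \<in> borel_measurable ?P" by measurable
  qed
  have Wym: "Wy A \<in> borel_measurable ?P" if A: "A \<subseteq> Cm" for A
    unfolding Wy_def
  proof (rule borel_measurable_sum)
    fix t assume "t \<in> {..<N}"
    then have [measurable]: "yt A t \<in> borel_measurable ?P" using ytm A by auto
    show "(\<lambda>w. (cmod (yt A t w))\<^sup>2 / (\<nu> + sA A) - 1) \<in> borel_measurable ?P" by measurable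
  qed
  have Wz2: "(\<integral>\<^sup>+w. ennreal ((Wz w)\<^sup>2) \<partial>?P) \<le> ennreal (16 * (real n)\<^sup>2 * real N)"
    unfolding Wz_def \<zeta>_def
    by (rule gauss_quad_lln[where v=v, OF v Z Zdisj \<nu> \<nu>pos]) (use n in fastforce)+
  have Wy2: "(\<integral>\<^sup>+w. ennreal ((Wy A w)\<^sup>2) \<partial>?P) \<le> ennreal (16 * (real n)\<^sup>2 * real N)" if A: "A \<subseteq> Cm" for A
  proof -
    define T where "T t = (\<lambda>k. \<phi> k (idx c0 k) t) ` A" for t
    \<comment> \<open>Merges the coefficients of noise and codewords into one function on
      coordinates, as the law of large numbers requires; injectivity of \<open>\<phi>\<close> makes
      the component of a coordinate unique.\<close>
    define a where "a i = (if \<exists>k\<in>A. \<exists>t<N. i = \<phi> k (idx c0 k) t then \<alpha> (THE k. k \<in> A \<and> (\<exists>t<N. i = \<phi> k (idx c0 k) t)) else b i)" for i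
    have finA: "finite A" using A Cm finite_subset by blast
    have a1: "a (\<phi> k (idx c0 k) t) = \<alpha> k" if "k \<in> A" "t < N" for k t
    proof -
      have "(THE j. j \<in> A \<and> (\<exists>t'<N. \<phi> k (idx c0 k) t = \<phi> j (idx c0 j) t')) = k"
        using that A \<phi>inj by (intro the_equality) blast+
      then show ?thesis using that by (auto simp: a_def)
    qed
    have a2: "a i = b i" if "i \<in> Z t" "t < N" for i t
      using Z\<phi> that A by (auto simp: a_def)
    have injT: "inj_on (\<lambda>k. \<phi> k (idx c0 k) t) A" for t
      unfolding inj_on_def using \<phi>inj A by blast
    have ZT: "Z t \<inter> T t' = {}" if "t < N" for t t' using Z\<phi> A that by (auto simp: T_def)
    have finT: "finite (T t)" for t using finA by (simp add: T_def)
    have sumT: "(\<Sum>i\<in>T t. f i) = (\<Sum>k\<in>A. f (\<phi> k (idx c0 k) t))" for t and f :: "'i \<Rightarrow> 'x::comm_monoid_add"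
      unfolding T_def by (subst sum.reindex[OF injT]) simp
    have yeq: "yt A t w = (\<Sum>i\<in>Z t \<union> T t. a i * w i)" if "t < N" for t w
    proof -
      have "(\<Sum>i\<in>Z t \<union> T t. a i * w i) = (\<Sum>i\<in>Z t. a i * w i) + (\<Sum>i\<in>T t. a i * w i)"
        using Z[OF that] finT ZT[OF that] by (intro sum.union_disjoint) auto
      then show ?thesis using that by (simp add: yt_def \<zeta>_def sumT a1 a2)
    qed
    have "(\<integral>\<^sup>+w. ennreal ((\<Sum>t<N. (cmod (\<Sum>i\<in>Z t \<union> T t. a i * w i))\<^sup>2 / (\<nu> + sA A) - 1)\<^sup>2) \<partial>?P) \<le> ennreal (16 * (real n)\<^sup>2 * real N)"
    proof (rule gauss_quad_lln[where v=v, OF v])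
      fix t assume t: "t < N"
      have TI: "T t \<subseteq> I" using \<phi>1[of _ t c0] A t by (auto simp: T_def)
      then show "finite (Z t \<union> T t) \<and> Z t \<union> T t \<subseteq> I" using Z[OF t] finT by auto
      have "(\<Sum>i\<in>Z t \<union> T t. (cmod (a i))\<^sup>2 * v i) = (\<Sum>i\<in>Z t. (cmod (a i))\<^sup>2 * v i) + (\<Sum>i\<in>T t. (cmod (a i))\<^sup>2 * v i)"
        using Z[OF t] finT ZT[OF t] by (intro sum.union_disjoint) auto
      also have "(\<Sum>i\<in>Z t. (cmod (a i))\<^sup>2 * v i) = \<nu>" using \<nu>[OF t] a2 t by simp
      also have "(\<Sum>i\<in>T t. (cmod (a i))\<^sup>2 * v i) = sA A"
        unfolding sumT sA_def using \<phi>1[of _ t c0] A t by (intro sum.cong refl) (auto simp: a1)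
      finally show "(\<Sum>i\<in>Z t \<union> T t. (cmod (a i))\<^sup>2 * v i) = \<nu> + sA A" .
      have "card (Z t \<union> T t) \<le> card (Z t) + card (T t)" by (rule card_Un_le)
      also have "card (T t) \<le> card Cm" unfolding T_def using card_image_le[OF finA] card_mono[OF Cm A] le_trans by blast
      finally show "card (Z t \<union> T t) \<le> n" using n[OF t] by simp
    next
      show "disjoint_family_on (\<lambda>t. Z t \<union> T t) {..<N}"
        unfolding disjoint_family_on_def
      proof (intro ballI impI)
        fix s t assume st: "s \<in> {..<N}" "t \<in> {..<N}" "s \<noteq> t"
        have "Z s \<inter> Z t = {}" using Zdisj st by (auto simp: disjoint_family_on_def)
        moreover have "T s \<inter> T t = {}" using \<phi>inj A st by (fastforce simp: T_def)
        moreover have "Z s \<inter> T t = {}" "Z t \<inter> T s = {}" using ZT st by auto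
        ultimately show "(Z s \<union> T s) \<inter> (Z t \<union> T t) = {}" by blast
      qed
      show "\<nu> + sA A > 0" using \<nu>pos sA[of A] by simp
    qed
    then show ?thesis unfolding Wy_def using yeq by simp
  qed

  define B where "B A = {w \<in> space ?P. Wz w - Wy A w > real N * \<eta>}" for A
  have Bm: "B A \<in> sets ?P" if "A \<subseteq> Cm" for A
    unfolding B_def using Wym[OF that] by measurable
  have Bprob: "emeasure ?P (B A) \<le> ennreal (64 * (real n)\<^sup>2 / (real N * \<eta>\<^sup>2))" if A: "A \<subseteq> Cm" for A
  proof -
    note [measurable] = Wym[OF A]
    have Np: "real N * \<eta> > 0" using N \<eta> by simp
    \<comment> \<open>Chebyshev's inequality with
      \<open>(x - y)\<^sup>2 \<le> 2 * (x\<^sup>2 + y\<^sup>2)\<close>: two second moments of at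
      most \<open>16 * n\<^sup>2 * N\<close> each give the constant 64.\<close>
    define cc where "cc = 2 / (real N * \<eta>)\<^sup>2"
    have cc: "cc \<ge> 0" by (simp add: cc_def)
    have "emeasure ?P (B A) = (\<integral>\<^sup>+w. indicator (B A) w \<partial>?P)" using Bm[OF A] by simp
    also have "\<dots> \<le> (\<integral>\<^sup>+w. ennreal cc * (ennreal ((Wz w)\<^sup>2) + ennreal ((Wy A w)\<^sup>2)) \<partial>?P)"
    proof (rule nn_integral_mono)
      fix w
      show "indicator (B A) w \<le> ennreal cc * (ennreal ((Wz w)\<^sup>2) + ennreal ((Wy A w)\<^sup>2))"
      proof (cases "w \<in> B A")
        case True
        then have "real N * \<eta> < Wz w - Wy A w" by (simp add: B_def)
        then have "(real N * \<eta>)\<^sup>2 \<le> (Wz w - Wy A w)\<^sup>2" using Np by (intro power_mono) auto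
        also have "\<dots> \<le> 2 * ((Wz w)\<^sup>2 + (Wy A w)\<^sup>2)"
          using zero_le_power2[of "Wz w + Wy A w"] by (simp add: power2_eq_square algebra_simps)
        finally have "1 \<le> cc * ((Wz w)\<^sup>2 + (Wy A w)\<^sup>2)" using Np N \<eta> by (simp add: cc_def field_simps)
        then have "ennreal 1 \<le> ennreal (cc * ((Wz w)\<^sup>2 + (Wy A w)\<^sup>2))" by (rule ennreal_leI)
        then show ?thesis using True cc by (simp add: ennreal_mult)
      qed simp
    qed
    also have "\<dots> = ennreal cc * ((\<integral>\<^sup>+w. ennreal ((Wz w)\<^sup>2) \<partial>?P) + (\<integral>\<^sup>+w. ennreal ((Wy A w)\<^sup>2) \<partial>?P))"
      by (simp add: nn_integral_cmult nn_integral_add)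
    also have "\<dots> \<le> ennreal cc * (ennreal (16 * (real n)\<^sup>2 * real N) + ennreal (16 * (real n)\<^sup>2 * real N))"
      by (intro mult_left_mono add_mono Wz2 Wy2 A) simp
    also have "\<dots> = ennreal (cc * (32 * (real n)\<^sup>2 * real N))"
      using cc by (simp flip: ennreal_mult ennreal_plus)
    also have "cc * (32 * (real n)\<^sup>2 * real N) = 64 * (real n)\<^sup>2 / (real N * \<eta>\<^sup>2)"
      using N by (simp add: cc_def power2_eq_square)
    finally show ?thesis .
  qed

  define E2 where "E2 c = {w \<in> space ?P. Wz w - Wy (df c) w \<le> real N * \<eta> \<and> D c w \<le> D0 w}" for c
  have E2m: "E2 c \<in> sets ?P" if "c \<in> C" for c
  proof -
    have "df c \<subseteq> Cm" by (auto simp: df_def)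
    note [measurable] = Wym[OF this]
    have "{w \<in> space ?P. Wz w - Wy (df c) w \<le> real N * \<eta>} \<in> sets ?P" by measurable
    moreover have "E2 c = {w \<in> space ?P. Wz w - Wy (df c) w \<le> real N * \<eta>} \<inter> {w \<in> space ?P. D c w \<le> D0 w}"
      by (auto simp: E2_def)
    ultimately show ?thesis using Dset[OF that] by auto
  qed
  \<comment> \<open>Chernoff bound with parameter \<open>1 / \<nu>\<close>: the indicator is at most
    \<open>exp ((D0 - D) / \<nu>)\<close>. Integrating out the codewords of the candidate gives the
    power of \<open>1 / (1 + s c / \<nu>)\<close> and an exponential in the energy of
    \<open>yt\<close>. Together with \<open>exp (D0 / \<nu>)\<close> the latter is
    \<open>exp (Wz - Wy)\<close>, at most \<open>exp (N * \<eta>)\<close> where the energies are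
    typical.\<close>
  have pair: "emeasure ?P {w \<in> space ?P. Wz w - Wy (df c) w \<le> real N * \<eta> \<and> D c w \<le> D0 w} \<le> ennreal (exp (real N * \<eta>) * (1 / (1 + s c / \<nu>)) ^ N)"
    if c: "c \<in> C" for c
  proof -
    let ?A = "df c"
    let ?im = "(\<lambda>(k, t). \<phi> k (idx c k) t) ` (?A \<times> {..<N})"
    have A: "?A \<subseteq> Cm" by (auto simp: df_def)
    have finA: "finite ?A" using A Cm finite_subset by blast
    note [measurable] = Wym[OF A] Dm[OF c]
    define S where "S = {w. Wz w - Wy ?A w \<le> real N * \<eta>}"
    define G where "G w = indicator S w * ennreal (exp (D0 w / \<nu>))" for w
    have res: "X c0 t w + \<zeta> t w - X c t w = yt ?A t w - (\<Sum>k\<in>?A. \<alpha> k * w (\<phi> k (idx c k) t))" for t w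
    proof -
      have "X c0 t w - X c t w = (\<Sum>k\<in>Cm. \<alpha> k * w (\<phi> k (idx c0 k) t) - \<alpha> k * w (\<phi> k (idx c k) t))"
        by (simp add: X_def sum_subtractf)
      also have "\<dots> = (\<Sum>k\<in>?A. \<alpha> k * w (\<phi> k (idx c0 k) t) - \<alpha> k * w (\<phi> k (idx c k) t))"
        by (rule sum.mono_neutral_right[OF Cm A]) (auto simp: df_def)
      finally show ?thesis by (simp add: yt_def sum_subtractf algebra_simps)
    qed
    have zinv: "\<zeta> t w = \<zeta> t w'" if "t < N" and e: "\<And>i. i \<in> I - ?im \<Longrightarrow> w i = w' i" for t w w'
      unfolding \<zeta>_def using Z[OF that(1)] Z\<phi>[OF _ that(1)] A by (intro sum.cong refl arg_cong2[where f="(*)"] e) fastforce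
    have yinv: "yt ?A t w = yt ?A t w'" if t: "t < N" and e: "\<And>i. i \<in> I - ?im \<Longrightarrow> w i = w' i" for t w w'
    proof -
      have "w (\<phi> k (idx c0 k) t) = w' (\<phi> k (idx c0 k) t)" if k: "k \<in> ?A" for k
      proof (rule e)
        have "\<phi> k (idx c0 k) t \<noteq> \<phi> k' (idx c k') t'" if "k' \<in> ?A" for k' t'
        proof
          assume "\<phi> k (idx c0 k) t = \<phi> k' (idx c k') t'"
          then have "k = k' \<and> idx c0 k = idx c k'" using \<phi>inj[of k k'] k that A by blast
          then show False using that by (auto simp: df_def)
        qed
        then show "\<phi> k (idx c0 k) t \<in> I - ?im" using \<phi>1[of k t c0] k A t by auto
      qed
      then show ?thesis unfolding yt_def using zinv[OF t e] by simp
    qed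
    have "emeasure ?P {w \<in> space ?P. Wz w - Wy ?A w \<le> real N * \<eta> \<and> D c w \<le> D0 w} =
       (\<integral>\<^sup>+w. indicator {w \<in> space ?P. Wz w - Wy ?A w \<le> real N * \<eta> \<and> D c w \<le> D0 w} w \<partial>?P)"
      using E2m[OF c] unfolding E2_def by (rule nn_integral_indicator[symmetric])
    also have "\<dots> \<le> (\<integral>\<^sup>+w. G w * ennreal (\<Prod>t<N. exp (- (1 / \<nu>) * (cmod (yt ?A t w - (\<Sum>k\<in>?A. \<alpha> k * w (\<phi> k (idx c k) t))))\<^sup>2)) \<partial>?P)"
    proof (rule nn_integral_mono)
      fix w
      have pe: "(\<Prod>t<N. exp (- (1 / \<nu>) * (cmod (yt ?A t w - (\<Sum>k\<in>?A. \<alpha> k * w (\<phi> k (idx c k) t))))\<^sup>2)) = exp (- (D c w / \<nu>))"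
        unfolding res[symmetric] D_def by (simp add: exp_sum[symmetric] sum_negf sum_divide_distrib)
      show "indicator {w \<in> space ?P. Wz w - Wy ?A w \<le> real N * \<eta> \<and> D c w \<le> D0 w} w \<le>
          G w * ennreal (\<Prod>t<N. exp (- (1 / \<nu>) * (cmod (yt ?A t w - (\<Sum>k\<in>?A. \<alpha> k * w (\<phi> k (idx c k) t))))\<^sup>2))"
      proof (cases "Wz w - Wy ?A w \<le> real N * \<eta> \<and> D c w \<le> D0 w")
        case True
        then have "1 \<le> exp (D0 w / \<nu>) * exp (- (D c w / \<nu>))" using \<nu>pos by (simp add: mult_exp_exp divide_right_mono)
        then have "ennreal 1 \<le> ennreal (exp (D0 w / \<nu>) * exp (- (D c w / \<nu>)))" by (rule ennreal_leI)
        then show ?thesis using True unfolding pe G_def by (simp add: S_def indicator_def ennreal_mult)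
      next
        case False
        then have "w \<notin> {w \<in> space ?P. Wz w - Wy ?A w \<le> real N * \<eta> \<and> D c w \<le> D0 w}" by blast
        then show ?thesis by (subst indicator_simps(2)) (assumption, rule zero_le)
      qed
    qed
    also have "\<dots> = (\<integral>\<^sup>+w. G w * ennreal ((1 / (1 + (1 / \<nu>) * sA ?A))^N *
        (\<Prod>t<N. exp (- ((1 / \<nu>) / (1 + (1 / \<nu>) * sA ?A)) * (cmod (yt ?A t w))\<^sup>2))) \<partial>?P)"
      unfolding sA_def
    proof (rule gauss_codeword_eliminate[where v=v and \<phi>="\<lambda>k. \<phi> k (idx c k)", OF v I finA])
      show "inj_on (\<lambda>(k, t). \<phi> k (idx c k) t) (?A \<times> {..<N})"
        using \<phi>inj A by (fastforce simp: inj_on_def)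
      have "S \<inter> space ?P \<in> sets ?P"
      proof -
        have "S \<inter> space ?P = {w \<in> space ?P. Wz w - Wy ?A w \<le> real N * \<eta>}" by (auto simp: S_def)
        then show ?thesis by simp
      qed
      then have Sm: "(indicator S :: _ \<Rightarrow> ennreal) \<in> borel_measurable ?P" by (simp add: borel_measurable_indicator_iff)
      have "(\<lambda>w. exp (D0 w / \<nu>)) \<in> borel_measurable ?P" by measurable
      then show "G \<in> borel_measurable ?P" unfolding G_def
        by (intro borel_measurable_times_ennreal Sm measurable_compose[OF _ measurable_ennreal])
      show "yt ?A t \<in> borel_measurable ?P" if "t < N" for t by (rule ytm[OF A that])
    next
      fix w w' :: "'i \<Rightarrow> complex" assume e: "\<And>i. i \<in> I - ?im \<Longrightarrow> w i = w' i"
      have z: "t < N \<Longrightarrow> \<zeta> t w = \<zeta> t w'" for t by (rule zinv[OF _ e])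
      have y: "t < N \<Longrightarrow> yt ?A t w = yt ?A t w'" for t by (rule yinv[OF _ e])
      have "D0 w = D0 w'" unfolding D0_def using z by simp
      moreover have "Wz w = Wz w'" unfolding Wz_def using z by simp
      moreover have "Wy ?A w = Wy ?A w'" unfolding Wy_def using y by simp
      ultimately show "G w = G w'" by (simp add: G_def S_def indicator_def)
    next
      fix t and w w' :: "'i \<Rightarrow> complex" assume "t < N" and e: "\<And>i. i \<in> I - ?im \<Longrightarrow> w i = w' i"
      then show "yt ?A t w = yt ?A t w'" by (intro yinv)
    next
      fix k t assume "k \<in> ?A" "t < N"
      then show "\<phi> k (idx c k) t \<in> I \<and> v (\<phi> k (idx c k) t) = 1" using \<phi>1[of k t c] c A by auto
    qed (use \<nu>pos in auto)
    also have "\<dots> \<le> (\<integral>\<^sup>+w. ennreal (exp (real N * \<eta>) * (1 / (1 + s c / \<nu>)) ^ N) \<partial>?P)"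
    proof (rule nn_integral_mono)
      fix w
      have lam: "(1 / \<nu>) / (1 + (1 / \<nu>) * sA ?A) = 1 / (\<nu> + sA ?A)"
        using \<nu>pos sA[of ?A] by (simp add: field_simps)
      have pe: "(\<Prod>t<N. exp (- ((1 / \<nu>) / (1 + (1 / \<nu>) * sA ?A)) * (cmod (yt ?A t w))\<^sup>2)) = exp (- (\<Sum>t<N. (cmod (yt ?A t w))\<^sup>2 / (\<nu> + sA ?A)))"
        unfolding lam by (simp add: exp_sum[symmetric] sum_negf)
      have pos: "0 \<le> (1 / (1 + sA ?A / \<nu>)) ^ N" using \<nu>pos sA[of ?A] by simp
      show "G w * ennreal ((1 / (1 + (1 / \<nu>) * sA ?A))^N *
        (\<Prod>t<N. exp (- ((1 / \<nu>) / (1 + (1 / \<nu>) * sA ?A)) * (cmod (yt ?A t w))\<^sup>2))) \<le> ennreal (exp (real N * \<eta>) * (1 / (1 + s c / \<nu>)) ^ N)"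
      proof (cases "w \<in> S")
        case True
        have "Wz w - Wy ?A w = D0 w / \<nu> - (\<Sum>t<N. (cmod (yt ?A t w))\<^sup>2 / (\<nu> + sA ?A))"
          by (simp add: Wz_def Wy_def D0_def sum_subtractf sum_divide_distrib)
        then have le: "exp (D0 w / \<nu>) * exp (- (\<Sum>t<N. (cmod (yt ?A t w))\<^sup>2 / (\<nu> + sA ?A))) \<le> exp (real N * \<eta>)"
          using True by (simp add: S_def mult_exp_exp)
        have "exp (D0 w / \<nu>) * ((1 / (1 + (1 / \<nu>) * sA ?A))^N * exp (- (\<Sum>t<N. (cmod (yt ?A t w))\<^sup>2 / (\<nu> + sA ?A)))) =
           (exp (D0 w / \<nu>) * exp (- (\<Sum>t<N. (cmod (yt ?A t w))\<^sup>2 / (\<nu> + sA ?A)))) * (1 / (1 + sA ?A / \<nu>))^N"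
          by (simp add: mult_ac)
        also have "\<dots> \<le> exp (real N * \<eta>) * (1 / (1 + sA ?A / \<nu>))^N" by (rule mult_right_mono[OF le pos])
        finally show ?thesis unfolding pe G_def s_eq using True
          by (simp add: ennreal_leI flip: ennreal_mult')
      qed (simp add: G_def)
    qed
    also have "\<dots> = ennreal (exp (real N * \<eta>) * (1 / (1 + s c / \<nu>)) ^ N)" by (simp add: emeasure_space_1)
    finally show ?thesis .
  qed

  \<comment> \<open>The union runs over sets of components, not over candidates: the polynomially
    small probability of atypical energies is multiplied by a constant and not by an exponential
    number.\<close>
  define E1 where "E1 = (\<Union>A\<in>Pow Cm. B A)"
  have E1m: "E1 \<in> sets ?P" unfolding E1_def using Cm Bm by (intro sets.finite_UN) auto
  have sub: "E \<subseteq> E1 \<union> (\<Union>c\<in>C. E2 c)"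
  proof
    fix w assume "w \<in> E"
    then obtain c where c: "c \<in> C" "w \<in> space ?P" "D c w \<le> D0 w" unfolding Eeq by auto
    show "w \<in> E1 \<union> (\<Union>c\<in>C. E2 c)"
    proof (cases "Wz w - Wy (df c) w \<le> real N * \<eta>")
      case True then show ?thesis using c by (auto simp: E2_def)
    next
      case False
      then have "w \<in> B (df c)" using c by (simp add: B_def)
      moreover have "df c \<in> Pow Cm" by (auto simp: df_def)
      ultimately show ?thesis by (auto simp: E1_def)
    qed
  qed
  have nn: "0 \<le> exp (real N * \<eta>) * (1 / (1 + s c / \<nu>)) ^ N" for c
    using \<nu>pos sA[of "df c"] by (simp add: s_eq)
  have "emeasure ?P E \<le> emeasure ?P (E1 \<union> (\<Union>c\<in>C. E2 c))"
    using E1m E2m C by (intro emeasure_mono sub) auto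
  also have "\<dots> \<le> emeasure ?P E1 + emeasure ?P (\<Union>c\<in>C. E2 c)"
    using E1m E2m C by (intro emeasure_subadditive) auto
  also have "emeasure ?P E1 \<le> (\<Sum>A\<in>Pow Cm. emeasure ?P (B A))"
    unfolding E1_def using Cm Bm by (intro emeasure_subadditive_finite) auto
  also have "\<dots> \<le> (\<Sum>A\<in>Pow Cm. ennreal (64 * (real n)\<^sup>2 / (real N * \<eta>\<^sup>2)))"
    using Bprob by (intro sum_mono) auto
  also have "\<dots> = ennreal (\<Sum>A\<in>Pow Cm. 64 * (real n)\<^sup>2 / (real N * \<eta>\<^sup>2))"
    by (rule sum_ennreal) simp
  also have "(\<Sum>A\<in>Pow Cm. 64 * (real n)\<^sup>2 / (real N * \<eta>\<^sup>2)) = 2 ^ card Cm * (64 * (real n)\<^sup>2 / (real N * \<eta>\<^sup>2))"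
    using Cm by (simp add: card_Pow)
  also have "emeasure ?P (\<Union>c\<in>C. E2 c) \<le> (\<Sum>c\<in>C. emeasure ?P (E2 c))"
    using C E2m by (intro emeasure_subadditive_finite) auto
  also have "\<dots> \<le> (\<Sum>c\<in>C. ennreal (exp (real N * \<eta>) * (1 / (1 + s c / \<nu>)) ^ N))"
    unfolding E2_def by (intro sum_mono pair)
  also have "\<dots> = ennreal (\<Sum>c\<in>C. exp (real N * \<eta>) * (1 / (1 + s c / \<nu>)) ^ N)"
    by (rule sum_ennreal) (rule nn)
  finally show "emeasure ?P E \<le> ennreal (2 ^ card Cm * (64 * (real n)\<^sup>2 / (real N * \<eta>\<^sup>2)) + (\<Sum>c\<in>C. exp (real N * \<eta>) * (1 / (1 + s c / \<nu>)) ^ N))"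
    using nn by (simp add: add_mono sum_nonneg flip: ennreal_plus)
qed

section \<open>Superposition coding\<close>

type_synonym coord = "(nat \<times> nat \<times> nat \<times> nat) + (nat \<times> nat)"

text \<open>Coordinate \<open>Inl (i, l, n, t)\<close> is the \<open>t\<close>-th symbol of codeword \<open>n\<close> in layer \<open>l\<close> of user \<open>i\<close>
  (the users \<open>i \<ge> 1\<close> only have layer 0), \<open>Inr (i, t)\<close> is the noise at receiver \<open>i\<close>. User 0 sends the sum of
  its layers \<open>1, \<dots>, K + 1\<close>; layer \<open>l\<close> carries the message without its last \<open>kk l\<close> bits.
  Receiver \<open>i \<ge> 1\<close> decodes its own message jointly with the layers \<open>1, \<dots>, i\<close> and treats the others as noise.\<close>
locale superposition =
  fixes K N :: nat and n0 :: real and hdir hc :: "nat \<Rightarrow> complex"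
    and M :: "nat \<Rightarrow> nat" and kk :: "nat \<Rightarrow> nat" and al am :: "nat \<Rightarrow> real"
  assumes n0: "n0 > 0" and N: "N > 0" and M_pos: "\<And>i. i \<le> K \<Longrightarrow> M i \<ge> 1"
    and M0: "M 0 = 2 ^ kk 0" and kk_mono: "\<And>l l'. l \<le> l' \<Longrightarrow> kk l' \<le> kk l" and kk_last: "kk (Suc K) = 0"
begin

abbreviation "gain i \<equiv> (if i = 0 then hdir 0 else hc i)"
abbreviation "dl i \<equiv> (if i = 0 then Suc K else i)"

text \<open>A common bound on all codeword indices, so that the coordinates of all codebooks form
  one rectangular index set.\<close>

definition Mx :: nat where "Mx = (\<Sum>i\<le>K. M i)"
definition Jc :: "coord set" where "Jc = Inl ` ({..K} \<times> {..Suc K} \<times> {..<Mx} \<times> {..<N})"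
definition Jn :: "coord set" where "Jn = Inr ` ({..K} \<times> {..<N})"
definition vv :: "coord \<Rightarrow> real" where "vv j = (case j of Inl _ \<Rightarrow> 1 | Inr _ \<Rightarrow> n0)"

abbreviation "\<Omega> \<equiv> PiM (Jc \<union> Jn) (\<lambda>j. cgauss (vv j))"
abbreviation "\<Omega>c \<equiv> PiM Jc (\<lambda>j. cgauss (vv j))"
abbreviation "\<Omega>n \<equiv> PiM Jn (\<lambda>j. cgauss (vv j))"

definition cenc :: "(coord \<Rightarrow> complex) \<Rightarrow> nat \<Rightarrow> nat \<Rightarrow> nat \<Rightarrow> complex" where
  "cenc x i m t = (if i = 0 then (\<Sum>l\<in>{1..Suc K}. of_real (al l) * x (Inl (0, l, m div 2 ^ kk l, t)))
     else of_real (am i) * x (Inl (i, 0, m, t)))"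

text \<open>Component 0 is the own message of a receiver \<open>i \<ge> 1\<close>, component
  \<open>k \<ge> 1\<close> is layer \<open>k\<close> of user 0; receiver 0 has layers only.\<close>

definition Cm :: "nat \<Rightarrow> nat set" where "Cm i = (if i = 0 then {1..Suc K} else insert 0 {1..i})"
definition cf :: "nat \<Rightarrow> nat \<Rightarrow> complex" where "cf i k = (if k = 0 then hdir i * of_real (am i) else gain i * of_real (al k))"
definition ph :: "nat \<Rightarrow> nat \<Rightarrow> nat \<Rightarrow> nat \<Rightarrow> coord" where "ph i k n t = (if k = 0 then Inl (i, 0, n, t) else Inl (0, k, n, t))"
definition idx :: "nat \<times> nat \<Rightarrow> nat \<Rightarrow> nat" where "idx c k = (if k = 0 then fst c else snd c div 2 ^ kk k)"
text \<open>A receiver that decodes the layers up to \<open>dl i\<close> cannot tell apart messages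
  of user 0 that differ in the last \<open>kk (dl i)\<close> bits only; each such class is
  represented by its multiple of \<open>2 ^ kk (dl i)\<close>. For receiver 0 the first component is
  a dummy and \<open>kk (Suc K) = 0\<close> admits every message.\<close>

definition Cand :: "nat \<Rightarrow> (nat \<times> nat) set" where
  "Cand i = (if i = 0 then {0} else {..<M i}) \<times> {u. u < M 0 \<and> 2 ^ kk (dl i) dvd u}"
definition outp :: "nat \<Rightarrow> nat \<times> nat \<Rightarrow> nat" where "outp i c = (if i = 0 then snd c else fst c)"
definition tru :: "nat \<Rightarrow> (nat \<Rightarrow> nat) \<Rightarrow> nat \<times> nat" where
  "tru i w = (if i = 0 then 0 else w i, w 0 div 2 ^ kk (dl i) * 2 ^ kk (dl i))"
definition XX :: "nat \<Rightarrow> nat \<times> nat \<Rightarrow> nat \<Rightarrow> (coord \<Rightarrow> complex) \<Rightarrow> complex" where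
  "XX i c t x = (\<Sum>k\<in>Cm i. cf i k * x (ph i k (idx c k) t))"
definition ZZ :: "nat \<Rightarrow> (nat \<Rightarrow> nat) \<Rightarrow> nat \<Rightarrow> coord set" where
  "ZZ i w t = insert (Inr (i, t)) ((\<lambda>l. Inl (0, l, w 0 div 2 ^ kk l, t)) ` {Suc (dl i)..Suc K})"
definition bb :: "nat \<Rightarrow> coord \<Rightarrow> complex" where
  "bb i j = (case j of Inr _ \<Rightarrow> 1 | Inl (a, l, n, t) \<Rightarrow> gain i * of_real (al l))"
definition zt :: "nat \<Rightarrow> (nat \<Rightarrow> nat) \<Rightarrow> nat \<Rightarrow> (coord \<Rightarrow> complex) \<Rightarrow> complex" where
  "zt i w t x = (\<Sum>j\<in>ZZ i w t. bb i j * x j)"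
definition Dist :: "(coord \<Rightarrow> complex) \<Rightarrow> nat \<Rightarrow> nat \<times> nat \<Rightarrow> (nat \<Rightarrow> complex) \<Rightarrow> real" where
  "Dist x i c y = (\<Sum>t<N. (cmod (y t - XX i c t x))\<^sup>2)"
text \<open>Taking the least output among all minimizers breaks ties canonically, and measurability
  reduces to finitely many comparisons of distances.\<close>

definition cdec :: "(coord \<Rightarrow> complex) \<Rightarrow> nat \<Rightarrow> (nat \<Rightarrow> complex) \<Rightarrow> nat" where
  "cdec x i y = (LEAST m. \<exists>c\<in>Cand i. outp i c = m \<and> (\<forall>c'\<in>Cand i. Dist x i c y \<le> Dist x i c' y))"

abbreviation "WW \<equiv> PiE {..K} (\<lambda>i. {..<M i})"

section \<open>Received signals and error events in terms of codebook and noise coordinates\<close>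

lemma vv_pos: "vv j > 0" using n0 by (simp add: vv_def split: sum.split)

lemma finite_J: "finite Jc" "finite Jn" "finite (Jc \<union> Jn)" by (auto simp: Jc_def Jn_def)

lemma M_le_Mx: "i \<le> K \<Longrightarrow> M i \<le> Mx"
  unfolding Mx_def by (intro member_le_sum) auto

lemma finite_Cand: "finite (Cand i)"
  unfolding Cand_def by auto

lemma finite_Cm: "finite (Cm i)" by (simp add: Cm_def)

lemma tru_Cand: "i \<le> K \<Longrightarrow> w \<in> WW \<Longrightarrow> tru i w \<in> Cand i"
proof -
  assume i: "i \<le> K" and w: "w \<in> WW"
  have "w 0 div 2 ^ kk (dl i) * 2 ^ kk (dl i) \<le> w 0" by (rule div_times_less_eq_dividend)
  also have "w 0 < M 0" using w by (simp add: PiE_iff)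
  finally show ?thesis using i w by (simp add: tru_def Cand_def PiE_iff)
qed

lemma idx_lt_Mx: "i \<le> K \<Longrightarrow> c \<in> Cand i \<Longrightarrow> idx c k < Mx"
proof -
  assume i: "i \<le> K" and c: "c \<in> Cand i"
  have "snd c < Mx" "fst c < Mx" using c M_le_Mx[of 0] M_le_Mx[OF i] M_pos[of 0] by (auto simp: Cand_def split: if_splits)
  then show ?thesis using le_less_trans[OF div_le_dividend[of "snd c" "2 ^ kk k"]] by (simp add: idx_def)
qed

lemma ph_Jc: "i \<le> K \<Longrightarrow> k \<in> Cm i \<Longrightarrow> n < Mx \<Longrightarrow> t < N \<Longrightarrow> ph i k n t \<in> Jc"
  by (cases "k = 0") (auto simp: ph_def Jc_def Cm_def split: if_splits)

text \<open>Layers up to \<open>dl i\<close> ignore at least the last \<open>kk (dl i)\<close> bits,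
  since \<open>kk\<close> decreases, so clearing these bits does not change the selected
  codewords.\<close>

lemma idx_tru: "k \<le> dl i \<Longrightarrow> k \<noteq> 0 \<Longrightarrow> idx (tru i w) k = w 0 div 2 ^ kk k"
proof -
  assume k: "k \<le> dl i" "k \<noteq> 0"
  define a where "a = kk (dl i)"
  obtain d where d: "kk k = a + d" using kk_mono[OF k(1)] unfolding a_def by (metis le_Suc_ex)
  have "w 0 div 2 ^ a * 2 ^ a div 2 ^ (a + d) = w 0 div 2 ^ (a + d)"
    by (simp add: power_add div_mult2_eq)
  then show ?thesis using k d by (simp add: idx_def tru_def a_def)
qed

text \<open>Separates the components to be decoded from the effective noise \<open>zt\<close>,
  thermal noise plus undecoded layers. In the random codebook the undecoded layers are Gaussian, so
  over codebook and noise jointly \<open>zt\<close> is genuine Gaussian noise.\<close>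

lemma rx_eq:
  assumes i: "i \<le> K" and t: "t < N"
  shows "rx N hdir hc (cenc x) w (\<lambda>p. x (Inr p)) i t = XX i (tru i w) t x + zt i w t x"
proof -
  have zt: "zt i w t x = x (Inr (i, t)) + (\<Sum>l\<in>{Suc (dl i)..Suc K}. gain i * of_real (al l) * x (Inl (0, l, w 0 div 2 ^ kk l, t)))"
  proof -
    have inj: "inj_on (\<lambda>l. Inl (0, l, w 0 div 2 ^ kk l, t) :: coord) {Suc (dl i)..Suc K}" by (auto simp: inj_on_def)
    have "zt i w t x = bb i (Inr (i, t)) * x (Inr (i, t)) + (\<Sum>j\<in>(\<lambda>l. Inl (0, l, w 0 div 2 ^ kk l, t)) ` {Suc (dl i)..Suc K}. bb i j * x j)"
      unfolding zt_def ZZ_def by (subst sum.insert) auto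
    also have "(\<Sum>j\<in>(\<lambda>l. Inl (0, l, w 0 div 2 ^ kk l, t)) ` {Suc (dl i)..Suc K}. bb i j * x j) =
        (\<Sum>l\<in>{Suc (dl i)..Suc K}. gain i * of_real (al l) * x (Inl (0, l, w 0 div 2 ^ kk l, t)))"
      by (subst sum.reindex[OF inj]) (simp add: bb_def)
    finally show ?thesis by (simp add: bb_def)
  qed
  define f where "f l = of_real (al l) * x (Inl (0, l, w 0 div 2 ^ kk l, t))" for l
  show ?thesis
  proof (cases "i = 0")
    case True
    have "XX 0 (tru 0 w) t x = hdir 0 * (\<Sum>l\<in>{1..Suc K}. f l)"
      unfolding XX_def sum_distrib_left Cm_def by (rule sum.cong) (auto simp: cf_def ph_def f_def idx_tru mult.assoc)
    then show ?thesis using True t zt by (simp add: rx_def cenc_def f_def)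
  next
    case False
    have "XX i (tru i w) t x = cf i 0 * x (ph i 0 (idx (tru i w) 0) t) + (\<Sum>k\<in>{1..i}. cf i k * x (ph i k (idx (tru i w) k) t))"
      unfolding XX_def Cm_def using False by (simp add: sum.insert)
    also have "(\<Sum>k\<in>{1..i}. cf i k * x (ph i k (idx (tru i w) k) t)) = hc i * (\<Sum>k\<in>{1..i}. f k)"
      unfolding sum_distrib_left using False by (intro sum.cong) (auto simp: cf_def ph_def f_def idx_tru mult.assoc)
    also have "cf i 0 * x (ph i 0 (idx (tru i w) 0) t) = hdir i * (of_real (am i) * x (Inl (i, 0, w i, t)))"
      using False by (simp add: cf_def ph_def idx_def tru_def mult.assoc)
    finally have X: "XX i (tru i w) t x = hdir i * (of_real (am i) * x (Inl (i, 0, w i, t))) + hc i * (\<Sum>k\<in>{1..i}. f k)" .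
    have Z: "zt i w t x = x (Inr (i, t)) + hc i * (\<Sum>l\<in>{Suc i..Suc K}. f l)"
      using False zt by (simp add: f_def sum_distrib_left mult.assoc del: sum.cl_ivl_Suc)
    have "{1..Suc K} = {1..i} \<union> {Suc i..Suc K}" using i by auto
    then have "(\<Sum>l\<in>{1..Suc K}. f l) = (\<Sum>l\<in>{1..i}. f l) + (\<Sum>l\<in>{Suc i..Suc K}. f l)"
      by (simp only:) (rule sum.union_disjoint, auto)
    moreover have "rx N hdir hc (cenc x) w (\<lambda>p. x (Inr p)) i t =
        hdir i * (of_real (am i) * x (Inl (i, 0, w i, t))) + hc i * (\<Sum>l\<in>{1..Suc K}. f l) + x (Inr (i, t))"
      using False t by (simp add: rx_def cenc_def f_def del: sum.cl_ivl_Suc)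
    ultimately show ?thesis unfolding X Z by (simp only: distrib_left add_ac)
  qed
qed

text \<open>Free of the decoder, with ties counted as errors: it contains the decoding error and has
  the form that \<open>gauss_receiver_error\<close> bounds.\<close>

definition ev :: "nat \<Rightarrow> (nat \<Rightarrow> nat) \<Rightarrow> (coord \<Rightarrow> complex) set" where
  "ev i w = {x \<in> space \<Omega>. \<exists>c\<in>{c \<in> Cand i. outp i c \<noteq> w i}.
      (\<Sum>t<N. (cmod (XX i (tru i w) t x + zt i w t x - XX i c t x))\<^sup>2) \<le> (\<Sum>t<N. (cmod (zt i w t x))\<^sup>2)}"

lemma error_imp_ev:
  assumes i: "i \<le> K" and w: "w \<in> WW" and x: "x \<in> space \<Omega>"
    and err: "cdec x i (rx N hdir hc (cenc x) w (\<lambda>p. x (Inr p)) i) \<noteq> w i"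
  shows "x \<in> ev i w"
proof -
  define y where "y = rx N hdir hc (cenc x) w (\<lambda>p. x (Inr p)) i"
  have y: "y t = XX i (tru i w) t x + zt i w t x" if "t < N" for t
    unfolding y_def by (rule rx_eq[OF i that])
  have ne: "Cand i \<noteq> {}" using tru_Cand[OF i w] by auto
  let ?Q = "\<lambda>m. \<exists>c\<in>Cand i. outp i c = m \<and> (\<forall>c'\<in>Cand i. Dist x i c y \<le> Dist x i c' y)"
  obtain c where "c \<in> Cand i" "\<forall>c'\<in>Cand i. Dist x i c y \<le> Dist x i c' y"
    using arg_min_if_finite[OF finite_Cand ne, of "\<lambda>c. Dist x i c y"] not_le_imp_less by blast
  then have "?Q (outp i c)" by blast
  then have "?Q (LEAST m. ?Q m)" by (rule LeastI[of ?Q])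
  then have "?Q (cdec x i y)" unfolding cdec_def .
  then obtain c where c: "c \<in> Cand i" "outp i c = cdec x i y" "\<forall>c'\<in>Cand i. Dist x i c y \<le> Dist x i c' y" by blast
  have "Dist x i c y \<le> Dist x i (tru i w) y" using c tru_Cand[OF i w] by blast
  then have "(\<Sum>t<N. (cmod (XX i (tru i w) t x + zt i w t x - XX i c t x))\<^sup>2) \<le> (\<Sum>t<N. (cmod (zt i w t x))\<^sup>2)"
    unfolding Dist_def by (simp add: y)
  moreover have "outp i c \<noteq> w i" using c(2) err by (simp add: y_def)
  ultimately show ?thesis unfolding ev_def using c(1) x by (intro CollectI conjI bexI[of _ c]) auto
qed

lemma cdec_cong:
  assumes "\<And>j. j \<in> Jc \<Longrightarrow> x j = x' j" and i: "i \<le> K"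
  shows "cdec x i = cdec x' i"
proof -
  have "XX i c t x = XX i c t x'" if "c \<in> Cand i" "t < N" for c t
    unfolding XX_def
    by (intro sum.cong refl arg_cong2[where f="(*)"] assms(1) ph_Jc[OF i] idx_lt_Mx[OF i] that)
  then have D: "Dist x i c y = Dist x' i c y" if "c \<in> Cand i" for c y using that by (simp add: Dist_def)
  show ?thesis unfolding cdec_def by (rule ext, rule arg_cong[where f=Least]) (use D in auto)
qed

lemma cenc_cong:
  assumes "\<And>j. j \<in> Jc \<Longrightarrow> x j = x' j" and i: "i \<le> K" "m < M i" "t < N"
  shows "cenc x i m t = cenc x' i m t"
proof -
  have mM: "m < Mx" using M_le_Mx[OF i(1)] i by simp
  have "Inl (0, l, m div 2 ^ kk l, t) \<in> Jc" if "l \<in> {1..Suc K}" for l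
    using that i mM le_less_trans[OF div_le_dividend mM] by (auto simp: Jc_def)
  moreover have "Inl (i, 0, m, t) \<in> Jc" using i mM by (auto simp: Jc_def)
  ultimately show ?thesis unfolding cenc_def using assms(1) by auto
qed

lemma cdec_measurable: "cdec x i \<in> measurable (out_space N) (count_space UNIV)"
proof -
  have D: "Dist x i c \<in> borel_measurable (out_space N)" for c
    unfolding Dist_def out_space_def by measurable
  have fin: "finite (Cand i)" by (rule finite_Cand)
  have 1: "Measurable.pred (out_space N) (\<lambda>y. Dist x i c y \<le> Dist x i c' y)" for c c'
    using borel_measurable_le[OF D D] by (simp only: pred_def)
  have 2: "Measurable.pred (out_space N) (\<lambda>y. \<forall>c'\<in>Cand i. Dist x i c y \<le> Dist x i c' y)" for c
    by (rule pred_intros_finite(3)[OF fin 1])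
  have 3: "Measurable.pred (out_space N) (\<lambda>y. outp i c = m \<and> (\<forall>c'\<in>Cand i. Dist x i c y \<le> Dist x i c' y))" for c m
  proof (cases "outp i c = m")
    case True then show ?thesis using 2 by (simp only: simp_thms)
  qed simp
  have "Measurable.pred (out_space N) (\<lambda>y. \<exists>c\<in>Cand i. outp i c = m \<and> (\<forall>c'\<in>Cand i. Dist x i c y \<le> Dist x i c' y))" for m
    by (rule pred_intros_finite(4)[OF fin 3])
  then show ?thesis unfolding cdec_def by (rule measurable_Least)
qed

section \<open>Counting wrong candidates by their level of agreement\<close>

text \<open>\<open>S i l\<close> is the power at receiver \<open>i\<close> of a wrong candidate agreeing with the truth in the layers up to \<open>l\<close>.\<close>
definition S :: "nat \<Rightarrow> nat \<Rightarrow> real" where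
  "S i l = (if i = 0 then 0 else (cmod (hdir i) * am i)\<^sup>2) + (cmod (gain i))\<^sup>2 * (\<Sum>k\<in>{Suc l..dl i}. (al k)\<^sup>2)"
definition nu :: "nat \<Rightarrow> real" where
  "nu i = n0 + (cmod (gain i))\<^sup>2 * (\<Sum>k\<in>{Suc (dl i)..Suc K}. (al k)\<^sup>2)"
text \<open>A bound on the number of erroneous candidates whose level of agreement is
  \<open>l\<close>. The subtracted 1 removes the true message; for \<open>i \<ge> 1\<close> this is
  the own message, because wrong layers with a right own message are no error. The subtraction
  matters when only one message is left: the exponential estimate need not be small there.\<close>

definition wrong :: "nat \<Rightarrow> nat \<Rightarrow> real" where
  "wrong i l = (if i = 0 then (if l = Suc K then 0 else 2 ^ kk l - 1) else (real (M i) - 1) * 2 ^ (kk l - kk i))"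
text \<open>The first term accounts for atypical energies, with at most \<open>2 ^ (K + 2)\<close>
  sets of components and at most \<open>2 * K + 4\<close> Gaussian coordinates per time; the second
  is the union bound over levels.\<close>

definition beta :: "nat \<Rightarrow> real \<Rightarrow> real" where
  "beta i \<eta> = 2 ^ (K + 2) * (64 * (real (2 * K + 4))\<^sup>2 / (real N * \<eta>\<^sup>2)) +
     (\<Sum>l\<le>dl i. wrong i l * (exp (real N * \<eta>) * (1 / (1 + S i l / nu i)) ^ N))"

lemma nu_pos: "nu i > 0"
  using n0 by (simp add: nu_def add_pos_nonneg sum_nonneg)

lemma S_nonneg: "S i l \<ge> 0" by (simp add: S_def sum_nonneg)

text \<open>Writing \<open>u = n * 2 ^ a\<close> with \<open>a = kk (dl i)\<close>, a prescribed
  prefix confines \<open>n\<close> to a block of \<open>2 ^ (kk l - a)\<close> consecutive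
  integers.\<close>

lemma card_agree:
  assumes i: "i \<le> K" and l: "l \<le> dl i"
  shows "card {u. u < M 0 \<and> 2 ^ kk (dl i) dvd u \<and> u div 2 ^ kk l = q} \<le> 2 ^ (kk l - kk (dl i))"
proof -
  define a where "a = kk (dl i)"
  define d where "d = kk l - a"
  have kl: "kk l = a + d" using kk_mono[OF l] by (simp add: a_def d_def)
  have "{u. u < M 0 \<and> 2 ^ a dvd u \<and> u div 2 ^ kk l = q} \<subseteq> (\<lambda>n. n * 2 ^ a) ` {q * 2 ^ d..<(q + 1) * 2 ^ d}"
  proof
    fix u assume "u \<in> {u. u < M 0 \<and> 2 ^ a dvd u \<and> u div 2 ^ kk l = q}"
    then obtain n where n: "u = n * 2 ^ a" and q: "u div 2 ^ kk l = q" by (auto elim: dvdE simp: mult.commute)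
    have "n div 2 ^ d = q" using q unfolding n kl by (simp add: power_add div_mult2_eq)
    then have "n = q * 2 ^ d + n mod 2 ^ d" using div_mult_mod_eq[of n "2 ^ d"] by simp
    moreover have "n mod 2 ^ d < 2 ^ d" by simp
    ultimately have "n \<in> {q * 2 ^ d..<(q + 1) * 2 ^ d}" unfolding atLeastLessThan_iff distrib_right by linarith
    then show "u \<in> (\<lambda>n. n * 2 ^ a) ` {q * 2 ^ d..<(q + 1) * 2 ^ d}" using n by blast
  qed
  then have "card {u. u < M 0 \<and> 2 ^ a dvd u \<and> u div 2 ^ kk l = q} \<le> card {q * 2 ^ d..<(q + 1) * 2 ^ d}"
    by (intro surj_card_le) auto
  also have "\<dots> = 2 ^ d" by simp
  finally show ?thesis by (simp add: a_def d_def)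
qed

text \<open>Candidates are grouped by the highest level \<open>lv\<close> at which their prefix
  agrees with the truth. All decoded layers above it are wrong, so the power of the difference is at
  least \<open>S i (lv c)\<close>, and \<open>g\<close> decreases; it remains to count each
  group.\<close>

lemma sum_wrong:
  assumes i: "i \<le> K" and w: "w \<in> WW" and g: "\<And>x y. 0 \<le> x \<Longrightarrow> x \<le> y \<Longrightarrow> g y \<le> g x" "\<And>x. 0 \<le> x \<Longrightarrow> 0 \<le> (g x :: real)"
  shows "(\<Sum>c\<in>{c \<in> Cand i. outp i c \<noteq> w i}. g (\<Sum>k | k \<in> Cm i \<and> idx c k \<noteq> idx (tru i w) k. (cmod (cf i k))\<^sup>2)) \<le>
    (\<Sum>l\<le>dl i. wrong i l * g (S i l))"
proof -
  let ?C = "{c \<in> Cand i. outp i c \<noteq> w i}"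
  define lv where "lv c = Max {l \<in> {..dl i}. snd c div 2 ^ kk l = w 0 div 2 ^ kk l}" for c :: "nat \<times> nat"
  have w0: "w 0 < M 0" "w i < M i" using w i by (auto simp: PiE_iff)
  have lv: "lv c \<le> dl i" "snd c div 2 ^ kk (lv c) = w 0 div 2 ^ kk (lv c)"
    "\<And>k. lv c < k \<Longrightarrow> k \<le> dl i \<Longrightarrow> snd c div 2 ^ kk k \<noteq> w 0 div 2 ^ kk k" if "c \<in> ?C" for c
  proof -
    let ?L = "{l \<in> {..dl i}. snd c div 2 ^ kk l = w 0 div 2 ^ kk l}"
    have "snd c < M 0" using that by (auto simp: Cand_def)
    \<comment> \<open>Level 0 always agrees: all messages are below \<open>2 ^ kk 0\<close> and have
      prefix 0. So the maximum is taken over a nonempty set.\<close>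
    then have "0 \<in> ?L" using w0 by (simp add: M0)
    then have "lv c \<in> ?L" unfolding lv_def by (intro Max_in) auto
    then show "lv c \<le> dl i" "snd c div 2 ^ kk (lv c) = w 0 div 2 ^ kk (lv c)" by auto
    show "snd c div 2 ^ kk k \<noteq> w 0 div 2 ^ kk k" if "lv c < k" "k \<le> dl i" for k
    proof
      assume "snd c div 2 ^ kk k = w 0 div 2 ^ kk k"
      then have "k \<in> ?L" using that by simp
      then have "k \<le> lv c" unfolding lv_def by (intro Max_ge) auto
      then show False using that by simp
    qed
  qed
  have finC: "finite ?C" using finite_Cand by auto
  let ?s = "\<lambda>c. \<Sum>k | k \<in> Cm i \<and> idx c k \<noteq> idx (tru i w) k. (cmod (cf i k))\<^sup>2"
  have s_ge: "S i (lv c) \<le> ?s c" if c: "c \<in> ?C" for c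
  proof -
    let ?B = "(if i = 0 then {} else {0}) \<union> {Suc (lv c)..dl i}"
    have "S i (lv c) = (\<Sum>k\<in>?B. (cmod (cf i k))\<^sup>2)"
    proof -
      have "(\<Sum>k\<in>?B. (cmod (cf i k))\<^sup>2) = (\<Sum>k\<in>(if i = 0 then {} else {0}). (cmod (cf i k))\<^sup>2) + (\<Sum>k\<in>{Suc (lv c)..dl i}. (cmod (cf i k))\<^sup>2)"
        by (rule sum.union_disjoint) auto
      also have "(\<Sum>k\<in>{Suc (lv c)..dl i}. (cmod (cf i k))\<^sup>2) = (cmod (gain i))\<^sup>2 * (\<Sum>k\<in>{Suc (lv c)..dl i}. (al k)\<^sup>2)"
        unfolding sum_distrib_left by (rule sum.cong) (auto simp: cf_def norm_mult power_mult_distrib)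
      finally show ?thesis by (simp add: S_def cf_def norm_mult power_mult_distrib)
    qed
    also have "\<dots> \<le> ?s c"
    proof (rule sum_mono2)
      show "finite {k. k \<in> Cm i \<and> idx c k \<noteq> idx (tru i w) k}" using finite_Cm by auto
      show "?B \<subseteq> {k. k \<in> Cm i \<and> idx c k \<noteq> idx (tru i w) k}"
      proof
        fix k assume k: "k \<in> ?B"
        show "k \<in> {k. k \<in> Cm i \<and> idx c k \<noteq> idx (tru i w) k}"
        proof (cases "k = 0")
          case True
          then have "i \<noteq> 0" using k by (auto split: if_splits)
          then show ?thesis using True c by (simp add: Cm_def idx_def tru_def outp_def)
        next
          case False
          then have k': "lv c < k" "k \<le> dl i" using k by (auto split: if_splits)
          have "idx (tru i w) k = w 0 div 2 ^ kk k" by (rule idx_tru[OF k'(2) False])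
          moreover have "idx c k = snd c div 2 ^ kk k" using False by (simp add: idx_def)
          ultimately show ?thesis using lv(3)[OF c k'] k' False by (auto simp: Cm_def)
        qed
      qed
    qed simp
    finally show ?thesis .
  qed
  have "(\<Sum>c\<in>?C. g (?s c)) \<le> (\<Sum>c\<in>?C. g (S i (lv c)))"
    by (intro sum_mono g(1) s_ge S_nonneg)
  also have "\<dots> = (\<Sum>l\<le>dl i. \<Sum>c | c \<in> ?C \<and> lv c = l. g (S i (lv c)))"
    by (rule sum.group[symmetric]) (use finC lv(1) in auto)
  also have "\<dots> = (\<Sum>l\<le>dl i. real (card {c. c \<in> ?C \<and> lv c = l}) * g (S i l))"
    by (intro sum.cong refl) simp
  also have "\<dots> \<le> (\<Sum>l\<le>dl i. wrong i l * g (S i l))"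
  proof (intro sum_mono mult_right_mono g(2) S_nonneg)
    fix l assume "l \<in> {..dl i}"
    then have l: "l \<le> dl i" by simp
    let ?U = "{u. u < M 0 \<and> 2 ^ kk (dl i) dvd u \<and> u div 2 ^ kk l = w 0 div 2 ^ kk l}"
    have finU: "finite ?U" by auto
    have cU: "real (card ?U) \<le> 2 ^ (kk l - kk (dl i))"
      using of_nat_mono[OF card_agree[OF i l, of "w 0 div 2 ^ kk l"], where 'a=real] by (simp only: of_nat_power of_nat_numeral)
    show "real (card {c. c \<in> ?C \<and> lv c = l}) \<le> wrong i l"
    proof (cases "i = 0")
      case False
      have "card {c. c \<in> ?C \<and> lv c = l} \<le> card (({..<M i} - {w i}) \<times> ?U)"
        by (rule card_mono) (use lv(2) False in \<open>auto simp: Cand_def outp_def\<close>)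
      also have "\<dots> = (M i - 1) * card ?U" using w0 by (simp add: card_cartesian_product)
      finally have "real (card {c. c \<in> ?C \<and> lv c = l}) \<le> real ((M i - 1) * card ?U)" by (simp only: of_nat_le_iff)
      also have "\<dots> = (real (M i) - 1) * real (card ?U)" using M_pos[OF i] by (simp add: of_nat_diff)
      also have "\<dots> \<le> (real (M i) - 1) * 2 ^ (kk l - kk (dl i))"
        using M_pos[OF i] by (intro mult_left_mono cU) auto
      finally show ?thesis using False by (simp add: wrong_def)
    next
      case True
      show ?thesis
      proof (cases "l = Suc K")
        case l: True
        have "{c. c \<in> ?C \<and> lv c = l} = {}"
          using lv(2) True l kk_last by (fastforce simp: outp_def)
        then have "real (card {c. c \<in> ?C \<and> lv c = l}) = 0" by (simp only: card.empty of_nat_0)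
        then show ?thesis using True l by (simp add: wrong_def)
      next
        case False
        have "card {c. c \<in> ?C \<and> lv c = l} \<le> card ({0::nat} \<times> (?U - {w 0}))"
          by (rule card_mono) (use lv(2) True in \<open>auto simp: Cand_def outp_def\<close>)
        also have "\<dots> = card ?U - 1"
          using w0 True kk_last by (subst card_cartesian_product) (simp add: card_Diff_singleton)
        finally have "real (card {c. c \<in> ?C \<and> lv c = l}) \<le> real (card ?U - 1)" by simp
        also have "\<dots> = real (card ?U) - 1"
        proof -
          have "w 0 \<in> ?U" using w0 True kk_last by simp
          then have "?U \<noteq> {}" by blast
          then have "card ?U > 0" using finU by (simp only: card_gt_0_iff simp_thms)
          then show ?thesis by (simp add: of_nat_diff)
        qed
        also have "\<dots> \<le> 2 ^ kk l - 1" using cU True kk_last by simp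
        finally show ?thesis using True False by (simp add: wrong_def)
      qed
    qed
  qed
  finally show ?thesis .
qed

lemma ev_bound:
  assumes i: "i \<le> K" and w: "w \<in> WW" and \<eta>: "\<eta> > 0"
  shows "ev i w \<in> sets \<Omega>" and "emeasure \<Omega> (ev i w) \<le> ennreal (beta i \<eta>)"
proof -
  let ?C = "{c \<in> Cand i. outp i c \<noteq> w i}"
  have w0: "w 0 < Mx" using w M_le_Mx[of 0] by (auto simp: PiE_iff intro: less_le_trans)
  have phJ: "ph i k n t \<in> Jc \<union> Jn \<and> vv (ph i k n t) = 1" if "k \<in> Cm i" "n < Mx" "t < N" for k n t
    using ph_Jc[OF i that] by (simp add: ph_def vv_def)
  have Zin: "ZZ i w t \<subseteq> Jc \<union> Jn" if "t < N" for t
    using that i w0 by (auto simp: ZZ_def Jc_def Jn_def intro: le_less_trans[OF div_le_dividend])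
  have finZ: "finite (ZZ i w t)" for t by (simp add: ZZ_def)
  have inj: "inj_on (\<lambda>l. Inl (0, l, w 0 div 2 ^ kk l, t) :: coord) {Suc (dl i)..Suc K}" for t by (auto simp: inj_on_def)
  have nu: "(\<Sum>j\<in>ZZ i w t. (cmod (bb i j))\<^sup>2 * vv j) = nu i" for t
  proof -
    have "(\<Sum>j\<in>ZZ i w t. (cmod (bb i j))\<^sup>2 * vv j) = (cmod (bb i (Inr (i, t))))\<^sup>2 * vv (Inr (i, t)) +
        (\<Sum>j\<in>(\<lambda>l. Inl (0, l, w 0 div 2 ^ kk l, t)) ` {Suc (dl i)..Suc K}. (cmod (bb i j))\<^sup>2 * vv j)"
      unfolding ZZ_def by (subst sum.insert) auto
    also have "(\<Sum>j\<in>(\<lambda>l. Inl (0, l, w 0 div 2 ^ kk l, t)) ` {Suc (dl i)..Suc K}. (cmod (bb i j))\<^sup>2 * vv j) =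
        (\<Sum>l\<in>{Suc (dl i)..Suc K}. (cmod (gain i))\<^sup>2 * (al l)\<^sup>2)"
      by (subst sum.reindex[OF inj]) (simp add: bb_def vv_def norm_mult power_mult_distrib)
    finally show ?thesis by (simp add: nu_def bb_def vv_def sum_distrib_left del: sum.cl_ivl_Suc)
  qed
  have cC: "card (Cm i) \<le> K + 2" "card (Cm i) \<le> K + 1" using i by (auto simp: Cm_def)
  have cZ: "card (ZZ i w t) + card (Cm i) \<le> 2 * K + 4" for t
  proof -
    have "card (ZZ i w t) \<le> Suc (card ((\<lambda>l. Inl (0, l, w 0 div 2 ^ kk l, t) :: coord) ` {Suc (dl i)..Suc K}))"
      unfolding ZZ_def by (rule card_insert_le_m1) auto
    also have "card ((\<lambda>l. Inl (0, l, w 0 div 2 ^ kk l, t) :: coord) ` {Suc (dl i)..Suc K}) \<le> card {Suc (dl i)..Suc K}"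
      by (rule card_image_le) simp
    finally show ?thesis using cC by simp
  qed
  note R = gauss_receiver_error[where v=vv and I="Jc \<union> Jn" and C="?C" and Cm="Cm i" and \<phi>="ph i" and idx=idx and Z="ZZ i w"
      and b="bb i" and \<nu>="nu i" and n="2 * K + 4" and ?c0.0="tru i w" and \<alpha>="cf i" and N=N and \<eta>=\<eta>]
  have prem1: "ph i k (idx c k) t \<in> Jc \<union> Jn \<and> vv (ph i k (idx c k) t) = 1" if "k \<in> Cm i" "t < N" "c \<in> insert (tru i w) ?C" for k t c
    using that tru_Cand[OF i w] by (intro phJ idx_lt_Mx[OF i]) auto
  have prem2: "k = k' \<and> n = n' \<and> t = t'" if "k \<in> Cm i" "k' \<in> Cm i" "ph i k n t = ph i k' n' t'" for k k' n n' t t'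
    using that by (auto simp: ph_def Cm_def split: if_splits)
  have prem3: "ph i k n t \<notin> ZZ i w t'" if "k \<in> Cm i" for k n t t'
    using that by (auto simp: ph_def Cm_def ZZ_def split: if_splits)
  have prem4: "disjoint_family_on (ZZ i w) {..<N}"
    by (auto simp: disjoint_family_on_def ZZ_def)
  have finC: "finite ?C" using finite_Cand by auto
  have E1: "ev i w = {x \<in> space \<Omega>. \<exists>c\<in>?C.
      (\<Sum>t<N. (cmod ((\<Sum>k\<in>Cm i. cf i k * x (ph i k (idx (tru i w) k) t)) + (\<Sum>j\<in>ZZ i w t. bb i j * x j) - (\<Sum>k\<in>Cm i. cf i k * x (ph i k (idx c k) t))))\<^sup>2)
      \<le> (\<Sum>t<N. (cmod (\<Sum>j\<in>ZZ i w t. bb i j * x j))\<^sup>2)}"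
    unfolding ev_def XX_def zt_def ..
  show "ev i w \<in> sets \<Omega>"
    unfolding E1 by (rule R(1)[OF vv_pos finite_J(3) finC finite_Cm prem1 prem2 _ prem4 prem3 nu nu_pos cZ \<eta> N]) (use Zin finZ in auto)
  have "emeasure \<Omega> (ev i w) \<le> ennreal (2 ^ card (Cm i) * (64 * (real (2 * K + 4))\<^sup>2 / (real N * \<eta>\<^sup>2)) +
     (\<Sum>c\<in>?C. exp (real N * \<eta>) * (1 / (1 + (\<Sum>k | k \<in> Cm i \<and> idx c k \<noteq> idx (tru i w) k. (cmod (cf i k))\<^sup>2) / nu i)) ^ N))"
    unfolding E1 by (rule R(2)[OF vv_pos finite_J(3) finC finite_Cm prem1 prem2 _ prem4 prem3 nu nu_pos cZ \<eta> N]) (use Zin finZ in auto)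
  also have "\<dots> \<le> ennreal (beta i \<eta>)"
  proof (rule ennreal_leI)
    have "(\<Sum>c\<in>?C. exp (real N * \<eta>) * (1 / (1 + (\<Sum>k | k \<in> Cm i \<and> idx c k \<noteq> idx (tru i w) k. (cmod (cf i k))\<^sup>2) / nu i)) ^ N) \<le>
       (\<Sum>l\<le>dl i. wrong i l * (exp (real N * \<eta>) * (1 / (1 + S i l / nu i)) ^ N))"
    proof (rule sum_wrong[OF i w, of "\<lambda>s. exp (real N * \<eta>) * (1 / (1 + s / nu i)) ^ N"])
      fix x y :: real assume "0 \<le> x" "x \<le> y"
      then show "exp (real N * \<eta>) * (1 / (1 + y / nu i)) ^ N \<le> exp (real N * \<eta>) * (1 / (1 + x / nu i)) ^ N"
        using nu_pos[of i] by (intro mult_left_mono power_mono divide_left_mono add_mono divide_right_mono mult_pos_pos add_pos_nonneg) auto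
    next
      fix x :: real assume "0 \<le> x"
      then show "0 \<le> exp (real N * \<eta>) * (1 / (1 + x / nu i)) ^ N" using nu_pos[of i] by simp
    qed
    moreover have "2 ^ card (Cm i) * (64 * (real (2 * K + 4))\<^sup>2 / (real N * \<eta>\<^sup>2)) \<le> 2 ^ (K + 2) * (64 * (real (2 * K + 4))\<^sup>2 / (real N * \<eta>\<^sup>2))"
      using cC by (intro mult_right_mono power_increasing) auto
    ultimately show "2 ^ card (Cm i) * (64 * (real (2 * K + 4))\<^sup>2 / (real N * \<eta>\<^sup>2)) +
     (\<Sum>c\<in>?C. exp (real N * \<eta>) * (1 / (1 + (\<Sum>k | k \<in> Cm i \<and> idx c k \<noteq> idx (tru i w) k. (cmod (cf i k))\<^sup>2) / nu i)) ^ N) \<le> beta i \<eta>"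
      unfolding beta_def by linarith
  qed
  finally show "emeasure \<Omega> (ev i w) \<le> ennreal (beta i \<eta>)" .
qed

section \<open>Choice of a codebook with small error and admissible power\<close>

definition Qp :: "nat \<Rightarrow> real" where
  "Qp i = (if i = 0 then (\<Sum>l\<in>{1..Suc K}. (al l)\<^sup>2) else (am i)\<^sup>2)"

lemma Qp_nonneg: "Qp i \<ge> 0" by (simp add: Qp_def sum_nonneg del: sum.cl_ivl_Suc)

lemma cenc_measurable:
  assumes i: "i \<le> K" and m: "m < M i" and t: "t < N"
  shows "(\<lambda>x. cenc x i m t) \<in> borel_measurable \<Omega>c"
proof -
  have mM: "m < Mx" using M_le_Mx[OF i] m by simp
  have 1: "Inl (0, l, m div 2 ^ kk l, t) \<in> Jc" if "l \<in> {1..Suc K}" for l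
    using that i t mM le_less_trans[OF div_le_dividend mM] by (auto simp: Jc_def)
  have 2: "Inl (i, 0, m, t) \<in> Jc" using i t mM by (auto simp: Jc_def)
  show ?thesis
  proof (cases "i = 0")
    case True
    have "(\<lambda>x. \<Sum>l\<in>{1..Suc K}. of_real (al l) * x (Inl (0, l, m div 2 ^ kk l, t))) \<in> borel_measurable \<Omega>c"
      by (intro borel_measurable_sum borel_measurable_times borel_measurable_const measurable_compose[OF measurable_component_singleton[OF 1]]) auto
    then show ?thesis using True by (simp add: cenc_def del: sum.cl_ivl_Suc)
  next
    case False
    have "(\<lambda>x. of_real (am i) * x (Inl (i, 0, m, t))) \<in> borel_measurable \<Omega>c"
      using 2 by measurable
    then show ?thesis using False by (simp add: cenc_def)
  qed
qed

lemma power_moment: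
  assumes i: "i \<le> K" and m: "m < M i" and Q: "Qp i > 0"
  shows "(\<integral>\<^sup>+x. ennreal (((\<Sum>t<N. (cmod (cenc x i m t))\<^sup>2) - real N * Qp i)\<^sup>2) \<partial>\<Omega>c) \<le>
    ennreal (16 * (real (2 * K + 4))\<^sup>2 * real N * (Qp i)\<^sup>2)"
proof -
  define ly where "ly = (if i = 0 then {1..Suc K} else {0})"
  define A where "A t = (\<lambda>l. Inl (i, l, m div 2 ^ (if i = 0 then kk l else 0), t) :: coord) ` ly" for t
  define a where "a j = (case j of Inl (i', l, n, t) \<Rightarrow> of_real (if i = 0 then al l else am i) | Inr _ \<Rightarrow> (0 :: complex))" for j :: coord
  have mM: "m < Mx" using M_le_Mx[OF i] m by simp
  have inj: "inj_on (\<lambda>l. Inl (i, l, m div 2 ^ (if i = 0 then kk l else 0), t) :: coord) ly" for t by (auto simp: inj_on_def)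
  have sumA: "(\<Sum>j\<in>A t. f j) = (\<Sum>l\<in>ly. f (Inl (i, l, m div 2 ^ (if i = 0 then kk l else 0), t)))" for t and f :: "coord \<Rightarrow> 'z::comm_monoid_add"
    unfolding A_def by (subst sum.reindex[OF inj]) simp
  have enc: "cenc x i m t = (\<Sum>j\<in>A t. a j * x j)" for x t
    unfolding sumA by (cases "i = 0") (simp_all add: ly_def cenc_def a_def del: sum.cl_ivl_Suc)
  have "(\<integral>\<^sup>+x. ennreal ((\<Sum>t<N. (cmod (\<Sum>j\<in>A t. a j * x j))\<^sup>2 / Qp i - 1)\<^sup>2) \<partial>\<Omega>c) \<le> ennreal (16 * (real (2 * K + 4))\<^sup>2 * real N)"
  proof (rule gauss_quad_lln[where v=vv, OF vv_pos])
    fix t assume t: "t < N"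
    have "ly \<subseteq> {..Suc K}" by (auto simp: ly_def)
    then show "finite (A t) \<and> A t \<subseteq> Jc"
      using i t mM le_less_trans[OF div_le_dividend mM] finite_subset[of ly "{..Suc K}"] by (auto simp: A_def Jc_def)
    show "(\<Sum>j\<in>A t. (cmod (a j))\<^sup>2 * vv j) = Qp i"
      unfolding sumA by (cases "i = 0") (simp_all add: ly_def a_def vv_def Qp_def del: sum.cl_ivl_Suc)
    have "card (A t) \<le> card ly" unfolding A_def by (rule card_image_le) (simp add: ly_def)
    also have "\<dots> \<le> 2 * K + 4" by (simp add: ly_def)
    finally show "card (A t) \<le> 2 * K + 4" .
  next
    show "disjoint_family_on A {..<N}" by (auto simp: disjoint_family_on_def A_def)
  qed (rule Q)
  then have *: "(\<integral>\<^sup>+x. ennreal ((\<Sum>t<N. (cmod (cenc x i m t))\<^sup>2 / Qp i - 1)\<^sup>2) \<partial>\<Omega>c) \<le> ennreal (16 * (real (2 * K + 4))\<^sup>2 * real N)"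
    by (simp only: enc)
  have "(\<integral>\<^sup>+x. ennreal (((\<Sum>t<N. (cmod (cenc x i m t))\<^sup>2) - real N * Qp i)\<^sup>2) \<partial>\<Omega>c) =
     (\<integral>\<^sup>+x. ennreal ((Qp i)\<^sup>2) * ennreal ((\<Sum>t<N. (cmod (cenc x i m t))\<^sup>2 / Qp i - 1)\<^sup>2) \<partial>\<Omega>c)"
  proof (rule nn_integral_cong)
    fix x
    have "(\<Sum>t<N. (cmod (cenc x i m t))\<^sup>2) - real N * Qp i = Qp i * (\<Sum>t<N. (cmod (cenc x i m t))\<^sup>2 / Qp i - 1)"
      using Q by (simp add: sum_subtractf sum_divide_distrib[symmetric] right_diff_distrib mult.commute)
    then show "ennreal (((\<Sum>t<N. (cmod (cenc x i m t))\<^sup>2) - real N * Qp i)\<^sup>2) = ennreal ((Qp i)\<^sup>2) * ennreal ((\<Sum>t<N. (cmod (cenc x i m t))\<^sup>2 / Qp i - 1)\<^sup>2)"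
      by (simp only: power_mult_distrib ennreal_mult zero_le_power2)
  qed
  also have "\<dots> = ennreal ((Qp i)\<^sup>2) * (\<integral>\<^sup>+x. ennreal ((\<Sum>t<N. (cmod (cenc x i m t))\<^sup>2 / Qp i - 1)\<^sup>2) \<partial>\<Omega>c)"
  proof (rule nn_integral_cmult)
    have "(\<lambda>x. (cmod (cenc x i m t))\<^sup>2 / Qp i - 1) \<in> borel_measurable \<Omega>c" if "t < N" for t
      using cenc_measurable[OF i m that] by measurable
    then have "(\<lambda>x. \<Sum>t<N. (cmod (cenc x i m t))\<^sup>2 / Qp i - 1) \<in> borel_measurable \<Omega>c"
      by (intro borel_measurable_sum) auto
    then show "(\<lambda>x. ennreal ((\<Sum>t<N. (cmod (cenc x i m t))\<^sup>2 / Qp i - 1)\<^sup>2)) \<in> borel_measurable \<Omega>c"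
      by measurable
  qed
  also have "\<dots> \<le> ennreal ((Qp i)\<^sup>2) * ennreal (16 * (real (2 * K + 4))\<^sup>2 * real N)"
    by (rule mult_left_mono[OF *]) simp
  also have "\<dots> = ennreal (16 * (real (2 * K + 4))\<^sup>2 * real N * (Qp i)\<^sup>2)"
    by (simp add: mult_ac flip: ennreal_mult)
  finally show ?thesis .
qed

lemma noise_space_eq: "noise_space K N n0 = distr \<Omega>n (noise_space K N n0) (\<lambda>y. \<lambda>p\<in>{..K}\<times>{..<N}. y (Inr p))"
proof -
  have "distr \<Omega>n (PiM ({..K}\<times>{..<N}) (\<lambda>p. cgauss (vv (Inr p)))) (\<lambda>y. \<lambda>p\<in>{..K}\<times>{..<N}. y (Inr p)) = PiM ({..K}\<times>{..<N}) (\<lambda>p. cgauss (vv (Inr p)))"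
    by (rule distr_PiM_reindex) (auto intro: prob_space_cgauss vv_pos simp: Jn_def inj_on_def)
  then show ?thesis by (simp add: noise_space_def vv_def)
qed

text \<open>First-moment method: the error probability in units of \<open>eps\<close> and the
  squared power deviations in units of the available slack add up to a random variable
  \<open>T\<close> of mean below 1, so one codebook meets all requirements at once. A user with
  \<open>Qp i = 0\<close> may have no slack, but it sends only zeros; hence the alternative in the
  assumption.\<close>

lemma good_code_exists:
  assumes \<eta>: "\<eta> > 0" and eps: "eps > 0"
    and P: "\<And>i. i \<le> K \<Longrightarrow> (Qp i = 0 \<and> Pw i \<ge> 0) \<or> Qp i < Pw i"
    and small: "(\<Sum>i\<le>K. beta i \<eta>) / eps + (\<Sum>i\<le>K. 16 * (real (2 * K + 4))\<^sup>2 * (Qp i)\<^sup>2 / (real N * (Pw i - Qp i)\<^sup>2)) < 1"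
  shows "\<exists>x. good_code K hdir hc Pw n0 N M (cenc x) (cdec x) eps"
proof -
  interpret Oc: prob_space \<Omega>c by (rule prob_space_PiM) (rule prob_space_cgauss[OF vv_pos])
  interpret On: prob_space \<Omega>n by (rule prob_space_PiM) (rule prob_space_cgauss[OF vv_pos])
  interpret pp: product_prob_space "\<lambda>j. cgauss (vv j)" by (rule product_prob_space_cgauss[OF vv_pos])
  have disj: "Jc \<inter> Jn = {}" by (auto simp: Jc_def Jn_def)
  define PM where "PM = (\<Prod>i\<le>K. real (M i))"
  have PM: "PM > 0" unfolding PM_def using M_pos by (intro prod_pos) (auto simp: Suc_le_eq)
  have cW: "real (card WW) = PM" by (simp add: card_PiE PM_def)
  have finW: "finite WW" by (intro finite_PiE) auto
  have be: "beta i \<eta> \<ge> 0" if "i \<le> K" for i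
  proof -
    have "wrong i l \<ge> 0" for l using M_pos[OF that] by (auto simp: wrong_def intro!: mult_nonneg_nonneg)
    then show ?thesis using nu_pos[of i] S_nonneg by (auto simp: beta_def intro!: add_nonneg_nonneg sum_nonneg)
  qed
  \<comment> \<open>The error event is averaged over the noise with the codebook frozen, which
    leaves a function of the codebook alone; by Fubini its mean is the bound from
    \<open>ev_bound\<close>.\<close>
  define er where "er i w x = (\<integral>\<^sup>+y. indicator (ev i w) (merge Jc Jn (x, y)) \<partial>\<Omega>n)" for i w x
  have indm: "(indicator (ev i w) :: _ \<Rightarrow> ennreal) \<in> borel_measurable \<Omega>" if "i \<le> K" "w \<in> WW" for i w
    using ev_bound(1)[OF that \<eta>] by simp
  have mm: "(\<lambda>p. indicator (ev i w) (merge Jc Jn p) :: ennreal) \<in> borel_measurable (\<Omega>c \<Otimes>\<^sub>M \<Omega>n)" if "i \<le> K" "w \<in> WW" for i w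
    by (rule measurable_compose[OF measurable_merge indm[OF that]])
  have erm: "er i w \<in> borel_measurable \<Omega>c" if "i \<le> K" "w \<in> WW" for i w
    unfolding er_def by (rule On.borel_measurable_nn_integral_fst[OF mm[OF that]])
  have er_int: "(\<integral>\<^sup>+x. er i w x \<partial>\<Omega>c) \<le> ennreal (beta i \<eta>)" if "i \<le> K" "w \<in> WW" for i w
  proof -
    have "(\<integral>\<^sup>+x. er i w x \<partial>\<Omega>c) = (\<integral>\<^sup>+x. indicator (ev i w) x \<partial>\<Omega>)"
      unfolding er_def by (rule pp.product_nn_integral_fold[OF disj finite_J(1,2) indm[OF that], symmetric])
    also have "\<dots> = emeasure \<Omega> (ev i w)" using ev_bound(1)[OF that \<eta>] by simp
    also have "\<dots> \<le> ennreal (beta i \<eta>)" by (rule ev_bound(2)[OF that \<eta>])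
    finally show ?thesis .
  qed
  define pw where "pw i m x = ((\<Sum>t<N. (cmod (cenc x i m t))\<^sup>2) - real N * Qp i)\<^sup>2" for i m x
  \<comment> \<open>Normalized so that a weighted sum of at most 1 says exactly that the mean square
    deviation over the messages is at most the square of the slack
    \<open>N * (Pw i - Qp i)\<close>.\<close>
  define cp where "cp i = (if Qp i = 0 then 0 else 1 / (real (M i) * (real N * (Pw i - Qp i))\<^sup>2))" for i
  have cp: "cp i \<ge> 0" for i by (simp add: cp_def)
  have pwm: "(\<lambda>x. ennreal (pw i m x)) \<in> borel_measurable \<Omega>c" if "i \<le> K" "m < M i" for i m
  proof -
    have "(\<lambda>x. \<Sum>t<N. (cmod (cenc x i m t))\<^sup>2) \<in> borel_measurable \<Omega>c"
    proof (rule borel_measurable_sum)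
      fix t assume "t \<in> {..<N}"
      then have [measurable]: "(\<lambda>x. cenc x i m t) \<in> borel_measurable \<Omega>c" using cenc_measurable that by auto
      show "(\<lambda>x. (cmod (cenc x i m t))\<^sup>2) \<in> borel_measurable \<Omega>c" by measurable
    qed
    then show ?thesis unfolding pw_def by measurable
  qed
  define T where "T x = ennreal (1 / (eps * PM)) * (\<Sum>w\<in>WW. \<Sum>i\<le>K. er i w x) + (\<Sum>i\<le>K. ennreal (cp i) * (\<Sum>m<M i. ennreal (pw i m x)))" for x
  have s1m: "(\<lambda>x. \<Sum>w\<in>WW. \<Sum>i\<le>K. er i w x) \<in> borel_measurable \<Omega>c"
    by (intro borel_measurable_sum erm) auto
  have s2m: "(\<lambda>x. \<Sum>m<M i. ennreal (pw i m x)) \<in> borel_measurable \<Omega>c" if "i \<le> K" for i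
    by (intro borel_measurable_sum pwm) (use that in auto)
  have I1: "(\<integral>\<^sup>+x. (\<Sum>w\<in>WW. \<Sum>i\<le>K. er i w x) \<partial>\<Omega>c) \<le> ennreal (PM * (\<Sum>i\<le>K. beta i \<eta>))"
  proof -
    have "(\<integral>\<^sup>+x. (\<Sum>w\<in>WW. \<Sum>i\<le>K. er i w x) \<partial>\<Omega>c) = (\<Sum>w\<in>WW. \<integral>\<^sup>+x. (\<Sum>i\<le>K. er i w x) \<partial>\<Omega>c)"
      by (rule nn_integral_sum) (intro borel_measurable_sum erm, auto)
    also have "\<dots> = (\<Sum>w\<in>WW. \<Sum>i\<le>K. \<integral>\<^sup>+x. er i w x \<partial>\<Omega>c)"
      by (intro sum.cong refl nn_integral_sum erm) auto
    also have "\<dots> \<le> (\<Sum>w\<in>WW. \<Sum>i\<le>K. ennreal (beta i \<eta>))"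
      by (intro sum_mono er_int) auto
    also have "\<dots> = (\<Sum>w\<in>WW. ennreal (\<Sum>i\<le>K. beta i \<eta>))"
      by (intro sum.cong refl sum_ennreal be) auto
    also have "\<dots> = ennreal (\<Sum>w\<in>WW. \<Sum>i\<le>K. beta i \<eta>)"
      by (intro sum_ennreal sum_nonneg be) auto
    also have "(\<Sum>w\<in>WW. \<Sum>i\<le>K. beta i \<eta>) = PM * (\<Sum>i\<le>K. beta i \<eta>)" by (simp only: sum_constant cW)
    finally show ?thesis .
  qed
  have I2: "(\<integral>\<^sup>+x. ennreal (cp i) * (\<Sum>m<M i. ennreal (pw i m x)) \<partial>\<Omega>c) \<le>
      ennreal (16 * (real (2 * K + 4))\<^sup>2 * (Qp i)\<^sup>2 / (real N * (Pw i - Qp i)\<^sup>2))" if i: "i \<le> K" for i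
  proof (cases "Qp i = 0")
    case True then show ?thesis by (simp add: cp_def)
  next
    case False
    then have Q: "Qp i > 0" "Qp i < Pw i" using Qp_nonneg[of i] P[OF i] by auto
    have "(\<integral>\<^sup>+x. ennreal (cp i) * (\<Sum>m<M i. ennreal (pw i m x)) \<partial>\<Omega>c) = ennreal (cp i) * (\<integral>\<^sup>+x. (\<Sum>m<M i. ennreal (pw i m x)) \<partial>\<Omega>c)"
      by (rule nn_integral_cmult[OF s2m[OF i]])
    also have "(\<integral>\<^sup>+x. (\<Sum>m<M i. ennreal (pw i m x)) \<partial>\<Omega>c) = (\<Sum>m<M i. \<integral>\<^sup>+x. ennreal (pw i m x) \<partial>\<Omega>c)"
      by (rule nn_integral_sum) (use pwm i in auto)
    also have "\<dots> \<le> (\<Sum>m<M i. ennreal (16 * (real (2 * K + 4))\<^sup>2 * real N * (Qp i)\<^sup>2))"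
      unfolding pw_def by (intro sum_mono power_moment i Q) auto
    also have "\<dots> = ennreal (\<Sum>m<M i. 16 * (real (2 * K + 4))\<^sup>2 * real N * (Qp i)\<^sup>2)" by (rule sum_ennreal) simp
    also have "ennreal (cp i) * \<dots> = ennreal (cp i * (\<Sum>m<M i. 16 * (real (2 * K + 4))\<^sup>2 * real N * (Qp i)\<^sup>2))"
      by (rule ennreal_mult[symmetric]) (auto simp: cp)
    also have "cp i * (\<Sum>m<M i. 16 * (real (2 * K + 4))\<^sup>2 * real N * (Qp i)\<^sup>2) = 16 * (real (2 * K + 4))\<^sup>2 * (Qp i)\<^sup>2 / (real N * (Pw i - Qp i)\<^sup>2)"
      using False M_pos[OF i] N by (simp add: cp_def power_mult_distrib power2_eq_square[of "real N"])
    finally show ?thesis by (simp add: mult_left_mono)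
  qed
  have IT: "(\<integral>\<^sup>+x. T x \<partial>\<Omega>c) < 1"
  proof -
    have c1: "1 / (eps * PM) \<ge> 0" using eps PM by simp
    define b1 where "b1 = (\<Sum>i\<le>K. beta i \<eta>) / eps"
    define b2 where "b2 = (\<Sum>i\<le>K. 16 * (real (2 * K + 4))\<^sup>2 * (Qp i)\<^sup>2 / (real N * (Pw i - Qp i)\<^sup>2))"
    define T1 where "T1 x = ennreal (1 / (eps * PM)) * (\<Sum>w\<in>WW. \<Sum>i\<le>K. er i w x)" for x
    define T2 where "T2 x = (\<Sum>i\<le>K. ennreal (cp i) * (\<Sum>m<M i. ennreal (pw i m x)))" for x
    have b1: "b1 \<ge> 0" unfolding b1_def using eps be by (intro divide_nonneg_pos sum_nonneg) auto
    have b2: "b2 \<ge> 0" unfolding b2_def by (simp add: sum_nonneg)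
    have T1m: "T1 \<in> borel_measurable \<Omega>c" unfolding T1_def
      by (intro borel_measurable_times_ennreal borel_measurable_const s1m)
    have T2m: "T2 \<in> borel_measurable \<Omega>c" unfolding T2_def
      by (intro borel_measurable_sum borel_measurable_times_ennreal borel_measurable_const s2m) auto
    have 1: "(\<integral>\<^sup>+x. T1 x \<partial>\<Omega>c) \<le> ennreal b1"
    proof -
      have "(\<integral>\<^sup>+x. T1 x \<partial>\<Omega>c) = ennreal (1 / (eps * PM)) * (\<integral>\<^sup>+x. (\<Sum>w\<in>WW. \<Sum>i\<le>K. er i w x) \<partial>\<Omega>c)"
        unfolding T1_def by (rule nn_integral_cmult[OF s1m])
      also have "\<dots> \<le> ennreal (1 / (eps * PM)) * ennreal (PM * (\<Sum>i\<le>K. beta i \<eta>))"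
        by (rule mult_left_mono[OF I1]) simp
      also have "\<dots> = ennreal (1 / (eps * PM) * (PM * (\<Sum>i\<le>K. beta i \<eta>)))"
        by (rule ennreal_mult'[symmetric]) (rule c1)
      also have "1 / (eps * PM) * (PM * (\<Sum>i\<le>K. beta i \<eta>)) = b1" using PM by (simp add: b1_def)
      finally show ?thesis .
    qed
    have 2: "(\<integral>\<^sup>+x. T2 x \<partial>\<Omega>c) \<le> ennreal b2"
    proof -
      have "(\<integral>\<^sup>+x. T2 x \<partial>\<Omega>c) = (\<Sum>i\<le>K. \<integral>\<^sup>+x. ennreal (cp i) * (\<Sum>m<M i. ennreal (pw i m x)) \<partial>\<Omega>c)"
        unfolding T2_def by (intro nn_integral_sum borel_measurable_times_ennreal borel_measurable_const s2m) auto
      also have "\<dots> \<le> (\<Sum>i\<le>K. ennreal (16 * (real (2 * K + 4))\<^sup>2 * (Qp i)\<^sup>2 / (real N * (Pw i - Qp i)\<^sup>2)))"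
        by (intro sum_mono I2) auto
      also have "\<dots> = ennreal b2" unfolding b2_def by (rule sum_ennreal) simp
      finally show ?thesis .
    qed
    have "(\<integral>\<^sup>+x. T x \<partial>\<Omega>c) = (\<integral>\<^sup>+x. T1 x + T2 x \<partial>\<Omega>c)" unfolding T_def T1_def T2_def ..
    also have "\<dots> = (\<integral>\<^sup>+x. T1 x \<partial>\<Omega>c) + (\<integral>\<^sup>+x. T2 x \<partial>\<Omega>c)" by (rule nn_integral_add[OF T1m T2m])
    also have "\<dots> \<le> ennreal b1 + ennreal b2" by (rule add_mono[OF 1 2])
    also have "\<dots> = ennreal (b1 + b2)" by (rule ennreal_plus[symmetric, OF b1 b2])
    also have "\<dots> < 1" using small by (simp add: ennreal_less_one_iff b1_def b2_def)
    finally show ?thesis .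
  qed
  have "\<exists>x\<in>space \<Omega>c. T x < 1"
  proof (rule ccontr)
    assume "\<not> (\<exists>x\<in>space \<Omega>c. T x < 1)"
    then have "(\<integral>\<^sup>+x. 1 \<partial>\<Omega>c) \<le> (\<integral>\<^sup>+x. T x \<partial>\<Omega>c)" by (intro nn_integral_mono) (auto simp: not_less)
    then show False using IT by (simp add: Oc.emeasure_space_1)
  qed
  then obtain x where x: "x \<in> space \<Omega>c" and Tx: "T x < 1" by blast
  have T1: "ennreal (1 / (eps * PM)) * (\<Sum>w\<in>WW. \<Sum>i\<le>K. er i w x) \<le> 1"
  proof -
    have "ennreal (1 / (eps * PM)) * (\<Sum>w\<in>WW. \<Sum>i\<le>K. er i w x) \<le> T x"
      unfolding T_def by (rule add_increasing2[OF zero_le order.refl])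
    then show ?thesis using Tx by (simp only: order_trans[OF _ less_imp_le])
  qed
  have T2: "ennreal (cp i) * (\<Sum>m<M i. ennreal (pw i m x)) \<le> 1" if i: "i \<le> K" for i
  proof -
    have "ennreal (cp i) * (\<Sum>m<M i. ennreal (pw i m x)) \<le> (\<Sum>i\<le>K. ennreal (cp i) * (\<Sum>m<M i. ennreal (pw i m x)))"
      using i by (intro member_le_sum) auto
    also have "\<dots> \<le> T x" unfolding T_def by simp
    finally show ?thesis using Tx by simp
  qed

  have decm: "cdec x i \<in> measurable (out_space N) (count_space UNIV)" for i by (rule cdec_measurable)
  let ?Ns = "noise_space K N n0"
  interpret Ns: prob_space ?Ns unfolding noise_space_def by (rule prob_space_PiM) (rule prob_space_cgauss[OF n0])
  define Bad where "Bad w = {z \<in> space ?Ns. \<exists>i\<le>K. cdec x i (rx N hdir hc (cenc x) w z i) \<noteq> w i}" for w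
  have Badm: "Bad w \<in> sets ?Ns" for w
  proof -
    have rm: "(\<lambda>z. rx N hdir hc (cenc x) w z i) \<in> measurable ?Ns (out_space N)" if "i \<le> K" for i
      unfolding rx_def out_space_def noise_space_def
    proof (rule measurable_restrict)
      fix t assume "t \<in> {..<N}"
      then have it: "(i, t) \<in> {..K} \<times> {..<N}" using that by simp
      have "(\<lambda>z. z (i, t)) \<in> borel_measurable (PiM ({..K} \<times> {..<N}) (\<lambda>_. cgauss n0))"
        using measurable_component_singleton[OF it, of "\<lambda>_. cgauss n0"] by (simp cong: measurable_cong_sets)
      note m = borel_measurable_add[OF borel_measurable_const this]
      show "(\<lambda>z. if i = 0 then hdir 0 * cenc x 0 (w 0) t + z (0, t) else hdir i * cenc x i (w i) t + hc i * cenc x 0 (w 0) t + z (i, t)) \<in> borel_measurable (PiM ({..K} \<times> {..<N}) (\<lambda>_. cgauss n0))"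
        by (cases "i = 0") (use m in \<open>simp_all only: if_True if_False simp_thms\<close>)
    qed
    have "{z \<in> space ?Ns. cdec x i (rx N hdir hc (cenc x) w z i) = w i} \<in> sets ?Ns" if "i \<le> K" for i
      using measurable_compose[OF rm[OF that] decm[of i]] by measurable
    then have "(\<Union>i\<in>{..K}. space ?Ns - {z \<in> space ?Ns. cdec x i (rx N hdir hc (cenc x) w z i) = w i}) \<in> sets ?Ns" by auto
    also have "(\<Union>i\<in>{..K}. space ?Ns - {z \<in> space ?Ns. cdec x i (rx N hdir hc (cenc x) w z i) = w i}) = Bad w" by (auto simp: Bad_def)
    finally show ?thesis .
  qed
  have Bad_le: "emeasure ?Ns (Bad w) \<le> (\<Sum>i\<le>K. er i w x)" if w: "w \<in> WW" for w
  proof -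
    define ff where "ff y = (\<lambda>p\<in>{..K}\<times>{..<N}. y (Inr p))" for y :: "coord \<Rightarrow> complex"
    have fm: "ff \<in> measurable \<Omega>n ?Ns"
      unfolding noise_space_def ff_def by (rule measurable_restrict) (auto simp: Jn_def intro!: measurable_component_singleton[THEN measurable_compose])
    have "emeasure ?Ns (Bad w) = emeasure \<Omega>n (ff -` Bad w \<inter> space \<Omega>n)"
      by (subst noise_space_eq) (unfold ff_def[symmetric], rule emeasure_distr[OF fm Badm])
    also have "\<dots> = (\<integral>\<^sup>+y. indicator (ff -` Bad w \<inter> space \<Omega>n) y \<partial>\<Omega>n)"
      by (rule nn_integral_indicator[symmetric, OF measurable_sets[OF fm Badm]])
    also have "\<dots> \<le> (\<integral>\<^sup>+y. (\<Sum>i\<le>K. indicator (ev i w) (merge Jc Jn (x, y))) \<partial>\<Omega>n)"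
    proof (rule nn_integral_mono)
      fix y assume y: "y \<in> space \<Omega>n"
      define om where "om = merge Jc Jn (x, y)"
      have om: "om \<in> space \<Omega>"
        using x y by (auto simp: om_def space_PiM PiE_iff merge_def extensional_def)
      have omc: "j \<in> Jc \<Longrightarrow> x j = om j" for j by (simp add: om_def merge_def)
      have omn: "y (Inr p) = om (Inr p)" if "p \<in> {..K}\<times>{..<N}" for p
      proof -
        have "Inr p \<in> Jn" using that by (auto simp: Jn_def)
        then show ?thesis using disj by (auto simp: om_def merge_def)
      qed
      show "indicator (ff -` Bad w \<inter> space \<Omega>n) y \<le> (\<Sum>i\<le>K. indicator (ev i w) (merge Jc Jn (x, y)) :: ennreal)"
      proof (cases "ff y \<in> Bad w")
        case True
        then obtain i where i: "i \<le> K" and e: "cdec x i (rx N hdir hc (cenc x) w (ff y) i) \<noteq> w i" by (auto simp: Bad_def)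
        have wi: "w i < M i" "w 0 < M 0" using w i by (auto simp: PiE_iff)
        have "rx N hdir hc (cenc x) w (ff y) i = rx N hdir hc (cenc om) w (\<lambda>p. om (Inr p)) i"
          unfolding rx_def
        proof (rule restrict_ext)
          fix t assume t: "t \<in> {..<N}"
          have "cenc x i (w i) t = cenc om i (w i) t" "cenc x 0 (w 0) t = cenc om 0 (w 0) t"
            using t i wi by (auto intro!: cenc_cong omc)
          then show "(if i = 0 then hdir 0 * cenc x 0 (w 0) t + ff y (0, t) else hdir i * cenc x i (w i) t + hc i * cenc x 0 (w 0) t + ff y (i, t)) =
            (if i = 0 then hdir 0 * cenc om 0 (w 0) t + om (Inr (0, t)) else hdir i * cenc om i (w i) t + hc i * cenc om 0 (w 0) t + om (Inr (i, t)))"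
            using t i omn[of "(0, t)"] omn[of "(i, t)"] by (simp add: ff_def)
        qed
        moreover have "cdec x i = cdec om i" by (rule cdec_cong[OF omc i])
        ultimately have "om \<in> ev i w" using e by (intro error_imp_ev[OF i w om]) simp
        then have "(1::ennreal) = indicator (ev i w) (merge Jc Jn (x, y))" by (simp add: om_def)
        also have "\<dots> \<le> (\<Sum>i\<le>K. indicator (ev i w) (merge Jc Jn (x, y)))"
          using i by (intro member_le_sum) auto
        finally show ?thesis using True y by simp
      qed simp
    qed
    also have "\<dots> = (\<Sum>i\<le>K. er i w x)"
      unfolding er_def
    proof (rule nn_integral_sum)
      fix i assume "i \<in> {..K}"
      then have "i \<le> K" by simp
      from measurable_Pair2[OF mm[OF this w] x]
      show "(\<lambda>y. indicator (ev i w) (merge Jc Jn (x, y)) :: ennreal) \<in> borel_measurable \<Omega>n" .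
    qed
    finally show ?thesis .
  qed
  have "err_prob K N hdir hc n0 M (cenc x) (cdec x) \<le> eps"
  proof -
    have "ennreal (\<Sum>w\<in>WW. measure ?Ns (Bad w)) = (\<Sum>w\<in>WW. emeasure ?Ns (Bad w))"
      by (simp add: Ns.emeasure_eq_measure)
    also have "\<dots> \<le> (\<Sum>w\<in>WW. \<Sum>i\<le>K. er i w x)" by (rule sum_mono[OF Bad_le])
    finally have "ennreal (1 / (eps * PM)) * ennreal (\<Sum>w\<in>WW. measure ?Ns (Bad w)) \<le> 1"
      by (intro order_trans[OF mult_left_mono[OF _ zero_le] T1])
    then have "ennreal (1 / (eps * PM) * (\<Sum>w\<in>WW. measure ?Ns (Bad w))) \<le> ennreal 1"
      using eps PM by (simp add: sum_nonneg flip: ennreal_mult)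
    then have "1 / (eps * PM) * (\<Sum>w\<in>WW. measure ?Ns (Bad w)) \<le> 1"
      by (subst (asm) ennreal_le_iff) auto
    then have "(\<Sum>w\<in>WW. measure ?Ns (Bad w)) \<le> eps * PM" using eps PM by (simp add: field_simps)
    then have "(\<Sum>w\<in>WW. measure ?Ns (Bad w)) / PM \<le> eps" using PM by (simp add: field_simps)
    then show ?thesis unfolding err_prob_def Bad_def PM_def .
  qed
  moreover have "(\<Sum>m<M i. \<Sum>t<N. (cmod (cenc x i m t))\<^sup>2) / real (M i) \<le> real N * Pw i" if i: "i \<le> K" for i
  proof (cases "Qp i = 0")
    case True
    have "cenc x i m t = 0" for m t
    proof (cases "i = 0")
      case i0: True
      then have "(\<Sum>l\<in>{1..Suc K}. (al l)\<^sup>2) = 0" using True by (simp add: Qp_def del: sum.cl_ivl_Suc)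
      then have "\<forall>l\<in>{1..Suc K}. (al l)\<^sup>2 = 0" by (subst (asm) sum_nonneg_eq_0_iff) auto
      then show ?thesis using i0 by (simp add: cenc_def del: sum.cl_ivl_Suc)
    next
      case False then show ?thesis using True by (simp add: Qp_def cenc_def)
    qed
    then show ?thesis using P[OF i] True by auto
  next
    case False
    then have Q: "Qp i < Pw i" using P[OF i] by auto
    define d where "d = real N * (Pw i - Qp i)"
    have d: "d > 0" using Q N by (simp add: d_def)
    define am' where "am' m = (\<Sum>t<N. (cmod (cenc x i m t))\<^sup>2) - real N * Qp i" for m
    have Mi: "real (M i) > 0" using M_pos[OF i] by simp
    have "ennreal (cp i * (\<Sum>m<M i. pw i m x)) \<le> ennreal 1"
      using T2[OF i] cp[of i] by (simp add: pw_def sum_nonneg ennreal_mult)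
    then have "cp i * (\<Sum>m<M i. pw i m x) \<le> 1"
      by (subst (asm) ennreal_le_iff) auto
    then have a: "(\<Sum>m<M i. (am' m)\<^sup>2) \<le> real (M i) * d\<^sup>2"
      using False Mi d by (simp add: cp_def pw_def am'_def d_def[symmetric] field_simps)
    \<comment> \<open>By Cauchy-Schwarz the mean square controls the mean deviation, which suffices
      because the power constraint averages over messages.\<close>
    have "(\<Sum>m<M i. am' m)\<^sup>2 \<le> real (M i) * (\<Sum>m<M i. (am' m)\<^sup>2)"
      using Cauchy_Schwarz_ineq_sum[of "\<lambda>_. 1" am' "{..<M i}"] by simp
    also have "\<dots> \<le> real (M i) * (real (M i) * d\<^sup>2)"
      by (rule mult_left_mono[OF a]) simp
    finally have "(\<Sum>m<M i. am' m)\<^sup>2 \<le> real (M i) * (real (M i) * d\<^sup>2)" .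
    then have "(\<Sum>m<M i. am' m)\<^sup>2 \<le> (real (M i) * d)\<^sup>2" by (simp add: power2_eq_square mult_ac)
    then have "(\<Sum>m<M i. am' m) \<le> real (M i) * d" by (rule power2_le_imp_le) (use Mi d in simp)
    then have "(\<Sum>m<M i. \<Sum>t<N. (cmod (cenc x i m t))\<^sup>2) \<le> real (M i) * (real N * Pw i)"
      by (simp add: am'_def sum_subtractf d_def algebra_simps)
    then show ?thesis using Mi by (simp add: divide_le_eq mult.commute)
  qed
  ultimately have "good_code K hdir hc Pw n0 N M (cenc x) (cdec x) eps"
    unfolding good_code_def using M_pos decm by blast
  then show ?thesis by blast
qed

end

section \<open>Layer rates and the capacity region\<close>

text \<open>\<open>b l\<close> is the total rate of the layers of user 0 above layer \<open>l\<close>. The constraints bound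
  \<open>b l\<close> from above by \<open>b i\<close> for \<open>i > l\<close>, so the largest solution is a minimum over the chains
  \<open>l < i\<^sub>1 < \<dots> < i\<^sub>m\<close>, i.e. over the sets of the outer bound.\<close>
lemma rate_chain_exists:
  fixes K :: nat and snr inr r :: "nat \<Rightarrow> real"
  assumes snr: "\<And>i. i \<le> K \<Longrightarrow> snr i \<ge> 0" and inr: "\<And>i. 1 \<le> i \<Longrightarrow> i \<le> K \<Longrightarrow> inr i > 1"
    and mono: "\<And>i j. 1 \<le> i \<Longrightarrow> i \<le> j \<Longrightarrow> j \<le> K \<Longrightarrow> inr i \<le> inr j"
    and rK: "\<And>i. i \<le> K \<Longrightarrow> r i \<le> log 2 (1 + snr i)"
    and sumb: "\<And>S ss. S \<subseteq> {1..K} \<Longrightarrow> S \<noteq> {} \<Longrightarrow> ss = sorted_list_of_set S \<Longrightarrow> r 0 + (\<Sum>i\<in>S. r i) \<le>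
       log 2 (1 + snr 0 / (1 + inr (ss ! (length ss - 1)))) + log 2 (1 + snr (ss ! 0) + inr (ss ! 0))
      + (\<Sum>j\<in>{1..<length ss}. log 2 (1 + snr (ss ! j) + inr (ss ! j) / (1 + inr (ss ! (j - 1)))))"
  defines "io \<equiv> \<lambda>l. if l = 0 then 1 else inr l"
  defines "A \<equiv> \<lambda>l. log 2 (1 + snr 0 / io l)" and "C \<equiv> \<lambda>i l. log 2 (1 + (snr i + io i / io l - 1) / 2)"
    and "\<rho> \<equiv> \<lambda>i. max (r i - 1) 0"
  shows "\<exists>b. (\<forall>l\<le>K. b l \<le> A l) \<and> (\<forall>i\<le>K. \<forall>l\<le>i. 1 \<le> i \<longrightarrow> b l + \<rho> i \<le> b i + C i l) \<and>
     (\<forall>l l'. l \<le> l' \<and> l' \<le> K \<longrightarrow> b l' \<le> b l) \<and> b K \<ge> 0 \<and> b 0 \<ge> r 0 - real K"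
proof -
  have io: "io l \<ge> 1" if "l \<le> K" for l using inr[of l] that by (auto simp: io_def)
  have iom: "io l \<le> io l'" if "l \<le> l'" "l' \<le> K" for l l'
    using mono[of l l'] inr[of l'] that by (auto simp: io_def)
  \<comment> \<open>The bound on \<open>b l\<close> obtained by following the constraints along the
    chain \<open>is\<close> and ending with the bound \<open>A\<close> at its last element.\<close>
  define V where "V = rec_list A (\<lambda>i is f l. C i l - \<rho> i + f i)"
  have V0: "V [] l = A l" and V1: "V (i # is) l = C i l - \<rho> i + V is i" for i "is" l by (simp_all add: V_def)
  define valid where "valid l is \<longleftrightarrow> sorted_wrt (<) (l # is) \<and> set is \<subseteq> {..K}" for l :: nat and "is"
  have fin: "finite {is. valid l is}" for l
  proof (rule finite_subset)
    show "{is. valid l is} \<subseteq> {is. set is \<subseteq> {..K} \<and> length is \<le> card {..K}}"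
    proof
      fix "is" assume "is \<in> {is. valid l is}"
      then have v: "sorted_wrt (<) is" "set is \<subseteq> {..K}" by (auto simp: valid_def)
      then have "distinct is" by (simp add: strict_sorted_iff)
      then have "length is \<le> card {..K}" using v card_mono[OF _ v(2)] distinct_card by fastforce
      then show "is \<in> {is. set is \<subseteq> {..K} \<and> length is \<le> card {..K}}" using v by simp
    qed
    show "finite {is. set is \<subseteq> {..K} \<and> length is \<le> card {..K}}" by (rule finite_lists_length_le) simp
  qed
  have vNil: "valid l []" for l by (simp add: valid_def)
  define b where "b l = Min ((\<lambda>is. V is l) ` {is. valid l is})" for l
  have b_le: "b l \<le> V is l" if "valid l is" for l "is"
    unfolding b_def by (rule Min_le) (use fin that in auto)
  have b_ex: "\<exists>is. valid l is \<and> b l = V is l" for l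
  proof -
    have "b l \<in> (\<lambda>is. V is l) ` {is. valid l is}"
      unfolding b_def by (rule Min_in) (use fin vNil in auto)
    then show ?thesis by auto
  qed
  have C_mono: "C i l' \<le> C i l" if "l \<le> l'" "l' \<le> i" "i \<le> K" for i l l'
  proof -
    have "io i / io l' \<le> io i / io l" using iom[OF that(1)] io[of l] io[of i] that by (intro divide_left_mono) auto
    moreover have "1 \<le> io i / io l'" using iom[OF that(2,3)] io[of l'] that by simp
    moreover have "log 2 (1 + (a + x - 1) / 2) \<le> log 2 (1 + (a + y - 1) / 2)" if "x \<le> y" "1 \<le> x" "0 \<le> a" for a x y :: real
      using that by (intro log_mono) (auto simp: field_simps)
    ultimately show ?thesis unfolding C_def using snr[OF that(3)] by blast
  qed
  \<comment> \<open>The bit subtracted in \<open>\<rho> i\<close> pays for the halved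
    signal-to-noise ratio of the own message. Chain links thus never contribute a negative amount,
    on which the monotonicity of \<open>b\<close> rests.\<close>
  have C_rho: "\<rho> i \<le> C i l" if "l \<le> i" "i \<le> K" for i l
  proof -
    have "C i i = log 2 (1 + snr i / 2)" using io[OF that(2)] by (simp add: C_def)
    moreover have "log 2 (1 + snr i) - 1 \<le> log 2 (1 + snr i / 2)"
    proof -
      have "log 2 (1 + snr i) - 1 = log 2 ((1 + snr i) / 2)" using snr[OF that(2)] by (simp add: log_divide)
      also have "\<dots> \<le> log 2 (1 + snr i / 2)" using snr[OF that(2)] by (simp add: field_simps)
      finally show ?thesis .
    qed
    moreover have "0 \<le> log 2 (1 + snr i / 2)" using snr[OF that(2)] by simp
    ultimately have "\<rho> i \<le> C i i" using rK[OF that(2)] by (simp add: \<rho>_def)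
    then show ?thesis using C_mono[OF that(1) order.refl that(2)] by linarith
  qed
  have A_mono: "A l' \<le> A l" if "l \<le> l'" "l' \<le> K" for l l'
  proof -
    have "snr 0 / io l' \<le> snr 0 / io l" using iom[OF that] io[of l] snr[of 0] that by (intro divide_left_mono) auto
    moreover have "0 \<le> snr 0 / io l'" using io[of l'] snr[of 0] that by simp
    ultimately show ?thesis unfolding A_def by simp
  qed
  \<comment> \<open>A chain from \<open>l\<close> is cut at \<open>l'\<close>: the elements up to
    \<open>l'\<close> contribute nonnegative amounts and are dropped, and the first one beyond
    \<open>l'\<close> contributes no more when seen from \<open>l'\<close>.\<close>
  have Vb: "b l' \<le> V is l" if "valid l is" "l \<le> l'" "l' \<le> K" for l l' "is"
    using that
  proof (induction "is" arbitrary: l)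
    case Nil
    have "b l' \<le> A l'" using b_le[OF vNil, of l'] by (simp add: V0)
    then show ?case using A_mono[OF Nil(2,3)] by (simp add: V0)
  next
    case (Cons i js)
    have i: "l < i" "i \<le> K" and vi: "valid i js" using Cons.prems(1) by (auto simp: valid_def)
    show ?case
    proof (cases "i \<le> l'")
      case True
      have "b l' \<le> V js i" by (rule Cons.IH[OF vi True Cons.prems(3)])
      moreover have "\<rho> i \<le> C i l" using C_rho[of l i] i by simp
      ultimately show ?thesis by (simp add: V1)
    next
      case False
      then have "valid l' (i # js)" using Cons.prems(1) by (auto simp: valid_def)
      then have "b l' \<le> C i l' - \<rho> i + V js i" using b_le by (fastforce simp: V1)
      moreover have "C i l' \<le> C i l" using C_mono[of l l' i] False i Cons.prems by simp
      ultimately show ?thesis by (simp add: V1)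
    qed
  qed
  have bmono: "b l' \<le> b l" if "l \<le> l'" "l' \<le> K" for l l'
    using b_ex[of l] Vb that by auto
  have bA: "b l \<le> A l" for l using b_le[OF vNil, of l] by (simp add: V0)
  have bC: "b l + \<rho> i \<le> b i + C i l" if "l \<le> i" "i \<le> K" "1 \<le> i" for l i
  proof (cases "l = i")
    case True then show ?thesis using C_rho[of i i] that by simp
  next
    case False
    obtain js where js: "valid i js" "b i = V js i" using b_ex by blast
    then have "valid l (i # js)" using False that by (auto simp: valid_def)
    from b_le[OF this] show ?thesis using js by (simp add: V1)
  qed
  have bK: "b K \<ge> 0"
  proof -
    obtain js where js: "valid K js" "b K = V js K" using b_ex by blast
    have "js = []"
    proof (cases js)
      case (Cons j k) then show ?thesis using js(1) by (auto simp: valid_def)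
    qed
    moreover have "A K \<ge> 0"
    proof -
      have "0 \<le> snr 0 / io K" using snr[of 0] io[of K] by (intro divide_nonneg_nonneg) auto
      then show ?thesis by (simp add: A_def)
    qed
    ultimately show ?thesis using js by (simp add: V0)
  qed

  \<comment> \<open>The same recursion with the terms of the outer bound; the argument
    \<open>p\<close> is the INR of the preceding receiver, 0 at the start.\<close>
  define V' where "V' = rec_list (\<lambda>p. log 2 (1 + snr 0 / (1 + p))) (\<lambda>i is f p. log 2 (1 + snr i + inr i / (1 + p)) - max (r i) 0 + f (inr i))"
  have V'0: "V' [] p = log 2 (1 + snr 0 / (1 + p))"
    and V'1: "V' (i # is) p = log 2 (1 + snr i + inr i / (1 + p)) - max (r i) 0 + V' is (inr i)" for i "is" p by (simp_all add: V'_def)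
  \<comment> \<open>Each link loses at most one bit, from the factor 1/2 in \<open>C\<close>.
    Replacing \<open>1 + p\<close> by \<open>io l\<close> in the denominators can only help.\<close>
  have VV': "V' is (if l = 0 then 0 else inr l) - real (length is) \<le> V is l" if "valid l is" "l \<le> K" for l "is"
    using that
  proof (induction "is" arbitrary: l)
    case Nil
    have "snr 0 / (1 + (if l = 0 then 0 else inr l)) \<le> snr 0 / io l"
      using io[OF Nil(2)] snr[of 0] by (auto simp: io_def intro!: divide_left_mono)
    moreover have "0 \<le> snr 0 / (1 + (if l = 0 then 0 else inr l))" using io[OF Nil(2)] snr[of 0] by (auto simp: io_def split: if_splits)
    ultimately show ?case by (simp add: V0 V'0 A_def)
  next
    case (Cons i js)
    have i: "l < i" "i \<le> K" and vi: "valid i js" using Cons.prems(1) by (auto simp: valid_def)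
    have i0: "i \<noteq> 0" using i by simp
    have "V' js (inr i) - real (length js) \<le> V js i" using Cons.IH[OF vi i(2)] i0 by simp
    moreover have "log 2 (1 + snr i + inr i / (1 + (if l = 0 then 0 else inr l))) - 1 \<le> C i l"
    proof -
      have "inr i / (1 + (if l = 0 then 0 else inr l)) \<le> inr i / io l"
        using io[OF Cons.prems(2)] io[OF i(2)] i0 by (auto simp: io_def intro!: divide_left_mono split: if_splits)
      moreover have "0 \<le> inr i / (1 + (if l = 0 then 0 else inr l))"
        using io[OF Cons.prems(2)] io[OF i(2)] i0 by (auto simp: io_def split: if_splits)
      ultimately have "log 2 (1 + snr i + inr i / (1 + (if l = 0 then 0 else inr l))) \<le> log 2 (1 + snr i + inr i / io l)"
        using snr[OF i(2)] by simp
      moreover have "C i l = log 2 (1 + snr i + inr i / io l) - 1"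
      proof -
        have e: "1 + (snr i + io i / io l - 1) / 2 = (1 + snr i + inr i / io l) / 2" using i0 by (simp add: io_def field_simps)
        have "0 < 1 + snr i + inr i / io l" using snr[OF i(2)] io[OF i(2)] io[OF Cons.prems(2)] i0 by (simp add: io_def add_pos_nonneg)
        then show ?thesis unfolding C_def e by (subst log_divide) auto
      qed
      ultimately show ?thesis by simp
    qed
    moreover have "\<rho> i \<le> max (r i) 0" by (simp add: \<rho>_def)
    ultimately show ?case by (simp add: V1 V'1)
  qed
  \<comment> \<open>Deleting an element of INR \<open>q\<close> exposes its successor to the lower
    level \<open>p\<close>. The resulting growth is at most \<open>log 2 (1 + q / (1 + p))\<close>,
    which the term of the deleted element dominates.\<close>
  have drop: "V' is p \<le> V' is q + log 2 (1 + q / (1 + p))" if p: "p \<ge> 0" and q: "q \<ge> 0" and "set is \<subseteq> {1..K}" for p q "is"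
  proof -
    have key: "log 2 (a + s / (1 + p)) \<le> log 2 (a + s / (1 + q)) + log 2 (1 + q / (1 + p))" if "s \<ge> 0" "a \<ge> 1" for s a :: real
    proof -
      have f: "1 + q / (1 + p) = (1 + p + q) / (1 + p)" using p by (simp add: field_simps)
      have "s / (1 + p) = s / (1 + q) * ((1 + q) / (1 + p))" using q by simp
      also have "\<dots> \<le> s / (1 + q) * (1 + q / (1 + p))"
        unfolding f using that p q by (intro mult_left_mono divide_right_mono) auto
      finally have "a + s / (1 + p) \<le> a + s / (1 + q) * (1 + q / (1 + p))" by simp
      also have "\<dots> \<le> a * (1 + q / (1 + p)) + s / (1 + q) * (1 + q / (1 + p))"
        using that p q by (simp add: distrib_left)
      finally have "a + s / (1 + p) \<le> (a + s / (1 + q)) * (1 + q / (1 + p))" by (simp add: distrib_right)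
      moreover have pos: "a + s / (1 + p) > 0" "a + s / (1 + q) > 0" "1 + q / (1 + p) > 0"
        using that p q by (auto intro!: add_pos_nonneg)
      ultimately have "log 2 (a + s / (1 + p)) \<le> log 2 ((a + s / (1 + q)) * (1 + q / (1 + p)))" by simp
      then show ?thesis using pos by (simp add: log_mult)
    qed
    show ?thesis
    proof (cases "is")
      case Nil then show ?thesis using key[of "snr 0" 1] snr[of 0] by (simp add: V'0)
    next
      case (Cons i js)
      then have "i \<in> {1..K}" using that by simp
      then have "inr i \<ge> 0" "snr i \<ge> 0" using inr[of i] snr[of i] by auto
      then show ?thesis using key[of "inr i" "1 + snr i"] Cons by (simp add: V'1)
    qed
  qed
  \<comment> \<open>Rates in the outer region may be negative, while chains charge positive parts.
    On the users with positive rates both agree, so the sum constraint of just this subset is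
    used.\<close>
  have filt: "V' (filter (\<lambda>i. r i > 0) is) p \<le> V' is p" if "set is \<subseteq> {1..K}" "p \<ge> 0" for "is" p
    using that
  proof (induction "is" arbitrary: p)
    case Nil then show ?case by simp
  next
    case (Cons i js)
    have i: "i \<in> {1..K}" using Cons.prems by simp
    then have nn: "inr i \<ge> 0" "snr i \<ge> 0" using inr[of i] snr[of i] by auto
    have IH: "V' (filter (\<lambda>i. r i > 0) js) q \<le> V' js q" if "q \<ge> 0" for q using Cons.IH that Cons.prems by simp
    show ?case
    proof (cases "r i > 0")
      case True then show ?thesis using IH[OF nn(1)] by (simp add: V'1)
    next
      case False
      have "V' (filter (\<lambda>i. r i > 0) js) p \<le> V' js p" by (rule IH[OF Cons.prems(2)])
      also have "\<dots> \<le> V' js (inr i) + log 2 (1 + inr i / (1 + p))"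
        by (rule drop) (use Cons.prems nn in auto)
      also have "log 2 (1 + inr i / (1 + p)) \<le> log 2 (1 + snr i + inr i / (1 + p))"
      proof -
        have "0 \<le> inr i / (1 + p)" using nn Cons.prems by simp
        then show ?thesis using nn by simp
      qed
      finally show ?thesis using False by (simp add: V'1)
    qed
  qed
  have unf: "V' ss p = log 2 (1 + snr 0 / (1 + inr (ss ! (length ss - 1)))) + log 2 (1 + snr (ss ! 0) + inr (ss ! 0) / (1 + p))
      + (\<Sum>j\<in>{1..<length ss}. log 2 (1 + snr (ss ! j) + inr (ss ! j) / (1 + inr (ss ! (j - 1))))) - (\<Sum>i\<leftarrow>ss. max (r i) 0)"
    if "ss \<noteq> []" for ss p
    using that
  proof (induction ss arbitrary: p)
    case (Cons i js)
    show ?case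
    proof (cases js)
      case Nil then show ?thesis by (simp add: V'1 V'0)
    next
      case (Cons j ks)
      then have ne: "js \<noteq> []" by simp
      let ?f = "\<lambda>ss j. log 2 (1 + snr (ss ! j) + inr (ss ! j) / (1 + inr (ss ! (j - 1))))"
      have "{1..<length (i # js)} = insert 1 (Suc ` {1..<length js})"
        using ne by (auto simp: image_Suc_atLeastLessThan)
      then have "(\<Sum>k\<in>{1..<length (i # js)}. ?f (i # js) k) = ?f (i # js) 1 + (\<Sum>k\<in>Suc ` {1..<length js}. ?f (i # js) k)"
        by (simp add: image_Suc_atLeastLessThan)
      also have "(\<Sum>k\<in>Suc ` {1..<length js}. ?f (i # js) k) = (\<Sum>k\<in>{1..<length js}. ?f js k)"
        by (subst sum.reindex) (auto intro!: sum.cong simp: nth_Cons')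
      finally have s: "(\<Sum>k\<in>{1..<length (i # js)}. ?f (i # js) k) = log 2 (1 + snr (js ! 0) + inr (js ! 0) / (1 + inr i)) + (\<Sum>k\<in>{1..<length js}. ?f js k)"
        by simp
      have "(i # js) ! (length (i # js) - 1) = js ! (length js - 1)" using ne by (simp add: nth_Cons')
      then show ?thesis unfolding V'1 s Cons.IH[OF ne] by simp
    qed
  qed simp
  have b0: "b 0 \<ge> r 0 - real K"
  proof -
    obtain "is" where "is": "valid 0 is" "b 0 = V is 0" using b_ex by blast
    have sub: "set is \<subseteq> {1..K}" and srt: "sorted_wrt (<) is" using "is"(1) by (auto simp: valid_def Suc_le_eq)
    have "length is = card (set is)" using srt by (simp add: strict_sorted_iff distinct_card)
    also have "\<dots> \<le> card {1..K}" by (rule card_mono[OF _ sub]) simp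
    finally have len: "length is \<le> K" by simp
    define fl where "fl = filter (\<lambda>i. r i > 0) is"
    have fsub: "set fl \<subseteq> {1..K}" using sub by (auto simp: fl_def)
    have fs: "sorted_wrt (<) fl" unfolding fl_def by (rule sorted_wrt_filter[OF srt])
    have fls: "fl = sorted_list_of_set (set fl)" using fs by (metis strict_sorted_iff sorted_list_of_set.idem_if_sorted_distinct)
    have "r 0 \<le> V' fl 0"
    proof (cases "fl = []")
      case True then show ?thesis using rK[of 0] by (simp add: V'0)
    next
      case False
      then have "r 0 + (\<Sum>i\<in>set fl. r i) \<le> log 2 (1 + snr 0 / (1 + inr (fl ! (length fl - 1)))) + log 2 (1 + snr (fl ! 0) + inr (fl ! 0))
      + (\<Sum>j\<in>{1..<length fl}. log 2 (1 + snr (fl ! j) + inr (fl ! j) / (1 + inr (fl ! (j - 1)))))"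
        by (intro sumb[OF fsub _ fls]) simp
      moreover have "(\<Sum>i\<leftarrow>fl. max (r i) 0) = (\<Sum>i\<in>set fl. r i)"
      proof -
        have "(\<Sum>i\<leftarrow>fl. max (r i) 0) = (\<Sum>i\<in>set fl. max (r i) 0)"
          using fs by (simp add: strict_sorted_iff sum_list_distinct_conv_sum_set)
        also have "\<dots> = (\<Sum>i\<in>set fl. r i)" by (rule sum.cong) (auto simp: fl_def)
        finally show ?thesis .
      qed
      ultimately show ?thesis unfolding unf[OF False] by simp
    qed
    also have "\<dots> \<le> V' is 0" unfolding fl_def by (rule filt[OF sub]) simp
    also have "\<dots> \<le> b 0 + real (length is)" using VV'[OF "is"(1)] "is"(2) by simp
    finally show ?thesis using len by simp
  qed
  show ?thesis by (rule exI[of _ b]) (use bA bC bmono bK b0 in blast)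
qed

section \<open>Power allocation and block-length asymptotics\<close>

text \<open>The layers above \<open>l\<close> receive total power proportional to
  \<open>1 / io l\<close>, so at receiver \<open>l \<ge> 1\<close> they arrive just below the noise
  level. The hypotheses on \<open>b\<close> then say that, for each level of agreement, the rate of
  wrong candidates stays below the exponent of their pairwise error.\<close>

lemma superposition_achievable:
  fixes K :: nat and hdir hc :: "nat \<Rightarrow> complex" and P :: "nat \<Rightarrow> real" and n0 \<delta> r0 :: real and b \<rho> :: "nat \<Rightarrow> real"
  defines "snr \<equiv> SNR hdir P n0" and "inr \<equiv> INR hc P n0"
  defines "io \<equiv> \<lambda>l. if l = 0 then 1 else inr l"
  assumes n0: "n0 > 0" and P: "\<And>i. i \<le> K \<Longrightarrow> P i \<ge> 0" and P0: "P 0 > 0"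
    and inr: "\<And>i. 1 \<le> i \<Longrightarrow> i \<le> K \<Longrightarrow> inr i > 1"
    and mono: "\<And>i j. 1 \<le> i \<Longrightarrow> i \<le> j \<Longrightarrow> j \<le> K \<Longrightarrow> inr i \<le> inr j"
    and bA: "\<And>l. l \<le> K \<Longrightarrow> b l \<le> log 2 (1 + snr 0 / io l)"
    and bC: "\<And>i l. 1 \<le> i \<Longrightarrow> i \<le> K \<Longrightarrow> l \<le> i \<Longrightarrow> b l + \<rho> i \<le> b i + log 2 (1 + (snr i + io i / io l - 1) / 2)"
    and bmono: "\<And>l l'. l \<le> l' \<Longrightarrow> l' \<le> K \<Longrightarrow> b l' \<le> b l"
    and r0: "r0 \<le> b 0" and \<delta>: "\<delta> > 0"
  shows "(\<lambda>i. if i = 0 then max (r0 - 2 * \<delta>) 0 else if i \<le> K then max (\<rho> i - \<delta>) 0 else 0) \<in> achievable K hdir hc P n0"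
proof -
  define rd where "rd i = (if i = 0 then max (r0 - 2 * \<delta>) 0 else if i \<le> K then max (\<rho> i - \<delta>) 0 else 0)" for i
  \<comment> \<open>The margin \<delta> is spent in three parts: the power scaling
    \<open>\<theta>\<close> costs \<delta>/4 bits per symbol, the typicality slack
    \<open>\<eta>\<close> (in nats) another \<delta>/4, and the remaining \<delta>/2 is the
    exponential decay with base \<open>q\<close>.\<close>
  define \<theta> :: real where "\<theta> = 2 powr (- \<delta> / 4)"
  define \<eta> where "\<eta> = \<delta> * ln 2 / 4"
  define q :: real where "q = 2 powr (- \<delta> / 2)"
  have \<theta>: "0 < \<theta>" "\<theta> < 1" using \<delta> powr_less_mono[of "- \<delta> / 4" 0 "2::real"] by (auto simp: \<theta>_def)
  have \<eta>: "\<eta> > 0" using \<delta> by (simp add: \<eta>_def)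
  have q: "0 < q" "q < 1" using \<delta> powr_less_mono[of "- \<delta> / 2" 0 "2::real"] by (auto simp: q_def)
  have io: "io l \<ge> 1" if "l \<le> K" for l using inr[of l] that by (auto simp: io_def)
  have iom: "io l \<le> io l'" if "l \<le> l'" "l' \<le> K" for l l'
    using mono[of l l'] inr[of l'] that by (auto simp: io_def)
  \<comment> \<open>Fraction of the power of user 0 in the layers above \<open>l\<close>. It
    vanishes beyond \<open>K\<close>, so layer \<open>K + 1\<close> takes all that remains.\<close>
  define jj where "jj l = (if l \<le> K then 1 / io l else 0)" for l
  have jjm: "jj l' \<le> jj l" if "l \<le> l'" for l l'
    using iom[OF that] io[of l] io[of l'] that by (auto simp: jj_def intro!: divide_left_mono)
  define al where "al k = sqrt (\<theta> * P 0 * (jj (k - 1) - jj k))" for k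
  define am where "am i = sqrt (\<theta> * P i)" for i
  have al2: "(al k)\<^sup>2 = \<theta> * P 0 * (jj (k - 1) - jj k)" for k
    using jjm[of "k - 1" k] \<theta> P0 by (simp add: al_def)
  have am2: "(am i)\<^sup>2 = \<theta> * P i" if "i \<le> K" for i using P[OF that] \<theta> by (simp add: am_def)
  have tel: "(\<Sum>k\<in>{Suc l..m}. (al k)\<^sup>2) = \<theta> * P 0 * (jj l - jj m)" if "l \<le> m" for l m
    using that
  proof (induction m rule: dec_induct)
    case base then show ?case by simp
  next
    case (step m)
    have "{Suc l..Suc m} = insert (Suc m) {Suc l..m}" using step.hyps by auto
    then show ?case using step by (simp add: al2 algebra_simps)
  qed
  define a1 :: real where "a1 = 2 ^ (K + 2) * (64 * (real (2 * K + 4))\<^sup>2 / \<eta>\<^sup>2)"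
  define a2 :: real where "a2 = (\<Sum>i\<le>K. 16 * (real (2 * K + 4))\<^sup>2 * (\<theta> * P i)\<^sup>2 / (P i - \<theta> * P i)\<^sup>2)"
  have "\<exists>N0. \<forall>N\<ge>N0. \<exists>M enc dec. (\<forall>i\<le>K. real (M i) \<ge> 2 powr (real N * rd i)) \<and> good_code K hdir hc P n0 N M enc dec eps"
    if eps: "eps > 0" for eps
  proof -
    define F where "F N = (real (K + 1) * (a1 / real N + real (K + 2) * (2 * q ^ N))) / eps + a2 / real N" for N :: nat
    have "F \<longlonglongrightarrow> (real (K + 1) * (0 + real (K + 2) * (2 * 0))) / eps + 0"
      unfolding F_def using eps q by (intro tendsto_intros lim_const_over_n) auto
    then have "eventually (\<lambda>N. F N < 1) sequentially" by (intro order_tendstoD) auto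
    \<comment> \<open>Makes a margin of \<delta> per symbol worth at least one bit per block, which
      pays for rounding \<open>kk 0\<close> down; hence the \<open>2 * \<delta>\<close> in the rate
      of user 0.\<close>
    moreover have "eventually (\<lambda>N. real N \<ge> 1 / \<delta>) sequentially"
      by (intro eventually_sequentiallyI[of "nat \<lceil>1 / \<delta>\<rceil>"]) linarith
    ultimately have "eventually (\<lambda>N. F N < 1 \<and> real N \<ge> 1 / \<delta>) sequentially" by (rule eventually_conj)
    then obtain N0 where N0: "\<And>N. N \<ge> N0 \<Longrightarrow> F N < 1 \<and> real N \<ge> 1 / \<delta>" unfolding eventually_sequentially by blast
    have "\<exists>M enc dec. (\<forall>i\<le>K. real (M i) \<ge> 2 powr (real N * rd i)) \<and> good_code K hdir hc P n0 N M enc dec eps" if "N \<ge> N0" for N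
    proof -
      have FN: "F N < 1" and N\<delta>: "real N * \<delta> \<ge> 1" using N0[OF that] \<delta> by (auto simp: field_simps)
      have N: "N > 0" using N\<delta> by (cases N) auto
      \<comment> \<open>The bits of user 0 left to the layers above \<open>l\<close>, at rate
        \<open>b l - \<delta>\<close>. Layer \<open>K + 1\<close> completes the message, hence 0
        beyond \<open>K\<close>.\<close>
      define kk where "kk l = (if l \<le> K then nat \<lfloor>real N * max (b l - \<delta>) 0\<rfloor> else 0)" for l
      define M where "M i = (if i = 0 then 2 ^ kk 0 else nat \<lceil>2 powr (real N * rd i)\<rceil>)" for i
      have kk_up: "real (kk l) \<le> real N * max (b l - \<delta>) 0" if "l \<le> K" for l
        using that by (simp add: kk_def)
      have kk_lo: "real (kk l) \<ge> real N * max (b l - \<delta>) 0 - 1" if "l \<le> K" for l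
        using that by (simp add: kk_def)
      have kkm: "kk l' \<le> kk l" if "l \<le> l'" for l l'
      proof (cases "l' \<le> K")
        case True
        then have "real N * max (b l' - \<delta>) 0 \<le> real N * max (b l - \<delta>) 0"
          using bmono[OF that True] by (intro mult_left_mono) auto
        then show ?thesis using True that by (auto simp: kk_def intro!: nat_mono floor_mono)
      qed (simp add: kk_def)
      have Mge: "real (M i) \<ge> 2 powr (real N * rd i)" if "i \<le> K" for i
      proof (cases "i = 0")
        case True
        have "real N * rd 0 \<le> real (kk 0)"
        proof (cases "r0 - 2 * \<delta> \<le> 0")
          case True then show ?thesis by (simp add: rd_def)
        next
          case False
          have "real N * (r0 - 2 * \<delta>) \<le> real N * (b 0 - 2 * \<delta>)" using r0 by (intro mult_left_mono) auto
          also have "\<dots> \<le> real N * (b 0 - \<delta>) - 1" using N\<delta> by (simp add: algebra_simps)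
          also have "\<dots> \<le> real N * max (b 0 - \<delta>) 0 - 1" by (simp add: mult_left_mono)
          also have "\<dots> \<le> real (kk 0)" by (rule kk_lo) simp
          finally show ?thesis using False by (simp add: rd_def)
        qed
        then have "2 powr (real N * rd 0) \<le> 2 powr real (kk 0)" by simp
        then show ?thesis using True by (simp add: M_def powr_realpow)
      next
        case False
        then show ?thesis by (simp add: M_def)
      qed
      have Mpos: "M i \<ge> 1" if "i \<le> K" for i
      proof -
        have "0 < 2 powr (real N * rd i)" by simp
        then have "real (M i) > 0" using Mge[OF that] by linarith
        then show ?thesis by simp
      qed
      interpret superposition K N n0 hdir hc M kk al am
        by unfold_locales (use n0 N Mpos kkm in \<open>auto simp: M_def kk_def\<close>)
      have inrP: "(cmod (hc i))\<^sup>2 * P 0 = n0 * inr i" for i using n0 by (simp add: inr_def INR_def)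
      have snrP: "(cmod (hdir i))\<^sup>2 * P i = n0 * snr i" for i using n0 by (simp add: snr_def SNR_def)
      have snr_nn: "snr i \<ge> 0" if "i \<le> K" for i using P[OF that] n0 by (simp add: snr_def SNR_def)
      have QP: "Qp i = \<theta> * P i" if "i \<le> K" for i
      proof (cases "i = 0")
        case True
        have "(\<Sum>l\<in>{Suc 0..Suc K}. (al l)\<^sup>2) = \<theta> * P 0 * (jj 0 - jj (Suc K))" by (rule tel) simp
        then show ?thesis using True by (simp add: Qp_def jj_def io_def del: sum.cl_ivl_Suc)
      next
        case False then show ?thesis using am2[OF that] by (simp add: Qp_def)
      qed
      \<comment> \<open>The undecoded layers arrive with power \<open>\<theta> * n0\<close>, so the
        effective noise \<open>n0 * (1 + \<theta>)\<close> is at most doubled: this is the factor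
        1/2, hence the bit. Receiver 0 decodes all layers and has no such loss.\<close>
      have X: "\<theta> * (1 + (snr i + io i / io l - 1) / 2) \<le> 1 + S i l / nu i" if i: "1 \<le> i" "i \<le> K" "l \<le> i" for i l
      proof -
        have i0: "i \<noteq> 0" using i by simp
        have ioi: "io i = inr i" using i0 by (simp add: io_def)
        have pos: "io i > 0" "io l > 0" using io[of i] io[of l] i by auto
        have "S i l = (cmod (hdir i))\<^sup>2 * (\<theta> * P i) + (cmod (hc i))\<^sup>2 * (\<theta> * P 0 * (jj l - jj i))"
          using i0 tel[OF i(3)] am2[OF i(2)] by (simp add: S_def power_mult_distrib)
        also have "\<dots> = \<theta> * (((cmod (hdir i))\<^sup>2 * P i) + ((cmod (hc i))\<^sup>2 * P 0) * (jj l - jj i))" by (simp add: algebra_simps)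
        also have "\<dots> = \<theta> * n0 * (snr i + inr i * (jj l - jj i))" unfolding inrP snrP by (simp add: algebra_simps)
        also have "inr i * (jj l - jj i) = io i / io l - 1" using i pos by (simp add: jj_def ioi[symmetric] right_diff_distrib)
        finally have Si: "S i l = \<theta> * n0 * (snr i + io i / io l - 1)" by (simp add: add_diff_eq)
        have "nu i = n0 + (cmod (hc i))\<^sup>2 * (\<theta> * P 0 * (jj i - jj (Suc K)))"
          using i0 tel[of i "Suc K"] i by (simp add: nu_def del: sum.cl_ivl_Suc)
        also have "\<dots> = n0 + \<theta> * (((cmod (hc i))\<^sup>2 * P 0) * jj i)" by (simp add: jj_def algebra_simps)
        also have "\<dots> = n0 * (1 + \<theta>)" unfolding inrP using i pos by (simp add: jj_def ioi algebra_simps)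
        finally have nui: "nu i = n0 * (1 + \<theta>)" .
        define y where "y = snr i + io i / io l - 1"
        have "io i / io l \<ge> 1" using iom[OF i(3,2)] pos by simp
        then have y: "y \<ge> 0" using snr_nn[OF i(2)] by (simp add: y_def)
        have "\<theta> * y / 2 \<le> \<theta> * y / (1 + \<theta>)" using \<theta> y by (intro divide_left_mono) auto
        moreover have "S i l / nu i = \<theta> * y / (1 + \<theta>)" unfolding Si nui y_def[symmetric] using n0 by simp
        moreover have "\<theta> * (1 + y / 2) \<le> 1 + \<theta> * y / 2" using \<theta> by (simp add: algebra_simps)
        ultimately show ?thesis unfolding y_def[symmetric] by linarith
      qed
      have X0: "\<theta> * (1 + snr 0 / io l) \<le> 1 + S 0 l / nu 0" if l: "l \<le> K" for l
      proof -
        have "S 0 l = (cmod (hdir 0))\<^sup>2 * (\<theta> * P 0 * (jj l - jj (Suc K)))"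
          using tel[of l "Suc K"] l by (simp add: S_def del: sum.cl_ivl_Suc)
        also have "\<dots> = \<theta> * (((cmod (hdir 0))\<^sup>2 * P 0) * jj l)" by (simp add: jj_def algebra_simps)
        also have "\<dots> = \<theta> * n0 * (snr 0 / io l)" unfolding snrP using l by (simp add: jj_def)
        finally have "S 0 l = \<theta> * n0 * (snr 0 / io l)" .
        moreover have "nu 0 = n0" by (simp add: nu_def)
        ultimately have "S 0 l / nu 0 = \<theta> * (snr 0 / io l)" using n0 by simp
        then show ?thesis using \<theta> by (simp add: distrib_left)
      qed
      have pairb: "wr * (exp (real N * \<eta>) * (1 / x) ^ N) \<le> 2 * q ^ N"
        if wr: "0 \<le> wr" "wr \<le> 2 powr (real N * (c - \<delta>) + 1)" and x: "\<theta> * 2 powr c \<le> x" for wr x c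
      proof -
        have t0: "\<theta> * 2 powr c > 0" using \<theta> by simp
        have "exp (real N * \<eta>) = 2 powr (real N * \<delta> / 4)" by (simp add: powr_def \<eta>_def mult_ac)
        moreover have "(1 / x) ^ N \<le> (1 / (\<theta> * 2 powr c)) ^ N"
          using x t0 by (intro power_mono divide_left_mono) auto
        moreover have "(1 / (\<theta> * 2 powr c)) ^ N = 2 powr (real N * (\<delta> / 4 - c))"
        proof -
          have "\<theta> * 2 powr c = 2 powr (- (\<delta> / 4 - c))"
            unfolding \<theta>_def by (simp add: powr_add[symmetric])
          then have "1 / (\<theta> * 2 powr c) = 2 powr (\<delta> / 4 - c)"
            by (simp only: powr_minus_divide) simp
          then show ?thesis by (simp add: powr_power mult.commute)
        qed
        ultimately have "wr * (exp (real N * \<eta>) * (1 / x) ^ N) \<le> 2 powr (real N * (c - \<delta>) + 1) * (2 powr (real N * \<delta> / 4) * 2 powr (real N * (\<delta> / 4 - c)))"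
          using wr x t0 by (intro mult_mono) (auto intro!: mult_nonneg_nonneg zero_le_power)
        also have "\<dots> = 2 powr ((real N * (c - \<delta>) + 1) + (real N * \<delta> / 4 + real N * (\<delta> / 4 - c)))"
          by (simp only: powr_add)
        also have "(real N * (c - \<delta>) + 1) + (real N * \<delta> / 4 + real N * (\<delta> / 4 - c)) = 1 + (- \<delta> / 2) * real N"
          by (simp add: algebra_simps)
        also have "2 powr (1 + (- \<delta> / 2) * real N) = 2 * q ^ N"
          unfolding powr_add by (simp add: q_def powr_power mult.commute)
        finally show ?thesis .
      qed
      have wnn: "wrong i l \<ge> 0" if "i \<le> K" for i l using Mpos[OF that] by (auto simp: wrong_def intro!: mult_nonneg_nonneg)
      have terms: "wrong i l * (exp (real N * \<eta>) * (1 / (1 + S i l / nu i)) ^ N) \<le> 2 * q ^ N" if i: "i \<le> K" and l: "l \<le> (if i = 0 then Suc K else i)" for i l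
      proof (cases "i = 0")
        case True
        show ?thesis
        proof (cases "l = Suc K")
          case l: True
          show ?thesis using True l q by (simp add: wrong_def)
        next
          case False
          then have lK: "l \<le> K" using True l by simp
          show ?thesis
          proof (rule pairb[where c="log 2 (1 + snr 0 / io l)"])
            show "0 \<le> wrong i l" by (rule wnn[OF i])
            have "0 < 1 + snr 0 / io l" using snr_nn[of 0] io[OF lK] by (intro add_pos_nonneg divide_nonneg_nonneg) auto
            then show "\<theta> * 2 powr log 2 (1 + snr 0 / io l) \<le> 1 + S i l / nu i"
              using X0[OF lK] True by simp
            show "wrong i l \<le> 2 powr (real N * (log 2 (1 + snr 0 / io l) - \<delta>) + 1)"
            \<comment> \<open>Here the exponential bound may be useless, but no bits are left above
              layer \<open>l\<close>, so there is no wrong candidate.\<close>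
            proof (cases "b l \<le> \<delta>")
              case bl: True
              then have "kk l = 0" by (simp add: kk_def)
              then show ?thesis using True False by (simp add: wrong_def)
            next
              case bl: False
              have "wrong i l \<le> 2 powr real (kk l)" using True False by (simp add: wrong_def powr_realpow)
              also have "\<dots> \<le> 2 powr (real N * (log 2 (1 + snr 0 / io l) - \<delta>) + 1)"
              proof -
                have "real (kk l) \<le> real N * (b l - \<delta>)" using kk_up[OF lK] bl by simp
                also have "\<dots> \<le> real N * (log 2 (1 + snr 0 / io l) - \<delta>)" using bA[OF lK] by (intro mult_left_mono) auto
                finally show ?thesis by simp
              qed
              finally show ?thesis .
            qed
          qed
        qed
      next
        case False
        then have i1: "1 \<le> i" and li: "l \<le> i" using l by auto
        then have lK: "l \<le> K" using i by simp
        let ?c = "log 2 (1 + (snr i + io i / io l - 1) / 2)"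
        show ?thesis
        proof (rule pairb[where c="?c"])
          show "0 \<le> wrong i l" by (rule wnn[OF i])
          have "io i / io l \<ge> 1" using iom[OF li i] io[OF lK] by simp
          then have "0 < 1 + (snr i + io i / io l - 1) / 2" using snr_nn[OF i] by (intro add_pos_nonneg divide_nonneg_nonneg) auto
          then show "\<theta> * 2 powr ?c \<le> 1 + S i l / nu i" using X[OF i1 i li] by simp
          show "wrong i l \<le> 2 powr (real N * (?c - \<delta>) + 1)"
          \<comment> \<open>Similarly, user \<open>i\<close> then has a single message, and no own
            message can be wrong.\<close>
          proof (cases "\<rho> i \<le> \<delta>")
            case True
            then have "rd i = 0" using False i by (simp add: rd_def)
            then have "M i = 1" using False by (simp add: M_def)
            then show ?thesis using False by (simp add: wrong_def)
          next
            case rho: False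
            then have rdi: "rd i = \<rho> i - \<delta>" using False i by (simp add: rd_def)
            have "real (M i) - 1 \<le> 2 powr (real N * (\<rho> i - \<delta>))"
            proof -
              have "real (M i) = real_of_int \<lceil>2 powr (real N * rd i)\<rceil>" using False by (simp add: M_def)
              then show ?thesis unfolding rdi by linarith
            qed
            \<comment> \<open>Rounding enlarges the difference of \<open>kk l\<close> and
              \<open>kk i\<close> by at most one bit, whence the \<open>+ 1\<close>; taking positive
              parts does not enlarge the difference, since \<open>b i \<le> b l\<close>.\<close>
            moreover have "(2::real) ^ (kk l - kk i) \<le> 2 powr (real N * (b l - b i) + 1)"
            proof -
              have "real (kk l - kk i) = real (kk l) - real (kk i)" using kkm[OF li] by (simp add: of_nat_diff)
              also have "\<dots> \<le> real N * max (b l - \<delta>) 0 - (real N * max (b i - \<delta>) 0 - 1)"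
                using kk_up[OF lK] kk_lo[OF i] by linarith
              also have "\<dots> = real N * (max (b l - \<delta>) 0 - max (b i - \<delta>) 0) + 1" by (simp add: algebra_simps)
              also have "\<dots> \<le> real N * (b l - b i) + 1" using bmono[OF li i] by (intro add_mono mult_left_mono) auto
              finally have "2 powr real (kk l - kk i) \<le> 2 powr (real N * (b l - b i) + 1)" by simp
              then show ?thesis by (simp add: powr_realpow)
            qed
            ultimately have "wrong i l \<le> 2 powr (real N * (\<rho> i - \<delta>)) * 2 powr (real N * (b l - b i) + 1)"
              using False Mpos[OF i] by (simp add: wrong_def mult_mono)
            also have "\<dots> = 2 powr (real N * (\<rho> i - \<delta>) + (real N * (b l - b i) + 1))" by (simp only: powr_add)
            also have "real N * (\<rho> i - \<delta>) + (real N * (b l - b i) + 1) = real N * (\<rho> i + b l - b i - \<delta>) + 1" by (simp add: algebra_simps)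
            also have "2 powr (real N * (\<rho> i + b l - b i - \<delta>) + 1) \<le> 2 powr (real N * (?c - \<delta>) + 1)"
              using bC[OF i1 i li] by (simp add: mult_left_mono)
            finally show ?thesis .
          qed
        qed
      qed
      have beta_le: "beta i \<eta> \<le> a1 / real N + real (K + 2) * (2 * q ^ N)" if i: "i \<le> K" for i
      proof -
        have "(\<Sum>l\<le>dl i. wrong i l * (exp (real N * \<eta>) * (1 / (1 + S i l / nu i)) ^ N)) \<le> (\<Sum>l\<le>dl i. 2 * q ^ N)"
          by (intro sum_mono terms i) simp
        also have "\<dots> = real (Suc (dl i)) * (2 * q ^ N)" by simp
        also have "\<dots> \<le> real (K + 2) * (2 * q ^ N)" using i q by (intro mult_right_mono) auto
        finally have "(\<Sum>l\<le>dl i. wrong i l * (exp (real N * \<eta>) * (1 / (1 + S i l / nu i)) ^ N)) \<le> real (K + 2) * (2 * q ^ N)" .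
        moreover have "2 ^ (K + 2) * (64 * (real (2 * K + 4))\<^sup>2 / (real N * \<eta>\<^sup>2)) = a1 / real N" by (simp add: a1_def)
        ultimately show ?thesis unfolding beta_def by linarith
      qed
      have "\<exists>x. good_code K hdir hc P n0 N M (cenc x) (cdec x) eps"
      proof (rule good_code_exists[OF \<eta> eps])
        fix i assume i: "i \<le> K"
        show "(Qp i = 0 \<and> P i \<ge> 0) \<or> Qp i < P i"
          using P[OF i] \<theta> QP[OF i] by (cases "P i = 0") auto
      next
        have "(\<Sum>i\<le>K. beta i \<eta>) \<le> (\<Sum>i\<le>K. a1 / real N + real (K + 2) * (2 * q ^ N))"
          by (intro sum_mono beta_le) auto
        also have "\<dots> = real (K + 1) * (a1 / real N + real (K + 2) * (2 * q ^ N))" by simp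
        finally have "(\<Sum>i\<le>K. beta i \<eta>) / eps \<le> (real (K + 1) * (a1 / real N + real (K + 2) * (2 * q ^ N))) / eps"
          using eps by (intro divide_right_mono) auto
        moreover have "(\<Sum>i\<le>K. 16 * (real (2 * K + 4))\<^sup>2 * (Qp i)\<^sup>2 / (real N * (P i - Qp i)\<^sup>2)) = a2 / real N"
          unfolding a2_def sum_divide_distrib by (intro sum.cong refl) (simp add: QP mult.commute)
        ultimately show "(\<Sum>i\<le>K. beta i \<eta>) / eps + (\<Sum>i\<le>K. 16 * (real (2 * K + 4))\<^sup>2 * (Qp i)\<^sup>2 / (real N * (P i - Qp i)\<^sup>2)) < 1"
          using FN unfolding F_def by linarith
      qed
      then show ?thesis using Mge by blast
    qed
    then show ?thesis by blast
  qed
  moreover have "\<forall>i>K. rd i = 0" "\<forall>i\<le>K. rd i \<ge> 0" by (auto simp: rd_def)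
  ultimately have "rd \<in> achievable K hdir hc P n0" unfolding achievable_def by blast
  then show ?thesis unfolding rd_def .
qed

theorem theorem4:
  fixes K :: nat and hdir hc :: "nat \<Rightarrow> complex" and P :: "nat \<Rightarrow> real" and n0 :: real
  assumes "K \<ge> 1" and "n0 > 0" and "\<forall>i\<le>K. P i \<ge> 0"
    and "\<forall>i. 1 \<le> i \<and> i < K \<longrightarrow> INR hc P n0 (Suc i) > INR hc P n0 i"
    and "INR hc P n0 1 > 1"
  shows "capacity_region K hdir hc P n0 \<subseteq> outer_region K hdir hc P n0 \<and>
    (\<forall>r\<in>outer_region K hdir hc P n0.
       (\<lambda>i. if i = 0 then max (r 0 - real (2 * K + 1)) 0
            else if i \<le> K then max (r i - 1) 0 else 0) \<in> capacity_region K hdir hc P n0)"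
proof (intro conjI ballI)
  show "capacity_region K hdir hc P n0 \<subseteq> outer_region K hdir hc P n0"
    by (rule capacity_subset_outer[OF assms(2,3)])
next
  fix r assume r: "r \<in> outer_region K hdir hc P n0"
  let ?snr = "SNR hdir P n0" and ?inr = "INR hc P n0"
  let ?io = "\<lambda>l. if l = 0 then 1 else ?inr l"
  have mono: "?inr i \<le> ?inr j" if "1 \<le> i" "i \<le> j" "j \<le> K" for i j
    using that(2,1,3)
  proof (induction j rule: dec_induct)
    case (step j)
    then have "?inr j < ?inr (Suc j)" using assms(4) by auto
    then show ?case using step by simp
  qed simp
  have inr: "?inr i > 1" if "1 \<le> i" "i \<le> K" for i
    using mono[of 1 i] assms(5) that by simp
  have snr: "?snr i \<ge> 0" if "i \<le> K" for i
    using assms(2,3) that by (simp add: SNR_def)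
  have P0: "P 0 > 0"
  proof (rule ccontr)
    assume "\<not> P 0 > 0"
    then have "P 0 = 0" using assms(3) by (auto simp: less_eq_real_def)
    then show False using assms(5) by (simp add: INR_def)
  qed
  obtain b where bA: "\<forall>l\<le>K. b l \<le> log 2 (1 + ?snr 0 / ?io l)"
    and bC: "\<forall>i\<le>K. \<forall>l\<le>i. 1 \<le> i \<longrightarrow> b l + max (r i - 1) 0 \<le> b i + log 2 (1 + (?snr i + ?io i / ?io l - 1) / 2)"
    and bmono: "\<forall>l l'. l \<le> l' \<and> l' \<le> K \<longrightarrow> b l' \<le> b l" and bK: "b K \<ge> 0" and b0: "b 0 \<ge> r 0 - real K"
  proof -
    have "\<exists>b. (\<forall>l\<le>K. b l \<le> log 2 (1 + ?snr 0 / ?io l)) \<and>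
      (\<forall>i\<le>K. \<forall>l\<le>i. 1 \<le> i \<longrightarrow> b l + max (r i - 1) 0 \<le> b i + log 2 (1 + (?snr i + ?io i / ?io l - 1) / 2)) \<and>
      (\<forall>l l'. l \<le> l' \<and> l' \<le> K \<longrightarrow> b l' \<le> b l) \<and> b K \<ge> 0 \<and> b 0 \<ge> r 0 - real K"
    proof (rule rate_chain_exists)
      fix S ss assume "S \<subseteq> {1..K}" "S \<noteq> {}" "ss = sorted_list_of_set S"
      then show "r 0 + (\<Sum>i\<in>S. r i) \<le>
         log 2 (1 + ?snr 0 / (1 + ?inr (ss ! (length ss - 1)))) + log 2 (1 + ?snr (ss ! 0) + ?inr (ss ! 0))
        + (\<Sum>j\<in>{1..<length ss}. log 2 (1 + ?snr (ss ! j) + ?inr (ss ! j) / (1 + ?inr (ss ! (j - 1)))))"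
        using r unfolding outer_region_def sum_bound_def Let_def by blast
    next
      fix i assume "i \<le> K"
      then show "r i \<le> log 2 (1 + ?snr i)" using r by (simp add: outer_region_def)
    qed (use snr inr mono in auto)
    then show ?thesis using that by blast
  qed
  \<comment> \<open>The chains cost at most \<open>K\<close> bits, so
    \<open>b 0 \<ge> r 0 - K\<close> leaves room for the loss of \<open>2 * K + 1\<close>; the
    positive part is covered by \<open>b 0 \<ge> b K \<ge> 0\<close>.\<close>
  define r0 where "r0 = max (r 0 - real (2 * K + 1)) 0"
  have r0: "r0 \<le> b 0"
  proof -
    have "b K \<le> b 0" using bmono by simp
    then show ?thesis using b0 bK by (simp add: r0_def)
  qed
  \<comment> \<open>Every positive \<delta> gives an achievable tuple; \<open>f\<close> is
    continuous for the product topology, so its value at 0 lies in the closure.\<close>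
  define f where "f \<delta> = (\<lambda>i. if i = 0 then max (r0 - 2 * \<delta>) 0 else if i \<le> K then max (max (r i - 1) 0 - \<delta>) 0 else 0)" for \<delta> :: real
  have "f \<delta> \<in> achievable K hdir hc P n0" if "\<delta> > 0" for \<delta>
    unfolding f_def
    by (rule superposition_achievable[where b=b and \<rho>="\<lambda>i. max (r i - 1) 0"])
       (use assms P0 inr mono bA bC bmono r0 that in auto)
  then have sub: "f ` {0<..<1} \<subseteq> capacity_region K hdir hc P n0"
    unfolding capacity_region_def by (auto intro: subsetD[OF closure_subset])
  have "continuous_on (closure {0<..<1}) f"
    unfolding f_def
  proof (rule continuous_on_coordinatewise_then_product)
    fix i
    show "continuous_on (closure {0<..<1}) (\<lambda>\<delta>. if i = 0 then max (r0 - 2 * \<delta>) 0 else if i \<le> K then max (max (r i - 1) 0 - \<delta>) 0 else 0)"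
      by (cases "i = 0"; cases "i \<le> K") (auto intro!: continuous_intros)
  qed
  then have "f ` closure {0<..<1} \<subseteq> capacity_region K hdir hc P n0"
    by (rule image_closure_subset[OF _ _ sub]) (simp add: capacity_region_def)
  then have "f 0 \<in> capacity_region K hdir hc P n0" by auto
  moreover have "f 0 = (\<lambda>i. if i = 0 then max (r 0 - real (2 * K + 1)) 0 else if i \<le> K then max (r i - 1) 0 else 0)"
    by (auto simp: f_def r0_def fun_eq_iff)
  ultimately show "(\<lambda>i. if i = 0 then max (r 0 - real (2 * K + 1)) 0
            else if i \<le> K then max (r i - 1) 0 else 0) \<in> capacity_region K hdir hc P n0" by simp
qed

end
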